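(* The matroid $M_q$ satisfies: (a) For $q\ge 7$, the inclusion-minimal elements of $N_1$ are exactly the complements in $E=\mathbb{A}^2_q$ of the affine zero sets $\mathsf{C}\cap\mathbb{A}^2_q$ of conics $\mathsf{C}$ of the following types: (e) pair of distinct lines, neither equal to $L$, meeting at a point of $L$; (d) pair of lines meeting outside $L$; (h) irreducible conic with no rational point on $L$; (g) irreducible conic tangent to $L$; (f) irreducible conic meeting $L$ in two rational points. For $q=5$ they are the complements of the affine zero sets of conics of types (e),(d),(h),(g); for $q=4$ of types (e),(d),(h); for $q=3$ of types (e),(d); and for $q=2$ they are the complements of the affine zero sets of cardinality $3$ arising from conics of types (d) and (h). (b) Assume $q\ge 3$. The inclusion-minimal elements of $N_2$ are all the $(q^2+q)(q^2-q)$ complements of sets consisting of all $q$ points of an affine line together with one additional point, and all the $\frac{q^2(q^2-1)(q^2-q)(q^2-3q+3)}{24}$ complements of sets of four points no three of which are collinear. The inclusion-minimal elements of $N_3$ are all the $q^2+q$ complements of the $q$ points of an affine line, and all the $\frac{q^2(q^2-1)(q^2-q)}{6}$ complements of sets of three non-collinear points. The inclusion-minimal elements of $N_4$ are all the $\binom{q^2}{2}$ complements of two-point sets. The inclusion-minimal elements of $N_5$ are all the $q^2$ complements of single points. The only (minimal) element of $N_6$ is $E$. (c) For $q=2$, the inclusion-minimal elements of $N_i$, for $i=0,1,\dots,4$, are the subsets of $\mathbb{F}_2^2$ of cardinality $i$.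
   Context: Let $q$ be a prime power and identify $E=\{1,\dots,q^2\}$ with the points of $\mathbb{A}^2_q=\mathbb{F}_q^2$ via a fixed ordering $P_1,\dots,P_{q^2}$. For $q\ge 3$, $C_q=\mathrm{RM}_q(2,2)=\{(f(P_1),\dots,f(P_{q^2})): f\in\mathbb{F}_q[x,y],\deg f\le 2\}$; for $q=2$, $C_2$ is spanned by the evaluation vectors of $x^2,xy,y^2,1$ (so $C_2=\mathbb{F}_2^4$). $M_q$ is the parity check matroid of $C_q$ (independent sets: sets of column indices of a parity check matrix whose columns are linearly independent), with rank function $r$, nullity $n(\sigma)=|\sigma|-r(\sigma)$, and $N_i=\{\sigma\subseteq E: n(\sigma)=i\}$. $\mathbb{P}^2_q$ has coordinates $(x:y:z)$, $L$ is the line $z=0$, $\mathbb{A}^2_q=\mathbb{P}^2_q\setminus L$; a conic is the set of rational zeros of a nonzero homogeneous quadratic polynomial in $x,y,z$, and its affine zero set is its intersection with $\mathbb{A}^2_q$. *)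

theory Defs
  imports
    "Jordan_Normal_Form.Matrix_Kernel"
    "HOL-Algebra.Algebraic_Closure_Type"
    "HOL-Library.Poly_Mapping"
    "HOL-Library.Numeral_Type"
begin

section \<open>Polynomials in finitely many variables\<close>

text \<open>
  A polynomial with variables indexed by \<open>'v\<close> is a finitely supported map from exponent vectors
  to coefficients; the multiplication of \<open>\<Rightarrow>\<^sub>0\<close> is polynomial multiplication.
  The index type \<open>2 = {0, 1}\<close> gives \<open>K[x,y]\<close>, and \<open>3 = {0, 1, 2}\<close> gives \<open>K[x,y,z]\<close>.
  Accordingly \<open>2 \<Rightarrow> 'a\<close> is the affine plane and triples are of type \<open>3 \<Rightarrow> 'a\<close>.
\<close>

type_synonym ('v, 'a) mpoly = "('v \<Rightarrow>\<^sub>0 nat) \<Rightarrow>\<^sub>0 'a"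

definition pvar :: "'v \<Rightarrow> ('v, 'a::comm_semiring_1) mpoly" where
  "pvar i = Poly_Mapping.single (Poly_Mapping.single i 1) 1"

definition peval :: "('v, 'a::comm_semiring_1) mpoly \<Rightarrow> ('v \<Rightarrow> 'a) \<Rightarrow> 'a" where
  "peval f a = (\<Sum>m\<in>Poly_Mapping.keys f. Poly_Mapping.lookup f m *
                  (\<Prod>i\<in>Poly_Mapping.keys m. a i ^ Poly_Mapping.lookup m i))"

definition mon_degree :: "('v \<Rightarrow>\<^sub>0 nat) \<Rightarrow> nat" where
  "mon_degree m = (\<Sum>i\<in>Poly_Mapping.keys m. Poly_Mapping.lookup m i)"

text \<open>The zero polynomial gets total degree 0.\<close>

definition total_degree :: "('v, 'a::zero) mpoly \<Rightarrow> nat" where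
  "total_degree f = Max (insert 0 (mon_degree ` Poly_Mapping.keys f))"

definition homogeneous :: "nat \<Rightarrow> ('v, 'a::zero) mpoly \<Rightarrow> bool" where
  "homogeneous d f \<longleftrightarrow> (\<forall>m\<in>Poly_Mapping.keys f. mon_degree m = d)"

definition absolutely_irreducible :: "('v, 'a::field) mpoly \<Rightarrow> bool" where
  "absolutely_irreducible f \<longleftrightarrow>
     Factorial_Ring.irreducible (Poly_Mapping.map to_ac f :: ('v, 'a alg_closure) mpoly)"


section \<open>Matroids of parity check matrices\<close>

definition parity_check_matrix :: "nat \<Rightarrow> 'a::field vec set \<Rightarrow> 'a mat \<Rightarrow> bool" where
  "parity_check_matrix n C H \<longleftrightarrow> dim_col H = n \<and> mat_kernel H = C"

text \<open>
  The ground set is \<open>{1..n}\<close>, while matrix and vector indices start at 0, so that element \<open>j\<close>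
  corresponds to column \<open>j - 1\<close>. Linear independence is that of the family of columns:
  a set of indices with a repeated column is dependent, whence the injectivity condition.
\<close>

definition parity_check_matroid :: "'a::field mat \<Rightarrow> nat set set" where
  "parity_check_matroid H =
     {\<sigma>. \<sigma> \<subseteq> {1..dim_col H} \<and> inj_on (\<lambda>j. col H (j - 1)) \<sigma> \<and>
        \<not> LinearCombinations.module.lin_dep class_ring (module_vec TYPE('a) (dim_row H))
             ((\<lambda>j. col H (j - 1)) ` \<sigma>)}"

definition matroid_rank :: "'e set set \<Rightarrow> 'e set \<Rightarrow> nat" where
  "matroid_rank \<I> \<sigma> = Max (card ` {I \<in> \<I>. I \<subseteq> \<sigma>})"

definition nullity :: "'e set set \<Rightarrow> 'e set \<Rightarrow> nat" where
  "nullity \<I> \<sigma> = card \<sigma> - matroid_rank \<I> \<sigma>"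

definition nullity_sets :: "'e set \<Rightarrow> 'e set set \<Rightarrow> nat \<Rightarrow> 'e set set" where
  "nullity_sets E \<I> i = {\<sigma>. \<sigma> \<subseteq> E \<and> nullity \<I> \<sigma> = i}"

definition minimal_sets :: "'e set set \<Rightarrow> 'e set set" where
  "minimal_sets \<F> = {\<sigma> \<in> \<F>. \<forall>\<tau>\<in>\<F>. \<tau> \<subseteq> \<sigma> \<longrightarrow> \<tau> = \<sigma>}"


section \<open>The codes\<close>

text \<open>The points are ordered as \<open>P 1, \<dots>, P (q\<^sup>2)\<close> where \<open>q = CARD('a)\<close>.\<close>

definition eval_vec :: "(nat \<Rightarrow> (2 \<Rightarrow> 'a)) \<Rightarrow> (2, 'a::{field,finite}) mpoly \<Rightarrow> 'a vec" where
  "eval_vec P f = vec (CARD('a) ^ 2) (\<lambda>i. peval f (P (Suc i)))"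

definition RM_code :: "(nat \<Rightarrow> (2 \<Rightarrow> 'a::{field,finite})) \<Rightarrow> nat \<Rightarrow> 'a vec set" where
  "RM_code P d = {eval_vec P f | f. total_degree f \<le> d}"

definition conic_code :: "(nat \<Rightarrow> (2 \<Rightarrow> 'a::{field,finite})) \<Rightarrow> 'a vec set" where
  "conic_code P =
     (if CARD('a) = 2
      then LinearCombinations.module.span class_ring (module_vec TYPE('a) (CARD('a) ^ 2))
             (eval_vec P ` {pvar 0 ^ 2, pvar 0 * pvar 1, pvar 1 ^ 2, 1})
      else RM_code P 2)"


section \<open>The projective plane and conics\<close>

text \<open>Points are the classes \<open>(x:y:z)\<close> of nonzero triples up to nonzero scalars.\<close>

definition proj_point :: "(3 \<Rightarrow> 'a::field) \<Rightarrow> (3 \<Rightarrow> 'a) set" where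
  "proj_point v = {\<lambda>i. c * v i | c. c \<noteq> 0}"

definition proj_plane :: "(3 \<Rightarrow> 'a::field) set set" where
  "proj_plane = {proj_point v | v. v \<noteq> (\<lambda>_. 0)}"

definition proj_zeros :: "(3, 'a::field) mpoly \<Rightarrow> (3 \<Rightarrow> 'a) set set" where
  "proj_zeros F = {p \<in> proj_plane. \<forall>v\<in>p. peval F v = 0}"

definition proj_line :: "(3 \<Rightarrow> 'a::field) set set \<Rightarrow> bool" where
  "proj_line l \<longleftrightarrow> (\<exists>G. G \<noteq> 0 \<and> homogeneous 1 G \<and> l = proj_zeros G)"

definition line_at_infinity :: "(3 \<Rightarrow> 'a::field) set set" where
  "line_at_infinity = proj_zeros (pvar 2)"

text \<open>The embedding \<open>(x,y) \<mapsto> (x:y:1)\<close> identifies the affine plane with \<open>z \<noteq> 0\<close>.\<close>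

definition embed :: "(2 \<Rightarrow> 'a::field) \<Rightarrow> (3 \<Rightarrow> 'a) set" where
  "embed p = proj_point (\<lambda>i. if i = 0 then p 0 else if i = 1 then p 1 else 1)"

definition affine_part :: "(3 \<Rightarrow> 'a::field) set set \<Rightarrow> (2 \<Rightarrow> 'a) set" where
  "affine_part Z = {p. embed p \<in> Z}"

definition quadratic_form :: "(3, 'a::field) mpoly \<Rightarrow> bool" where
  "quadratic_form F \<longleftrightarrow> F \<noteq> 0 \<and> homogeneous 2 F"

definition conic :: "(3 \<Rightarrow> 'a::field) set set \<Rightarrow> bool" where
  "conic C \<longleftrightarrow> (\<exists>F. quadratic_form F \<and> C = proj_zeros F)"

text \<open>
  The line \<open>l\<close> is tangent to the curve \<open>F = 0\<close> at the rational point \<open>p\<close> if it passes through \<open>p\<close> and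
  has intersection multiplicity at least 2 with the curve there: for \<open>p = (u)\<close> and every
  \<open>(v)\<close> on \<open>l\<close>, the polynomial \<open>F(u + T v)\<close> in the indeterminate \<open>T\<close> vanishes to order at least 2
  at \<open>T = 0\<close>.
\<close>

definition tangent_at :: "(3, 'a::field) mpoly \<Rightarrow> (3 \<Rightarrow> 'a) set set \<Rightarrow> (3 \<Rightarrow> 'a) set \<Rightarrow> bool" where
  "tangent_at F l p \<longleftrightarrow> p \<in> proj_zeros F \<inter> l \<and>
     (\<forall>u v. u \<in> p \<and> proj_point v \<in> l \<longrightarrow>
        [:0, 1:] ^ 2 dvd peval (Poly_Mapping.map (\<lambda>c. [:c:]) F) (\<lambda>i. [:u i, v i:]))"

text \<open>
  An irreducible conic is one given by an absolutely irreducible form: a pair of conjugate lines,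
  which is irreducible over the ground field only, does not count.
\<close>

definition conic_type_d :: "(3 \<Rightarrow> 'a::field) set set \<Rightarrow> bool" where
  "conic_type_d C \<longleftrightarrow> conic C \<and>
     (\<exists>l m p. proj_line l \<and> proj_line m \<and> l \<noteq> m \<and> C = l \<union> m \<and>
        l \<inter> m = {p} \<and> p \<notin> line_at_infinity)"

definition conic_type_e :: "(3 \<Rightarrow> 'a::field) set set \<Rightarrow> bool" where
  "conic_type_e C \<longleftrightarrow> conic C \<and>
     (\<exists>l m p. proj_line l \<and> proj_line m \<and> l \<noteq> m \<and> l \<noteq> line_at_infinity \<and> m \<noteq> line_at_infinity \<and>
        C = l \<union> m \<and> l \<inter> m = {p} \<and> p \<in> line_at_infinity)"

definition conic_type_f :: "(3 \<Rightarrow> 'a::field) set set \<Rightarrow> bool" where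
  "conic_type_f C \<longleftrightarrow>
     (\<exists>F. quadratic_form F \<and> absolutely_irreducible F \<and> C = proj_zeros F \<and>
        card (C \<inter> line_at_infinity) = 2)"

definition conic_type_g :: "(3 \<Rightarrow> 'a::field) set set \<Rightarrow> bool" where
  "conic_type_g C \<longleftrightarrow>
     (\<exists>F. quadratic_form F \<and> absolutely_irreducible F \<and> C = proj_zeros F \<and>
        (\<exists>p. tangent_at F line_at_infinity p))"

definition conic_type_h :: "(3 \<Rightarrow> 'a::field) set set \<Rightarrow> bool" where
  "conic_type_h C \<longleftrightarrow>
     (\<exists>F. quadratic_form F \<and> absolutely_irreducible F \<and> C = proj_zeros F \<and>
        C \<inter> line_at_infinity = {})"


section \<open>Affine lines and complements\<close>

definition affine_line :: "(2 \<Rightarrow> 'a::field) set \<Rightarrow> bool" where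
  "affine_line l \<longleftrightarrow> (\<exists>a b c. (a \<noteq> 0 \<or> b \<noteq> 0) \<and> l = {p. a * p 0 + b * p 1 + c = 0})"

definition collinear_points :: "(2 \<Rightarrow> 'a::field) set \<Rightarrow> bool" where
  "collinear_points S \<longleftrightarrow> (\<exists>l. affine_line l \<and> S \<subseteq> l)"

text \<open>The complement of a set of points, as a set of indices in \<open>E = {1..q\<^sup>2}\<close>.\<close>

definition index_compl :: "(nat \<Rightarrow> (2 \<Rightarrow> 'a::{field,finite})) \<Rightarrow> (2 \<Rightarrow> 'a) set \<Rightarrow> nat set" where
  "index_compl P Z = {j \<in> {1..CARD('a) ^ 2}. P j \<notin> Z}"

definition line_and_point_sets :: "(2 \<Rightarrow> 'a::field) set set" where
  "line_and_point_sets = {insert p l | p l. affine_line l \<and> p \<notin> l}"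

definition quadrangles :: "(2 \<Rightarrow> 'a::field) set set" where
  "quadrangles = {S. card S = 4 \<and> (\<forall>T\<subseteq>S. card T = 3 \<longrightarrow> \<not> collinear_points T)}"

definition triangles :: "(2 \<Rightarrow> 'a::field) set set" where
  "triangles = {S. card S = 3 \<and> \<not> collinear_points S}"

end

(*
  Let Z be the complement of a set of columns. The nullity of that set is the dimension of the space of
  quadrics (polynomials of degree at most 2, viewed as ternary quadratic forms restricted to z = 1) that
  vanish on Z, so for q >= 3 the minimal sets of nullity i are the complements of the flats: the sets Z that
  contain every common zero of the quadrics through Z, and for which this space has q^i elements. Flats grow
  by adding one point outside the base locus, which divides the number of quadrics by q. Products of two
  linear forms compute the base loci of at most four independent points, which gives i >= 2. For i = 1 a flat
  is the zero set of a single quadric: if it has three collinear points it is a pair of lines, and otherwise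
  it is an arc with at least five points, which forces absolute irreducibility, since two lines over the
  algebraic closure cannot cover five points in general position. An absolutely irreducible conic has q + 1
  rational points, so the condition of having at least five affine points depends only on q and on the
  number of points on the line at infinity.
*)
theory Submission
  imports Defs
begin

text \<open>Points, lines and quadrics all live in homogeneous coordinates: an affine point is
  \<open>(x, y, 1)\<close> and a polynomial of degree at most 2 is a ternary form with six
  coefficients, so the affine code and the projective conics share one algebra. Characteristic 2 has
  to be included, which is why quadratic forms are studied through their coefficients and their
  polar form and never through a Gram matrix; only the existence of a rational point on a conic is
  proved separately for the two parities. Dimensions enter as cardinalities: a space of dimension
  \<open>i\<close> is recognised by having \<open>q^i\<close> elements. All forms together number
  \<open>q^6\<close>, so five independent points are what it takes to leave a single form up to
  scalars, and the bounds on \<open>q\<close> come from \<open>q + 1 - k \<ge> 5\<close>, where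
  \<open>k \<le> 2\<close> counts the points on the line at infinity. Irreducibility has to be
  absolute, so criteria for splitting are proved over arbitrary fields and then applied over the
  algebraic closure. For \<open>q = 2\<close> distinct forms can agree at every affine point, since
  \<open>x^2 + x\<close> vanishes there, and the code is the whole space; that case is treated on
  its own.\<close>

no_notation fps_nth (infixl "$" 75)

alias keys = Poly_Mapping.keys
alias lookup = Poly_Mapping.lookup
alias single = Poly_Mapping.single

section \<open>Evaluation of polynomials\<close>

lemma three_elements:
  assumes "3 \<le> card A"
  obtains a b c where "a \<in> A" "b \<in> A" "c \<in> A" "a \<noteq> b" "a \<noteq> c" "b \<noteq> c"
proof (rule obtain_subset_with_card_n[OF assms])
  fix T assume "T \<subseteq> A" "card T = 3"
  then show thesis using that by (auto simp: card_3_iff)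
qed

lemma UNIV_2: "(UNIV :: 2 set) = {0, 1}"
  by (rule sym, rule card_subset_eq) auto

lemma UNIV_3: "(UNIV :: 3 set) = {0, 1, 2}"
  by (rule sym, rule card_subset_eq) auto

lemma sum_UNIV_3: "(\<Sum>i\<in>(UNIV::3 set). f i) = f 0 + f 1 + f 2"
  unfolding UNIV_3 by (simp add: add.assoc)

lemma all_2: "(\<forall>i::2. Q i) \<longleftrightarrow> Q 0 \<and> Q 1"
  using UNIV_2 by (metis UNIV_I empty_iff insert_iff)

lemma all_3: "(\<forall>i::3. Q i) \<longleftrightarrow> Q 0 \<and> Q 1 \<and> Q 2"
  using UNIV_3 by (metis UNIV_I empty_iff insert_iff)

lemma fun_eq_3: "u = v \<longleftrightarrow> u (0::3) = v 0 \<and> u 1 = v 1 \<and> u 2 = v 2"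
  using all_3[of "\<lambda>i. u i = v i"] by (auto simp: fun_eq_iff)

lemma fun_eq_2: "u = v \<longleftrightarrow> u (0::2) = v 0 \<and> u 1 = v 1"
  using all_2[of "\<lambda>i. u i = v i"] by (auto simp: fun_eq_iff)

lemma poly_mapping_sum_single: "f = (\<Sum>m\<in>keys f. single m (lookup f m))"
proof (rule poly_mapping_eqI)
  fix k
  have "(\<Sum>m\<in>keys f. lookup f m when m = k) = lookup f k"
    by (simp add: when_def sum.delta in_keys_iff)
  then show "lookup f k = lookup (\<Sum>m\<in>keys f. single m (lookup f m)) k"
    by (simp add: lookup_sum lookup_single)
qed

lemma prod_power_single:
  "(\<Prod>k\<in>UNIV. (v :: 'v::finite \<Rightarrow> 'a::comm_semiring_1) k ^ lookup (single i 1) k) = v i"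
proof -
  have "(\<Prod>k\<in>UNIV. v k ^ (1 when i = k)) = (\<Prod>k\<in>UNIV. if k = i then v k else 1)"
    by (rule prod.cong) (auto simp: when_def)
  then show ?thesis by (simp add: lookup_single)
qed

context
  fixes a :: "'v::finite \<Rightarrow> 'a::comm_semiring_1"
begin

text \<open>Evaluation sums over the support of \<open>f\<close>, but sums for different polynomials
  can only be combined over a common index set. Monomials outside the support have coefficient 0,
  and variables absent from a monomial contribute \<open>a i ^ 0 = 1\<close>.\<close>

lemma peval_superset:
  assumes "finite M" "keys f \<subseteq> M"
  shows "peval f a = (\<Sum>m\<in>M. lookup f m * (\<Prod>i\<in>UNIV. a i ^ lookup m i))"
proof -
  have *: "(\<Prod>i\<in>keys m. a i ^ lookup m i) = (\<Prod>i\<in>UNIV. a i ^ lookup m i)" for m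
    by (rule prod.mono_neutral_left) (auto simp: in_keys_iff)
  show ?thesis
    unfolding peval_def * using assms
    by (intro sum.mono_neutral_left) (auto simp: in_keys_iff)
qed

lemma peval_zero [simp]: "peval 0 a = 0"
  by (simp add: peval_def)

lemma peval_add: "peval (f + g) a = peval f a + peval g a"
proof -
  let ?M = "keys f \<union> keys g"
  have "keys (f + g) \<subseteq> ?M" by (rule keys_add)
  then show ?thesis
    by (simp add: peval_superset[of ?M] lookup_add sum.distrib distrib_right)
qed

lemma peval_sum: "peval (sum f I) a = (\<Sum>i\<in>I. peval (f i) a)"
  by (induction I rule: infinite_finite_induct) (auto simp: peval_add)

lemma peval_single: "peval (single m c) a = c * (\<Prod>i\<in>UNIV. a i ^ lookup m i)"
  by (subst peval_superset[of "{m}"]) auto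

lemma peval_one [simp]: "peval 1 a = 1"
  using peval_single[of 0 1] by simp

lemma peval_mult: "peval (f * g) a = peval f a * peval g a"
proof -
  let ?s = "\<lambda>f m. single m (lookup f m)"
  have "f * g = (\<Sum>m\<in>keys f. ?s f m) * (\<Sum>m\<in>keys g. ?s g m)"
    using poly_mapping_sum_single by metis
  also have "\<dots> = (\<Sum>m\<in>keys f. \<Sum>n\<in>keys g. ?s f m * ?s g n)"
    by (simp add: sum_product)
  finally have "peval (f * g) a = (\<Sum>m\<in>keys f. \<Sum>n\<in>keys g. peval (?s f m) a * peval (?s g n) a)"
    by (simp add: peval_sum mult_single peval_single lookup_add power_add prod.distrib mult_ac)
  also have "\<dots> = peval (\<Sum>m\<in>keys f. ?s f m) a * peval (\<Sum>m\<in>keys g. ?s g m) a"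
    by (simp add: peval_sum sum_product)
  finally show ?thesis using poly_mapping_sum_single by metis
qed

lemma peval_power: "peval (f ^ n) a = peval f a ^ n"
  by (induction n) (auto simp: peval_mult)

lemma peval_pvar [simp]: "peval (pvar i) a = a i"
  unfolding pvar_def peval_single prod_power_single by simp

end

lemma mon_degree_UNIV: "mon_degree m = (\<Sum>i\<in>(UNIV::'v::finite set). lookup m i)"
  unfolding mon_degree_def by (rule sum.mono_neutral_left) (auto simp: in_keys_iff)

lemma mon_degree_add: "mon_degree (m + n) = mon_degree m + mon_degree (n :: 'v::finite \<Rightarrow>\<^sub>0 nat)"
  by (simp add: mon_degree_UNIV lookup_add sum.distrib)

lemma mon_degree_single [simp]: "mon_degree (single i n) = n"
  by (simp add: mon_degree_def)

lemma mon_degree_zero_iff: "mon_degree (m :: 'v::finite \<Rightarrow>\<^sub>0 nat) = 0 \<longleftrightarrow> m = 0"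
  by (auto simp: mon_degree_UNIV intro: poly_mapping_eqI)

lemma total_degree_le_iff: "total_degree f \<le> d \<longleftrightarrow> (\<forall>m\<in>keys f. mon_degree m \<le> d)"
  unfolding total_degree_def by (subst Max_le_iff) auto

lemma homogeneous_add:
  "homogeneous d f \<Longrightarrow> homogeneous d g \<Longrightarrow> homogeneous d (f + g)"
  using keys_add[of f g] by (auto simp: homogeneous_def)

lemma homogeneous_single: "mon_degree m = d \<Longrightarrow> homogeneous d (single m c)"
  by (cases "c = 0") (auto simp: homogeneous_def)

lemma homogeneous_mult:
  fixes f g :: "('v::finite, 'a::semiring_0) mpoly"
  assumes "homogeneous d f" "homogeneous e g" shows "homogeneous (d + e) (f * g)"
  using assms keys_mult[of f g] unfolding homogeneous_def by (force simp: mon_degree_add)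

lemma homogeneous_map:
  "homogeneous d f \<Longrightarrow> homogeneous d (Poly_Mapping.map h f)"
  unfolding homogeneous_def by (auto simp: in_keys_iff map.rep_eq when_def split: if_splits)


section \<open>Linear and quadratic ternary forms\<close>

text \<open>The exponent vector of a product of two variables; for \<open>i = j\<close> the
  exponents add up to 2, so squares and mixed products share one formula.\<close>

definition mon2 :: "3 \<Rightarrow> 3 \<Rightarrow> (3 \<Rightarrow>\<^sub>0 nat)" where
  "mon2 i j = single i 1 + single j 1"

text \<open>For \<open>i \<noteq> j\<close> this is the full coefficient of the mixed monomial, not
  half of it as in a Gram matrix, so that characteristic 2 is included.\<close>

definition cf :: "(3, 'a::zero) mpoly \<Rightarrow> 3 \<Rightarrow> 3 \<Rightarrow> 'a" where
  "cf F i j = lookup F (mon2 i j)"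

lemma mon_degree_mon2: "mon_degree (mon2 i j) = 2"
  by (simp add: mon2_def mon_degree_add)

lemma prod_power_mon2:
  "(\<Prod>k\<in>UNIV. (v :: 3 \<Rightarrow> 'a::comm_semiring_1) k ^ lookup (mon2 i j) k) = v i * v j"
  unfolding mon2_def lookup_add power_add prod.distrib prod_power_single ..

lemma mon_degree_2_cases:
  assumes "mon_degree (m :: 3 \<Rightarrow>\<^sub>0 nat) = 2"
  shows "m \<in> {mon2 0 0, mon2 1 1, mon2 2 2, mon2 0 1, mon2 0 2, mon2 1 2}"
proof -
  let ?l = "lookup m"
  have eq: "m = mon2 i j \<longleftrightarrow> ?l 0 = lookup (mon2 i j) 0 \<and> ?l 1 = lookup (mon2 i j) 1 \<and> ?l 2 = lookup (mon2 i j) 2" for i j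
    unfolding poly_mapping_eq_iff fun_eq_3 ..
  have s: "?l 0 + ?l 1 + ?l 2 = 2"
    using assms unfolding mon_degree_UNIV sum_UNIV_3 .
  then have "?l 0 = 0 \<or> ?l 0 = 1 \<or> ?l 0 = 2" "?l 1 = 0 \<or> ?l 1 = 1 \<or> ?l 1 = 2" by linarith+
  then show ?thesis
    unfolding eq insert_iff using s by (elim disjE) (simp_all add: mon2_def lookup_add lookup_single)
qed

lemma mon_degree_1_cases:
  assumes "mon_degree (m :: 3 \<Rightarrow>\<^sub>0 nat) = 1"
  shows "m \<in> {single 0 1, single 1 1, single 2 1}"
proof -
  let ?l = "lookup m"
  have eq: "m = single i 1 \<longleftrightarrow> ?l 0 = lookup (single i 1) 0
      \<and> ?l 1 = lookup (single i 1) 1 \<and> ?l 2 = lookup (single i 1) 2" for i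
    unfolding poly_mapping_eq_iff fun_eq_3 ..
  have s: "?l 0 + ?l 1 + ?l 2 = 1"
    using assms unfolding mon_degree_UNIV sum_UNIV_3 .
  then have "?l 0 = 0 \<or> ?l 0 = 1" "?l 1 = 0 \<or> ?l 1 = 1" by linarith+
  then show ?thesis
    unfolding eq insert_iff using s by (elim disjE) (simp_all add: lookup_single)
qed

lemma mon2_distinct:
  "mon2 0 0 \<noteq> mon2 1 1" "mon2 0 0 \<noteq> mon2 2 2" "mon2 0 0 \<noteq> mon2 0 1" "mon2 0 0 \<noteq> mon2 0 2" "mon2 0 0 \<noteq> mon2 1 2"
  "mon2 1 1 \<noteq> mon2 2 2" "mon2 1 1 \<noteq> mon2 0 1" "mon2 1 1 \<noteq> mon2 0 2" "mon2 1 1 \<noteq> mon2 1 2"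
  "mon2 2 2 \<noteq> mon2 0 1" "mon2 2 2 \<noteq> mon2 0 2" "mon2 2 2 \<noteq> mon2 1 2"
  "mon2 0 1 \<noteq> mon2 0 2" "mon2 0 1 \<noteq> mon2 1 2" "mon2 0 2 \<noteq> mon2 1 2"
  unfolding mon2_def poly_mapping_eq_iff fun_eq_3 lookup_add lookup_single by (simp_all add: when_def)

lemma sum_6:
  assumes "distinct [a, b, c, d, e, g]"
  shows "sum f {a, b, c, d, e, g} = f a + f b + f c + f d + f e + f g"
  using assms by (simp add: add.assoc)

lemma distinct_mon2: "distinct [mon2 0 0, mon2 1 1, mon2 2 2, mon2 0 1, mon2 0 2, mon2 1 (2::3)]"
  using mon2_distinct by simp

text \<open>Once the six coefficients are exposed, identities about quadratic forms become ring
  identities that simplification can check.\<close>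

lemma peval_form:
  fixes F :: "(3, 'a::comm_semiring_1) mpoly"
  assumes "homogeneous 2 F"
  shows "peval F v = cf F 0 0 * (v 0 * v 0) + cf F 1 1 * (v 1 * v 1) + cf F 2 2 * (v 2 * v 2)
           + cf F 0 1 * (v 0 * v 1) + cf F 0 2 * (v 0 * v 2) + cf F 1 2 * (v 1 * v 2)"
proof -
  let ?M = "{mon2 0 0, mon2 1 1, mon2 2 2, mon2 0 1, mon2 0 2, mon2 1 2}"
  have "keys F \<subseteq> ?M"
    using assms mon_degree_2_cases unfolding homogeneous_def by blast
  from peval_superset[OF _ this] show ?thesis
    by (simp only: finite.intros prod_power_mon2 sum_6[OF distinct_mon2] cf_def simp_thms)
qed

definition form :: "'a \<Rightarrow> 'a \<Rightarrow> 'a \<Rightarrow> 'a \<Rightarrow> 'a \<Rightarrow> 'a \<Rightarrow> (3, 'a::comm_monoid_add) mpoly" where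
  "form a b c d e g = single (mon2 0 0) a + single (mon2 1 1) b
     + single (mon2 2 2) c + single (mon2 0 1) d
     + single (mon2 0 2) e + single (mon2 1 2) g"

lemma homogeneous_form: "homogeneous 2 (form a b c d e g)"
  unfolding form_def by (intro homogeneous_add homogeneous_single mon_degree_mon2)

lemma cf_form [simp]:
  "cf (form a b c d e g) 0 0 = a" "cf (form a b c d e g) 1 1 = b" "cf (form a b c d e g) 2 2 = c"
  "cf (form a b c d e g) 0 1 = d" "cf (form a b c d e g) 0 2 = e" "cf (form a b c d e g) 1 2 = g"
  unfolding cf_def form_def
  by (simp_all only: lookup_add lookup_single mon2_distinct mon2_distinct[symmetric] when_simps refl add_0_left add_0_right)

lemma form_eqI:
  assumes "homogeneous 2 F" "homogeneous 2 G"
    "cf F 0 0 = cf G 0 0" "cf F 1 1 = cf G 1 1" "cf F 2 2 = cf G 2 2"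
    "cf F 0 1 = cf G 0 1" "cf F 0 2 = cf G 0 2" "cf F 1 2 = cf G 1 2"
  shows "F = G"
proof (rule poly_mapping_eqI)
  fix m
  show "lookup F m = lookup G m"
  proof (cases "mon_degree m = 2")
    case True
    then show ?thesis using mon_degree_2_cases[OF True] assms by (auto simp: cf_def)
  next
    case False
    then have "m \<notin> keys F" "m \<notin> keys G"
      using assms by (auto simp: homogeneous_def)
    then show ?thesis by (simp add: in_keys_iff)
  qed
qed

lemma form_cf: "homogeneous 2 F \<Longrightarrow> form (cf F 0 0) (cf F 1 1) (cf F 2 2) (cf F 0 1) (cf F 0 2) (cf F 1 2) = F"
  by (rule form_eqI) (auto simp: homogeneous_form)

definition vec3 :: "'a \<Rightarrow> 'a \<Rightarrow> 'a \<Rightarrow> 3 \<Rightarrow> 'a" where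
  "vec3 x y z i = (if i = 0 then x else if i = 1 then y else z)"

lemma vec3_simps [simp]: "vec3 x y z 0 = x" "vec3 x y z 1 = y" "vec3 x y z 2 = z"
  by (auto simp: vec3_def)

text \<open>Values at the unit vectors give the coefficients of the squares, and values at sums of
  two unit vectors then give the mixed ones. This determines a form over every commutative ring,
  however small.\<close>

lemma form_eq_peval:
  fixes F G :: "(3, 'a::comm_ring_1) mpoly"
  assumes "homogeneous 2 F" "homogeneous 2 G" "\<And>v. peval F v = peval G v"
  shows "F = G"
proof -
  note e = assms(3)[unfolded peval_form[OF assms(1)] peval_form[OF assms(2)]]
  show ?thesis
    using e[of "vec3 1 0 0"] e[of "vec3 0 1 0"] e[of "vec3 0 0 1"]
      e[of "vec3 1 1 0"] e[of "vec3 1 0 1"] e[of "vec3 0 1 1"]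
    by (intro form_eqI assms(1,2)) auto
qed

definition lin :: "(3 \<Rightarrow> 'a) \<Rightarrow> (3, 'a::comm_monoid_add) mpoly" where
  "lin n = single (single 0 1) (n 0)
     + single (single 1 1) (n 1)
     + single (single 2 1) (n 2)"

definition dot :: "(3 \<Rightarrow> 'a::comm_semiring_1) \<Rightarrow> (3 \<Rightarrow> 'a) \<Rightarrow> 'a" where
  "dot u v = u 0 * v 0 + u 1 * v 1 + u 2 * v 2"

lemma homogeneous_lin: "homogeneous 1 (lin n)"
  unfolding lin_def by (intro homogeneous_add homogeneous_single) auto

lemma peval_lin [simp]: "peval (lin n) v = dot n v"
  unfolding lin_def dot_def peval_add peval_single prod_power_single ..

lemma lookup_lin: "lookup (lin n) (single i 1) = n i"
  using all_3[of "\<lambda>i. lookup (lin n) (single i 1) = n i"]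
  unfolding lin_def lookup_add lookup_single poly_mapping_eq_iff fun_eq_3 by (simp add: when_def)

lemma lin_eqI:
  assumes "homogeneous 1 F"
  shows "F = lin (\<lambda>i. lookup F (single i 1))"
proof (rule poly_mapping_eqI)
  fix m
  let ?L = "lin (\<lambda>i. lookup F (single i 1))"
  show "lookup F m = lookup ?L m"
  proof (cases "mon_degree m = 1")
    case True
    then show ?thesis using mon_degree_1_cases[OF True] lookup_lin[of "\<lambda>i. lookup F (single i 1)"] by auto
  next
    case False
    then have "m \<notin> keys F" "m \<notin> keys ?L"
      using assms homogeneous_lin by (auto simp: homogeneous_def)
    then show ?thesis by (simp add: in_keys_iff)
  qed
qed

lemma lin_zero_iff: "lin n = 0 \<longleftrightarrow> n = (\<lambda>_. 0)"
proof
  assume "lin n = 0"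
  then show "n = (\<lambda>_. 0)" using lookup_lin[of n] by (auto simp: fun_eq_iff)
qed (simp add: lin_def)

lemma homogeneous_lin_mult: "homogeneous 2 (lin n * lin m :: (3, 'a::comm_semiring_1) mpoly)"
  using homogeneous_mult[OF homogeneous_lin homogeneous_lin] by (simp add: numeral_2_eq_2)

text \<open>The polar form \<open>F(u + v) - F(u) - F(v)\<close>, expanded.\<close>

definition polar :: "(3, 'a::comm_ring_1) mpoly \<Rightarrow> (3 \<Rightarrow> 'a) \<Rightarrow> (3 \<Rightarrow> 'a) \<Rightarrow> 'a" where
  "polar F u v = 2 * cf F 0 0 * (u 0 * v 0) + 2 * cf F 1 1 * (u 1 * v 1) + 2 * cf F 2 2 * (u 2 * v 2)
     + cf F 0 1 * (u 0 * v 1 + u 1 * v 0) + cf F 0 2 * (u 0 * v 2 + u 2 * v 0) + cf F 1 2 * (u 1 * v 2 + u 2 * v 1)"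

text \<open>On the span of \<open>u\<close> and \<open>v\<close> the form becomes a binary quadratic
  form with the polar form as middle coefficient. Containment of lines, singular points and
  intersections with lines are all read off from this expansion.\<close>

lemma peval_comb:
  fixes F :: "(3, 'a::comm_ring_1) mpoly"
  assumes "homogeneous 2 F"
  shows "peval F (\<lambda>i. s * u i + t * v i) = s^2 * peval F u + s * t * polar F u v + t^2 * peval F v"
  unfolding peval_form[OF assms] polar_def by (simp add: algebra_simps power2_eq_square)

lemma peval_scale:
  fixes F :: "(3, 'a::comm_ring_1) mpoly"
  assumes "homogeneous 2 F"
  shows "peval F (\<lambda>i. s * u i) = s^2 * peval F u"
  unfolding peval_form[OF assms] by (simp add: algebra_simps power2_eq_square)

lemma polar_comm: "polar F u v = polar F v u"
  unfolding polar_def by (simp add: algebra_simps)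

lemma polar_comb: "polar F w (\<lambda>i. s * u i + t * v i) = s * polar F w u + t * polar F w v"
  unfolding polar_def by (simp add: algebra_simps)

text \<open>In odd characteristic the polar form thus recovers the quadratic form; in characteristic
  2 it is alternating.\<close>

lemma polar_self:
  fixes F :: "(3, 'a::comm_ring_1) mpoly"
  assumes "homogeneous 2 F"
  shows "polar F u u = 2 * peval F u"
  unfolding peval_form[OF assms] polar_def by (simp add: algebra_simps)


section \<open>Absolute irreducibility of quadratic forms\<close>

text \<open>Terms of degree \<open>i + j\<close> come from \<open>A1 * B1\<close> alone: products
  involving \<open>A2\<close> or \<open>B2\<close> have smaller degree in the first alternative and
  larger degree in the second. The linear order on the variables provides the instance by which
  polynomials have no zero divisors, so \<open>A1 * B1\<close> is nonzero.\<close>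

lemma mult_extreme_degree:
  fixes A1 A2 B1 B2 :: "('v::{finite,linorder}, 'a::idom) mpoly"
  assumes ne: "A1 \<noteq> 0" "B1 \<noteq> 0" and hom: "homogeneous i A1" "homogeneous j B1"
    and less: "(\<forall>m\<in>keys A2. mon_degree m < i) \<and> (\<forall>m\<in>keys B2. mon_degree m < j)
      \<or> (\<forall>m\<in>keys A2. i < mon_degree m) \<and> (\<forall>m\<in>keys B2. j < mon_degree m)"
  shows "\<exists>m\<in>keys ((A1 + A2) * (B1 + B2)). mon_degree m = i + j"
proof -
  have "A1 * B1 \<noteq> 0" using ne by simp
  then obtain m where m: "m \<in> keys (A1 * B1)" by fastforce
  have deg: "mon_degree m = i + j"
    using homogeneous_mult[OF hom] m by (auto simp: homogeneous_def)
  have no: "m \<notin> keys (G * K)"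
    if "\<And>k l. k \<in> keys G \<Longrightarrow> l \<in> keys K \<Longrightarrow> mon_degree k + mon_degree l \<noteq> i + j" for G K
    using that keys_mult[of G K] deg by (force simp: mon_degree_add)
  have "m \<notin> keys (A1 * B2)" "m \<notin> keys (A2 * B1)" "m \<notin> keys (A2 * B2)"
    using less hom by (intro no; force simp: homogeneous_def)+
  moreover have "(A1 + A2) * (B1 + B2) = A1 * B1 + (A1 * B2 + (A2 * B1 + A2 * B2))"
    by (simp add: algebra_simps)
  ultimately have "lookup ((A1 + A2) * (B1 + B2)) m = lookup (A1 * B1) m"
    by (simp add: lookup_add in_keys_iff)
  then show ?thesis using m deg by (metis in_keys_iff)
qed

lemma homogeneous_part:
  fixes A :: "('v::finite, 'a::comm_monoid_add) mpoly"
  assumes "k \<in> keys A" "mon_degree k = i"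
  obtains A1 A2 where "A = A1 + A2" "A1 \<noteq> 0" "homogeneous i A1"
    "\<forall>m\<in>keys A2. m \<in> keys A \<and> mon_degree m \<noteq> i"
proof
  let ?s = "\<lambda>m. single m (lookup A m)"
  let ?K = "{m \<in> keys A. mon_degree m = i}" and ?K' = "{m \<in> keys A. mon_degree m \<noteq> i}"
  have lk: "lookup (sum ?s M) m = (if m \<in> M then lookup A m else 0)" if "finite M" for M m
    using that by (simp add: lookup_sum lookup_single when_def sum.delta)
  have "A = (\<Sum>m\<in>keys A. ?s m)" by (rule poly_mapping_sum_single)
  also have "keys A = ?K \<union> ?K'" by auto
  also have "(\<Sum>m\<in>?K \<union> ?K'. ?s m) = sum ?s ?K + sum ?s ?K'"
    by (rule sum.union_disjoint) auto
  finally show "A = sum ?s ?K + sum ?s ?K'" .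
  have "lookup (sum ?s ?K) k \<noteq> 0"
    using assms by (simp add: lk in_keys_iff)
  then show "sum ?s ?K \<noteq> 0" by auto
  show "homogeneous i (sum ?s ?K)" "\<forall>m\<in>keys (sum ?s ?K'). m \<in> keys A \<and> mon_degree m \<noteq> i"
    unfolding homogeneous_def by (auto simp: in_keys_iff lk split: if_splits)
qed

text \<open>The products of the top-degree parts and of the lowest-degree parts both have degree \<open>d\<close>.\<close>

lemma homogeneous_factors:
  fixes A B :: "('v::{finite,linorder}, 'a::idom) mpoly"
  assumes hom: "homogeneous d (A * B)" and ne: "A * B \<noteq> 0"
  obtains i j where "homogeneous i A" "homogeneous j B" "i + j = d"
proof -
  let ?D = "\<lambda>A. mon_degree ` keys A"
  have fin: "finite (?D A)" "finite (?D B)" by auto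
  have nA: "?D A \<noteq> {}" "?D B \<noteq> {}" using ne by auto
  have key: "i + j = d" if ij: "i \<in> ?D A" "j \<in> ?D B"
    "(\<forall>m\<in>?D A. m \<le> i) \<and> (\<forall>m\<in>?D B. m \<le> j) \<or> (\<forall>m\<in>?D A. i \<le> m) \<and> (\<forall>m\<in>?D B. j \<le> m)" for i j
  proof -
    obtain k l where k: "k \<in> keys A" "mon_degree k = i" and l: "l \<in> keys B" "mon_degree l = j"
      using ij by blast
    obtain A1 A2 where A: "A = A1 + A2" "A1 \<noteq> 0" "homogeneous i A1"
      "\<forall>m\<in>keys A2. m \<in> keys A \<and> mon_degree m \<noteq> i"
      using homogeneous_part[OF k] .
    obtain B1 B2 where B: "B = B1 + B2" "B1 \<noteq> 0" "homogeneous j B1"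
      "\<forall>m\<in>keys B2. m \<in> keys B \<and> mon_degree m \<noteq> j"
      using homogeneous_part[OF l] .
    have "\<exists>m\<in>keys (A * B). mon_degree m = i + j"
      unfolding A(1) B(1) using A(4) B(4) ij(3)
      by (intro mult_extreme_degree[OF A(2) B(2) A(3) B(3)]) (metis imageI le_neq_implies_less)
    then show ?thesis using hom by (auto simp: homogeneous_def)
  qed
  have "Max (?D A) + Max (?D B) = d" "Min (?D A) + Min (?D B) = d"
    using fin nA by (intro key; simp)+
  moreover have "Min (?D A) \<le> Max (?D A)" "Min (?D B) \<le> Max (?D B)"
    using fin nA by (meson Max_in Min_le)+
  \<comment> \<open>The two sums agree while each minimum is at most the corresponding maximum,
    which forces equality in each factor.\<close>
  ultimately have eq: "Min (?D A) = Max (?D A)" "Min (?D B) = Max (?D B)" by linarith+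
  have "homogeneous (Max (?D A)) A" "homogeneous (Max (?D B)) B"
    unfolding homogeneous_def using fin eq by (metis Max_ge Min_le imageI le_antisym)+
  then show ?thesis using that \<open>Max (?D A) + Max (?D B) = d\<close> by blast
qed

lemma homogeneous_0_unit:
  fixes A :: "('v::finite, 'a::field) mpoly"
  assumes "homogeneous 0 A" "A \<noteq> 0" shows "A dvd 1"
proof -
  let ?c = "lookup A 0"
  have A: "A = single 0 ?c"
    using assms(1) by (intro poly_mapping_eqI) (auto simp: lookup_single when_def homogeneous_def in_keys_iff mon_degree_zero_iff)
  then have "?c \<noteq> 0" using assms(2) by (metis single_zero)
  then have "A * single 0 (inverse ?c) = 1"
    by (subst A) (simp add: mult_single)
  then show ?thesis by (metis dvdI)
qed

text \<open>A linear form vanishes at the origin, where a unit cannot vanish.\<close>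

lemma lin_not_unit: "\<not> lin n dvd (1 :: (3, 'a::comm_ring_1) mpoly)"
proof
  assume "lin n dvd (1 :: (3, 'a) mpoly)"
  then obtain g where "(1 :: (3, 'a) mpoly) = lin n * g" by (elim dvdE)
  then have "peval (1 :: (3, 'a) mpoly) (\<lambda>_. 0) = peval (lin n) (\<lambda>_. 0) * peval g (\<lambda>_. 0)"
    by (metis peval_mult)
  then show False by (simp add: dot_def)
qed

text \<open>Factors of a form are homogeneous, here of degrees 0 and 2 or 1 and 1. Factors of degree
  0 are units, so only products of two linear forms can spoil irreducibility.\<close>

lemma irreducible_form_iff:
  fixes F :: "(3, 'a::field) mpoly"
  assumes hom: "homogeneous 2 F" and ne: "F \<noteq> 0"
  shows "Factorial_Ring.irreducible F \<longleftrightarrow> \<not> (\<exists>n m. F = lin n * lin m)"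
proof
  assume "Factorial_Ring.irreducible F"
  then show "\<not> (\<exists>n m. F = lin n * lin m)"
    using lin_not_unit by (metis Factorial_Ring.irreducibleD)
next
  assume no: "\<not> (\<exists>n m. F = lin n * lin m)"
  show "Factorial_Ring.irreducible F"
  proof (rule Factorial_Ring.irreducibleI[OF ne])
    have z: "peval F (\<lambda>_. 0) = 0" by (simp add: peval_form[OF hom])
    show "\<not> F dvd 1"
    proof
      assume "F dvd 1"
      then obtain g where "1 = F * g" by (elim dvdE)
      from arg_cong[OF this, of "\<lambda>h. peval h (\<lambda>_. 0)"] show False
        using z by (simp add: peval_mult)
    qed
  next
    fix A B assume AB: "F = A * B"
    then obtain i j where ij: "homogeneous i A" "homogeneous j B" "i + j = 2"
      using homogeneous_factors hom ne by metis
    have "A \<noteq> 0" "B \<noteq> 0" using AB ne by auto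
    consider "i = 0" | "j = 0" | "i = 1" "j = 1" using ij(3) by linarith
    then show "A dvd 1 \<or> B dvd 1"
    proof cases
      case 3
      then have "\<exists>n. A = lin n" "\<exists>m. B = lin m" using lin_eqI[of A] lin_eqI[of B] ij by auto
      then show ?thesis using AB no by blast
    qed (use homogeneous_0_unit ij \<open>A \<noteq> 0\<close> \<open>B \<noteq> 0\<close> in blast)+
  qed
qed

text \<open>The vector product plays both dual roles: it is the normal vector of the line joining
  two points and the intersection point of two lines. It vanishes exactly on linearly dependent
  pairs.\<close>

definition cross :: "(3 \<Rightarrow> 'a::comm_ring_1) \<Rightarrow> (3 \<Rightarrow> 'a) \<Rightarrow> 3 \<Rightarrow> 'a" where
  "cross u v = vec3 (u 1 * v 2 - u 2 * v 1) (u 2 * v 0 - u 0 * v 2) (u 0 * v 1 - u 1 * v 0)"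

lemma cross_simps [simp]:
  "cross u v 0 = u 1 * v 2 - u 2 * v 1" "cross u v 1 = u 2 * v 0 - u 0 * v 2" "cross u v 2 = u 0 * v 1 - u 1 * v 0"
  by (simp_all add: cross_def)

lemma nonzero_3: "v \<noteq> (\<lambda>_. 0) \<longleftrightarrow> v (0::3) \<noteq> 0 \<or> v 1 \<noteq> 0 \<or> v 2 \<noteq> 0"
  by (auto simp: fun_eq_3)

text \<open>Cramer's rule: the coordinates of \<open>w\<close> relative to \<open>u\<close> and
  \<open>v\<close> are quotients of entries of cross products.\<close>

lemma dot_cross_eq_0D:
  fixes u v w :: "3 \<Rightarrow> 'a::field"
  assumes ne: "cross u v \<noteq> (\<lambda>_. 0)" and z: "dot (cross u v) w = 0"
  shows "\<exists>s t. w = (\<lambda>i. s * u i + t * v i)"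
proof -
  have *: "cross u v i * w j = cross w v i * u j + cross u w i * v j" for i j
  proof -
    \<comment> \<open>The difference is identically 0 off the diagonal and equals the determinant of
      \<open>u\<close>, \<open>v\<close>, \<open>w\<close> on it.\<close>
    have "\<forall>i j. cross u v i * w j - (cross w v i * u j + cross u w i * v j) = (if i = j then dot (cross u v) w else 0)"
      unfolding all_3 dot_def by (simp add: algebra_simps)
    then show ?thesis using z by (metis right_minus_eq)
  qed
  obtain i where i: "cross u v i \<noteq> 0" using ne by auto
  have "w = (\<lambda>j. cross w v i / cross u v i * u j + cross u w i / cross u v i * v j)"
    using *[of i] i by (auto simp: field_simps)
  then show ?thesis by blast
qed

lemma cross_eq_0D:
  fixes u v :: "3 \<Rightarrow> 'a::field"
  assumes "cross u v = (\<lambda>_. 0)" "v \<noteq> (\<lambda>_. 0)"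
  shows "\<exists>s. u = (\<lambda>i. s * v i)"
proof -
  have c: "u 1 * v 2 = u 2 * v 1" "u 2 * v 0 = u 0 * v 2" "u 0 * v 1 = u 1 * v 0"
    using assms(1) by (simp_all add: cross_def fun_eq_3)
  obtain i where i: "v i \<noteq> 0" using assms(2) by auto
  have "\<forall>i j. u i * v j = u j * v i"
    using c unfolding all_3 by auto
  then have "u = (\<lambda>j. u i / v i * v j)" using i by (auto simp: field_simps)
  then show ?thesis by blast
qed

text \<open>Take \<open>e\<close> with \<open>dot n e = 1\<close>. The vector
  \<open>v - (dot n v) e\<close> lies in the plane where \<open>F\<close> vanishes, and expanding
  \<open>F\<close> there expresses \<open>F v\<close> by terms divisible by \<open>dot n v\<close>.
  No division by 2 occurs.\<close>

lemma linear_factor: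
  fixes F :: "(3, 'a::field) mpoly"
  assumes hom: "homogeneous 2 F" and ne: "n \<noteq> (\<lambda>_. 0)"
    and z: "\<And>v. dot n v = 0 \<Longrightarrow> peval F v = 0"
  shows "\<exists>m. F = lin n * lin m"
proof -
  have "\<exists>e. dot n e = 1"
    using ne unfolding nonzero_3
    by (auto simp: dot_def intro: exI[of _ "vec3 (1 / n 0) 0 0"] exI[of _ "vec3 0 (1 / n 1) 0"] exI[of _ "vec3 0 0 (1 / n 2)"])
  then obtain e where e: "dot n e = 1" by blast
  \<comment> \<open>The cofactor read off from the expansion is the linear function sending
    \<open>v\<close> to \<open>polar F e v - dot n v * peval F e\<close>; its coefficients are its
    values at the unit vectors.\<close>
  define m where "m = (\<lambda>i. polar F e (\<lambda>j. if j = i then 1 else 0) - n i * peval F e)"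
  have m: "dot m v = polar F e v - dot n v * peval F e" for v
    unfolding m_def dot_def polar_def by (simp add: algebra_simps)
  have "F = lin n * lin m"
  proof (rule form_eq_peval[OF hom homogeneous_lin_mult])
    fix v
    let ?t = "dot n v"
    have "dot n (\<lambda>i. 1 * v i + - ?t * e i) = dot n v - ?t * dot n e"
      by (simp add: dot_def algebra_simps)
    then have "peval F (\<lambda>i. 1 * v i + - ?t * e i) = 0" using e by (intro z) simp
    then have "peval F v = ?t * polar F v e - ?t^2 * peval F e"
      unfolding peval_comb[OF hom] by (simp add: algebra_simps)
    then show "peval F v = peval (lin n * lin m) v"
      by (simp add: peval_mult m polar_comm[of F e] algebra_simps power2_eq_square)
  qed
  then show ?thesis by blast
qed

text \<open>The three hypotheses say that all three coefficients of the form restricted to the span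
  of \<open>u\<close> and \<open>v\<close> vanish, so the line through them is a component.\<close>

lemma splits_if_line:
  fixes F :: "(3, 'a::field) mpoly"
  assumes hom: "homogeneous 2 F" and ne: "cross u v \<noteq> (\<lambda>_. 0)"
    and z: "peval F u = 0" "peval F v = 0" "polar F u v = 0"
  shows "\<exists>m. F = lin (cross u v) * lin m"
proof (rule linear_factor[OF hom ne])
  fix w assume "dot (cross u v) w = 0"
  then obtain s t where "w = (\<lambda>i. s * u i + t * v i)" using dot_cross_eq_0D[OF ne] by blast
  then show "peval F w = 0" using z by (simp add: peval_comb[OF hom])
qed

text \<open>A singular zero is the vertex of a cone: every line joining it to another zero lies in
  the conic. Another zero exists because, over an algebraically closed field, the form has a
  nontrivial zero on any two-dimensional space complementary to \<open>p\<close>.\<close>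

lemma splits_if_singular:
  fixes F :: "(3, 'a::alg_closed_field) mpoly"
  assumes hom: "homogeneous 2 F" and p: "p \<noteq> (\<lambda>_. 0)" "peval F p = 0" "\<And>v. polar F p v = 0"
  shows "\<exists>n m. F = lin n * lin m"
proof -
  have *: "\<exists>w. cross w p \<noteq> (\<lambda>_. 0) \<and> peval F w = 0"
    if ind: "\<And>s t. s \<noteq> 0 \<or> t \<noteq> 0 \<Longrightarrow> cross (\<lambda>i. s * a i + t * b i) p \<noteq> (\<lambda>_. 0)" for a b
  proof (cases "peval F a = 0")
    case True
    then show ?thesis using ind[of 1 0] by auto
  next
    case False
    \<comment> \<open>This is the form at \<open>s a + b\<close> as a polynomial in
      \<open>s\<close>, with nonzero leading coefficient \<open>peval F a\<close>.\<close>
    then have "Polynomial.degree [:peval F b, polar F a b, peval F a:] > 0" by simp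
    then obtain s where "poly [:peval F b, polar F a b, peval F a:] s = 0"
      using alg_closed_imp_poly_has_root by blast
    then have "peval F (\<lambda>i. s * a i + 1 * b i) = 0"
      unfolding peval_comb[OF hom] by (simp add: algebra_simps power2_eq_square)
    then show ?thesis using ind[of s 1] by (metis one_neq_zero)
  qed
  \<comment> \<open>If a coordinate of \<open>p\<close> is nonzero, the unit vectors of the other
    two coordinates span a complement of \<open>p\<close>.\<close>
  have "\<exists>w. cross w p \<noteq> (\<lambda>_. 0) \<and> peval F w = 0"
    using p(1) unfolding nonzero_3[of p]
  proof (elim disjE)
    assume "p 0 \<noteq> 0"
    then show ?thesis by (intro *[of "vec3 0 1 0" "vec3 0 0 1"]) (auto simp: nonzero_3)
  next
    assume "p 1 \<noteq> 0"
    then show ?thesis by (intro *[of "vec3 1 0 0" "vec3 0 0 1"]) (auto simp: nonzero_3)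
  next
    assume "p 2 \<noteq> 0"
    then show ?thesis by (intro *[of "vec3 1 0 0" "vec3 0 1 0"]) (auto simp: nonzero_3)
  qed
  then obtain w where "cross w p \<noteq> (\<lambda>_. 0)" "peval F w = 0" by blast
  then show ?thesis using splits_if_line[OF hom, of w p] p polar_comm[of F w p] by metis
qed

section \<open>Passage to the algebraic closure and absolutely irreducible forms\<close>

abbreviation extend_scalars :: "(3, 'a::field) mpoly \<Rightarrow> (3, 'a alg_closure) mpoly" where
  "extend_scalars F \<equiv> Poly_Mapping.map to_ac F"

lemma cf_map: "h 0 = 0 \<Longrightarrow> cf (Poly_Mapping.map h F) i j = h (cf F i j)"
  by (simp add: cf_def map.rep_eq when_def)

lemma peval_extend:
  "homogeneous 2 F \<Longrightarrow> peval (extend_scalars F) (to_ac \<circ> v) = to_ac (peval F v)"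
  by (simp add: peval_form homogeneous_map cf_map)

lemma polar_extend: "polar (extend_scalars F) (to_ac \<circ> u) (to_ac \<circ> v) = to_ac (polar F u v)"
  by (simp add: polar_def cf_map)

lemma cross_extend: "cross (to_ac \<circ> u) (to_ac \<circ> v) = to_ac \<circ> cross u v"
  by (simp add: fun_eq_3)

lemma to_ac_comp_eq_0_iff: "to_ac \<circ> u = (\<lambda>_. 0) \<longleftrightarrow> u = (\<lambda>_. 0)"
  by (auto simp: fun_eq_iff)

lemma extend_scalars_eq_0_iff [simp]: "extend_scalars F = 0 \<longleftrightarrow> F = 0"
  by (auto simp: map_eq_zero_iff intro!: poly_mapping_eqI simp: in_keys_iff)

lemma absolutely_irreducible_iff:
  "quadratic_form F \<Longrightarrow> absolutely_irreducible F \<longleftrightarrow> \<not> (\<exists>n m. extend_scalars F = lin n * lin m)"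
  unfolding absolutely_irreducible_def quadratic_form_def
  by (intro irreducible_form_iff) (auto simp: homogeneous_map)

locale irreducible_conic =
  fixes F :: "(3, 'a::field) mpoly"
  assumes quadratic: "quadratic_form F" and irreducible: "absolutely_irreducible F"
begin

lemma hom: "homogeneous 2 F"
  using quadratic by (simp add: quadratic_form_def)

text \<open>If the polar form vanished, the whole line through the two zeros would lie in the conic
  and its equation would divide the form.\<close>

lemma polar_nonzero:
  assumes "cross u v \<noteq> (\<lambda>_. 0)" "peval F u = 0" "peval F v = 0"
  shows "polar F u v \<noteq> 0"
proof
  assume "polar F u v = 0"
  then have "\<exists>m. extend_scalars F = lin (cross (to_ac \<circ> u) (to_ac \<circ> v)) * lin m"
    using assms by (intro splits_if_line homogeneous_map hom)
      (simp_all add: cross_extend to_ac_comp_eq_0_iff peval_extend hom polar_extend)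
  then show False using absolutely_irreducible_iff[OF quadratic] irreducible by blast
qed

text \<open>A rational singular point stays singular over the closure, where a conic with a singular
  point is a pair of lines.\<close>

lemma nonsingular:
  assumes "p \<noteq> (\<lambda>_. 0)" "peval F p = 0"
  shows "\<exists>v. polar F p v \<noteq> 0"
proof (rule ccontr)
  assume "\<not> ?thesis"
  then have z: "polar F p v = 0" for v by simp
  have "polar (extend_scalars F) (to_ac \<circ> p) w = 0" for w
  proof -
    \<comment> \<open>The polar form is linear in \<open>w\<close>, so vanishing on the three
      rational unit vectors carries over to all vectors over the closure.\<close>
    have "polar (extend_scalars F) (to_ac \<circ> p) w
      = w 0 * to_ac (polar F p (vec3 1 0 0)) + w 1 * to_ac (polar F p (vec3 0 1 0)) + w 2 * to_ac (polar F p (vec3 0 0 1))"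
      unfolding polar_def by (simp add: cf_map algebra_simps)
    then show ?thesis by (simp add: z)
  qed
  then have "\<exists>n m. extend_scalars F = lin n * lin m"
    using assms by (intro splits_if_singular[of _ "to_ac \<circ> p"] homogeneous_map hom)
      (simp_all add: to_ac_comp_eq_0_iff peval_extend hom)
  then show False using absolutely_irreducible_iff[OF quadratic] irreducible by blast
qed

end


section \<open>Points of the projective plane\<close>

lemma mem_proj_point_iff: "w \<in> proj_point v \<longleftrightarrow> (\<exists>c. c \<noteq> 0 \<and> w = (\<lambda>i. c * v i))"
  by (auto simp: proj_point_def)

lemma self_mem_proj_point: "v \<in> proj_point v"
  unfolding mem_proj_point_iff by (intro exI[of _ 1]) auto

lemma proj_point_scale:
  assumes c: "c \<noteq> 0" shows "proj_point (\<lambda>i. c * v i) = proj_point v"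
proof (rule Set.set_eqI)
  fix w
  show "w \<in> proj_point (\<lambda>i. c * v i) \<longleftrightarrow> w \<in> proj_point v"
    unfolding mem_proj_point_iff
  proof
    assume "\<exists>d. d \<noteq> 0 \<and> w = (\<lambda>i. d * (c * v i))"
    then obtain d where "d \<noteq> 0" "w = (\<lambda>i. d * (c * v i))" by blast
    then show "\<exists>d. d \<noteq> 0 \<and> w = (\<lambda>i. d * v i)" using c by (intro exI[of _ "d * c"]) (auto simp: mult.assoc)
  next
    assume "\<exists>d. d \<noteq> 0 \<and> w = (\<lambda>i. d * v i)"
    then obtain d where "d \<noteq> 0" "w = (\<lambda>i. d * v i)" by blast
    then show "\<exists>d. d \<noteq> 0 \<and> w = (\<lambda>i. d * (c * v i))" using c by (intro exI[of _ "d / c"]) auto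
  qed
qed

lemma proj_point_eq_iff: "proj_point v = proj_point w \<longleftrightarrow> v \<in> proj_point w"
proof
  assume "proj_point v = proj_point w"
  then show "v \<in> proj_point w" using self_mem_proj_point by blast
next
  assume "v \<in> proj_point w"
  then show "proj_point v = proj_point w" using proj_point_scale by (auto simp: mem_proj_point_iff)
qed

lemma proj_point_eq_cross:
  fixes v w :: "3 \<Rightarrow> 'a::field"
  assumes "v \<noteq> (\<lambda>_. 0)" "w \<noteq> (\<lambda>_. 0)"
  shows "proj_point v = proj_point w \<longleftrightarrow> cross v w = (\<lambda>_. 0)"
proof
  assume "proj_point v = proj_point w"
  then obtain c where "v = (\<lambda>i. c * w i)" unfolding proj_point_eq_iff mem_proj_point_iff by blast
  then show "cross v w = (\<lambda>_. 0)" by (auto simp: fun_eq_3)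
next
  assume "cross v w = (\<lambda>_. 0)"
  then obtain c where c: "v = (\<lambda>i. c * w i)" using cross_eq_0D assms(2) by blast
  with assms(1) have "c \<noteq> 0" by auto
  then show "proj_point v = proj_point w" unfolding c by (rule proj_point_scale)
qed

lemma proj_point_in_plane: "v \<noteq> (\<lambda>_. 0) \<Longrightarrow> proj_point v \<in> proj_plane"
  by (auto simp: proj_plane_def)

lemma proj_planeE:
  assumes "x \<in> proj_plane" obtains v where "v \<noteq> (\<lambda>_. 0)" "x = proj_point v"
  using assms by (auto simp: proj_plane_def)

lemma proj_zeros_subset: "proj_zeros F \<subseteq> proj_plane"
  by (auto simp: proj_zeros_def)

text \<open>Membership in \<open>proj_zeros\<close> asks for vanishing at every representative of
  the point; stability of zeros under scaling lets one representative decide.\<close>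

lemma proj_point_in_zeros:
  assumes "v \<noteq> (\<lambda>_. 0)" "\<And>c. peval F v = 0 \<Longrightarrow> peval F (\<lambda>i. c * v i) = 0"
  shows "proj_point v \<in> proj_zeros F \<longleftrightarrow> peval F v = 0"
proof
  assume "proj_point v \<in> proj_zeros F"
  then show "peval F v = 0" using self_mem_proj_point by (auto simp: proj_zeros_def)
next
  assume "peval F v = 0"
  then show "proj_point v \<in> proj_zeros F"
    using assms by (auto simp: proj_zeros_def proj_point_in_plane mem_proj_point_iff)
qed

lemma proj_point_in_conic:
  assumes "homogeneous 2 F" "v \<noteq> (\<lambda>_. 0)"
  shows "proj_point v \<in> proj_zeros F \<longleftrightarrow> peval F v = 0"
  using assms by (intro proj_point_in_zeros) (auto simp: peval_scale)

lemma proj_point_in_line: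
  assumes "v \<noteq> (\<lambda>_. 0)"
  shows "proj_point v \<in> proj_zeros (lin n) \<longleftrightarrow> dot n v = 0"
proof -
  have "dot n (\<lambda>i. c * v i) = c * dot n v" for c by (simp add: dot_def algebra_simps)
  then show ?thesis using assms by (subst proj_point_in_zeros) auto
qed

lemma proj_point_in_infinity:
  "v \<noteq> (\<lambda>_. 0) \<Longrightarrow> proj_point v \<in> line_at_infinity \<longleftrightarrow> v 2 = 0"
  unfolding line_at_infinity_def by (subst proj_point_in_zeros) auto

section \<open>The affine chart, the points at infinity and the size of projective sets\<close>

definition vec2 :: "'a \<Rightarrow> 'a \<Rightarrow> 2 \<Rightarrow> 'a" where
  "vec2 x y i = (if i = 0 then x else y)"

lemma vec2_simps [simp]: "vec2 x y 0 = x" "vec2 x y 1 = y"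
  by (simp_all add: vec2_def)

definition aff :: "(2 \<Rightarrow> 'a::field) \<Rightarrow> 3 \<Rightarrow> 'a" where
  "aff p = vec3 (p 0) (p 1) 1"

lemma aff_simps [simp]: "aff p 0 = p 0" "aff p 1 = p 1" "aff p 2 = 1"
  by (simp_all add: aff_def)

lemma aff_nonzero [simp]: "aff p \<noteq> (\<lambda>_. 0)"
  by (auto simp: nonzero_3)

lemma embed_eq: "embed p = proj_point (aff p)"
  unfolding embed_def aff_def by (rule arg_cong[of _ _ proj_point]) (simp add: fun_eq_3)

lemma proj_point_eq_embed:
  assumes "w 2 \<noteq> 0" shows "proj_point w = embed (vec2 (w 0 / w 2) (w 1 / w 2))"
proof -
  have "w = (\<lambda>i. w 2 * aff (vec2 (w 0 / w 2) (w 1 / w 2)) i)" using assms by (simp add: fun_eq_3)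
  then show ?thesis using proj_point_scale[OF assms] unfolding embed_eq by metis
qed

lemma cross_aff_eq_0_iff: "cross (aff p) (aff p') = (\<lambda>_. 0) \<longleftrightarrow> p = p'"
  by (auto simp: fun_eq_3 fun_eq_2)

lemma inj_embed: "inj embed"
  by (rule injI) (simp add: embed_eq proj_point_eq_cross cross_aff_eq_0_iff)

lemma affine_part_conic: "homogeneous 2 F \<Longrightarrow> affine_part (proj_zeros F) = {p. peval F (aff p) = 0}"
  by (simp add: affine_part_def embed_eq proj_point_in_conic)

lemma finite_proj_plane: "finite (proj_plane :: (3 \<Rightarrow> 'a::{field,finite}) set set)"
  by (rule finite_subset[of _ UNIV]) auto

lemma card_affine_part_infinity:
  fixes C :: "(3 \<Rightarrow> 'a::{field,finite}) set set"
  assumes C: "C \<subseteq> proj_plane"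
  shows "card C = card (affine_part C) + card (C \<inter> line_at_infinity)"
proof -
  have "C = embed ` affine_part C \<union> (C \<inter> line_at_infinity)" (is "_ = ?R")
  proof
    show "C \<subseteq> ?R"
    proof
      fix x assume x: "x \<in> C"
      then obtain v where v: "v \<noteq> (\<lambda>_. 0)" "x = proj_point v" using C proj_planeE by blast
      show "x \<in> ?R"
      proof (cases "v 2 = 0")
        case True
        then show ?thesis using v x proj_point_in_infinity by auto
      next
        case False
        then have "x = embed (vec2 (v 0 / v 2) (v 1 / v 2))"
          using proj_point_eq_embed[of v, OF False] v(2) by simp
        then show ?thesis using x by (auto simp: affine_part_def)
      qed
    qed
  qed (auto simp: affine_part_def)
  moreover have "card (?R) = card (embed ` affine_part C) + card (C \<inter> line_at_infinity)"
    by (rule card_Un_disjoint) (auto simp: embed_eq proj_point_in_infinity intro: finite_subset[OF C finite_proj_plane])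
  ultimately show ?thesis
    by (metis card_image inj_embed inj_on_subset subset_UNIV)
qed

lemma inj_scale:
  fixes v :: "3 \<Rightarrow> 'a::field"
  assumes "v \<noteq> (\<lambda>_. 0)" shows "inj (\<lambda>c i. c * v i)"
proof (rule injI)
  fix c d assume eq: "(\<lambda>i. c * v i) = (\<lambda>i. d * v i)"
  obtain i where "v i \<noteq> 0" using assms by auto
  then show "c = d" using fun_cong[OF eq, of i] by simp
qed

text \<open>The classes partition a scaling-invariant set of nonzero vectors, and each class is a
  free orbit of the \<open>q - 1\<close> nonzero scalars.\<close>

lemma card_proj_points:
  fixes V :: "(3 \<Rightarrow> 'a::{field,finite}) set"
  assumes nz: "\<And>v. v \<in> V \<Longrightarrow> v \<noteq> (\<lambda>_. 0)"
    and scale: "\<And>c v. c \<noteq> 0 \<Longrightarrow> v \<in> V \<Longrightarrow> (\<lambda>i. c * v i) \<in> V"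
  shows "(CARD('a) - 1) * card (proj_point ` V) = card V"
proof -
  have un: "\<Union> (proj_point ` V) = V"
  proof
    show "\<Union> (proj_point ` V) \<subseteq> V"
      using scale by (auto simp: proj_point_def)
    show "V \<subseteq> \<Union> (proj_point ` V)"
      using self_mem_proj_point by blast
  qed
  have "(CARD('a) - 1) * card (proj_point ` V) = card (\<Union> (proj_point ` V))"
  proof (rule card_partition)
    fix x assume "x \<in> proj_point ` V"
    then obtain v where v: "v \<in> V" "x = proj_point v" by blast
    have "x = (\<lambda>c i. c * v i) ` (UNIV - {0})" by (auto simp: v proj_point_def)
    also have "card \<dots> = card (UNIV - {0::'a})"
      by (rule card_image) (use inj_scale[OF nz[OF v(1)]] in \<open>auto simp: inj_on_def inj_def\<close>)
    finally show "card x = CARD('a) - 1" by (simp add: card_Diff_singleton)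
  next
    fix x y assume xy: "x \<in> proj_point ` V" "y \<in> proj_point ` V" "x \<noteq> y"
    then obtain v w where vw: "x = proj_point v" "y = proj_point w" by blast
    show "x \<inter> y = {}"
    proof (rule ccontr)
      assume "x \<inter> y \<noteq> {}"
      then obtain u where "u \<in> proj_point v" "u \<in> proj_point w" using vw by blast
      then have "proj_point u = proj_point v" "proj_point u = proj_point w" by (simp_all add: proj_point_eq_iff)
      then show False using xy vw by simp
    qed
  qed auto
  then show ?thesis by (simp add: un)
qed


section \<open>Conics over finite fields\<close>

text \<open>A nonzero square has at most two roots, so the \<open>q - 1\<close> nonzero elements
  give at least \<open>(q - 1) / 2\<close> nonzero squares; 0 is one more.\<close>

lemma card_squares: "CARD('a::{field,finite}) + 1 \<le> 2 * card (range (\<lambda>x::'a. x^2))"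
proof -
  let ?S = "range (\<lambda>x::'a. x^2)"
  have "card {x. x^2 = s} \<le> 2" for s :: 'a
  proof (cases "\<exists>r. r^2 = s")
    case True
    then obtain r where "r^2 = s" by blast
    then have "{x. x^2 = s} \<subseteq> {r, - r}" by (auto simp: power2_eq_iff)
    then have "card {x. x^2 = s} \<le> card {r, - r}" by (intro card_mono) auto
    also have "\<dots> \<le> 2" by (simp add: card_insert_if)
    finally show ?thesis .
  qed auto
  then have "(\<Sum>s\<in>?S - {0}. card {x. x^2 = s}) \<le> (\<Sum>s\<in>?S - {0}. 2)" by (intro sum_mono)
  moreover have "card (UNIV - {0::'a}) \<le> card (\<Union>s\<in>?S - {0}. {x. x^2 = s})"
    by (rule card_mono) auto
  moreover have "card (\<Union>s\<in>?S - {0}. {x. x^2 = s}) \<le> (\<Sum>s\<in>?S - {0}. card {x. x^2 = s})"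
    by (rule card_UN_le) auto
  moreover have "0 \<in> ?S" by (metis power_zero_numeral rangeI)
  moreover have "card ?S > 0" by (simp add: card_gt_0_iff)
  ultimately show ?thesis by (simp add: card_Diff_singleton)
qed

lemma exists_cross_nonzero:
  fixes n :: "3 \<Rightarrow> 'a::field"
  assumes "n \<noteq> (\<lambda>_. 0)" obtains v where "cross n v \<noteq> (\<lambda>_. 0)"
proof -
  have "\<exists>v. cross n v \<noteq> (\<lambda>_. 0)"
    using assms unfolding nonzero_3[of n]
  proof (elim disjE)
    assume "n 0 \<noteq> 0"
    then show ?thesis by (intro exI[of _ "vec3 0 1 0"]) (auto simp: nonzero_3)
  next
    assume "n 1 \<noteq> 0"
    then show ?thesis by (intro exI[of _ "vec3 1 0 0"]) (auto simp: nonzero_3)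
  next
    assume "n 2 \<noteq> 0"
    then show ?thesis by (intro exI[of _ "vec3 1 0 0"]) (auto simp: nonzero_3)
  qed
  then show ?thesis using that by blast
qed

text \<open>In characteristic 2 the polar form is alternating in three variables and therefore has a
  nonzero radical vector \<open>n\<close>, the nucleus. Then
  \<open>F (t n + v) = t^2 F n + F v\<close>, and this can be made zero because squaring is a
  bijection of the field.\<close>

lemma conic_has_point_char_2:
  fixes F :: "(3, 'a::{field,finite}) mpoly"
  assumes hom: "homogeneous 2 F" and two: "(2::'a) = 0"
  shows "\<exists>v. v \<noteq> (\<lambda>_. 0) \<and> peval F v = 0"
proof -
  have "\<exists>n. n \<noteq> (\<lambda>_. 0) \<and> (\<forall>v. polar F n v = 0)"
  \<comment> \<open>An alternating 3 by 3 matrix kills the vector of its complementary entries. If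
    that vector is 0, the polar form vanishes altogether and any nonzero vector will do.\<close>
  proof (cases "vec3 (cf F 1 2) (cf F 0 2) (cf F 0 1) = (\<lambda>_. 0)")
    case True
    then show ?thesis
      using two by (intro exI[of _ "vec3 1 0 0"]) (auto simp: polar_def fun_eq_3)
  next
    case False
    have "polar F (vec3 (cf F 1 2) (cf F 0 2) (cf F 0 1)) v = 2 * (cf F 0 0 * (cf F 1 2 * v 0) + cf F 1 1 * (cf F 0 2 * v 1)
        + cf F 2 2 * (cf F 0 1 * v 2) + cf F 0 1 * cf F 0 2 * v 0 + cf F 0 1 * cf F 1 2 * v 1 + cf F 0 2 * cf F 1 2 * v 2)" for v
      by (simp add: polar_def algebra_simps)
    then show ?thesis using False two by auto
  qed
  then obtain n where n: "n \<noteq> (\<lambda>_. 0)" "\<And>v. polar F n v = 0" by blast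
  show ?thesis
  proof (cases "peval F n = 0")
    case True
    then show ?thesis using n by blast
  next
    case False
    have "inj (\<lambda>x::'a. x^2)"
    proof (rule injI)
      fix x y :: 'a assume "x^2 = y^2"
      then have "(x - y)^2 = 0" using two by (simp add: power2_diff)
      then show "x = y" by simp
    qed
    then have "surj (\<lambda>x::'a. x^2)" by (rule finite_UNIV_inj_surj[OF finite])
    moreover obtain v where v: "cross n v \<noteq> (\<lambda>_. 0)" using exists_cross_nonzero[OF n(1)] .
    ultimately obtain t where t: "t^2 = - peval F v / peval F n" by (metis surjD)
    have "peval F (\<lambda>i. t * n i + 1 * v i) = 0"
      using t False n(2) unfolding peval_comb[OF hom] by simp
    moreover have "(\<lambda>i. t * n i + 1 * v i) \<noteq> (\<lambda>_. 0)"
    proof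
      assume "(\<lambda>i. t * n i + 1 * v i) = (\<lambda>_. 0)"
      then have "v = (\<lambda>i. - t * n i)" by (auto simp: fun_eq_3 add_eq_0_iff)
      then have "cross n v = (\<lambda>_. 0)" by (auto simp: fun_eq_3)
      with v show False by simp
    qed
    ultimately show ?thesis by blast
  qed
qed

text \<open>Diagonalise to \<open>\<alpha> x\<^sup>2 + \<beta> y\<^sup>2 + \<gamma> z\<^sup>2\<close>; the sets of values of \<open>\<alpha> x\<^sup>2\<close> and \<open>- \<gamma> - \<beta> y\<^sup>2\<close>
  each have more than half of the elements of the field.\<close>

lemma conic_has_point_odd:
  fixes F :: "(3, 'a::{field,finite}) mpoly"
  assumes hom: "homogeneous 2 F" and two: "(2::'a) \<noteq> 0"
  shows "\<exists>v. v \<noteq> (\<lambda>_. 0) \<and> peval F v = 0"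
proof (rule ccontr)
  assume "\<not> ?thesis"
  then have an: "peval F v \<noteq> 0" if "v \<noteq> (\<lambda>_. 0)" for v using that by blast
  \<comment> \<open>Gram-Schmidt for the polar form, applied to the standard basis. The denominators
    \<open>2 * peval F f\<close> are nonzero because \<open>F\<close> is assumed to have no
    nontrivial zero and 2 is invertible.\<close>
  define f0 where "f0 = vec3 (1::'a) 0 0"
  define f1 where "f1 = (\<lambda>i. 1 * vec3 0 1 0 i + - (polar F f0 (vec3 0 1 0) / (2 * peval F f0)) * f0 i)"
  define g where "g = (\<lambda>i. 1 * vec3 0 0 1 i + - (polar F f0 (vec3 0 0 1) / (2 * peval F f0)) * f0 i)"
  define f2 where "f2 = (\<lambda>i. 1 * g i + - (polar F f1 (vec3 0 0 1) / (2 * peval F f1)) * f1 i)"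
  have ne: "f0 \<noteq> (\<lambda>_. 0)" "f1 \<noteq> (\<lambda>_. 0)"
    by (auto simp: nonzero_3 f0_def f1_def)
  note an0 = an[OF ne(1)] and an1 = an[OF ne(2)]
  have p01: "polar F f0 f1 = 0" and p0g: "polar F f0 g = 0"
    unfolding f1_def g_def polar_comb polar_self[OF hom] using an0 two by (simp_all add: field_simps)
  have p02: "polar F f0 f2 = 0"
    unfolding f2_def polar_comb p0g p01 by simp
  have "polar F f1 g = polar F f1 (vec3 0 0 1)"
    unfolding g_def polar_comb polar_comm[of F f1 f0] p01 by simp
  then have p12: "polar F f1 f2 = 0"
    unfolding f2_def polar_comb[of F f1 1 g] polar_self[OF hom] using an1 two by (simp add: field_simps)
  let ?S = "range (\<lambda>x::'a. x^2)"
  let ?A = "(\<lambda>s. peval F f0 * s) ` ?S" and ?B = "(\<lambda>s. - peval F f2 - peval F f1 * s) ` ?S"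
  have "card ?A = card ?S" by (rule card_image) (use an0 in \<open>auto simp: inj_on_def\<close>)
  moreover have "card ?B = card ?S" by (rule card_image) (use an1 in \<open>auto simp: inj_on_def\<close>)
  moreover have "card (?A \<union> ?B) \<le> CARD('a)" by (rule card_mono) auto
  moreover have "?A \<inter> ?B = {} \<Longrightarrow> card (?A \<union> ?B) = card ?A + card ?B" by (rule card_Un_disjoint) auto
  ultimately have "?A \<inter> ?B \<noteq> {}" using card_squares[where 'a = 'a] by linarith
  then obtain x y where xy: "peval F f0 * x^2 = - peval F f2 - peval F f1 * y^2" by blast
  let ?w = "\<lambda>i. x * f0 i + 1 * (y * f1 i + 1 * f2 i)"
  have "peval F (\<lambda>i. y * f1 i + 1 * f2 i) = y^2 * peval F f1 + peval F f2"
    unfolding peval_comb[OF hom] p12 by simp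
  moreover have "polar F f0 (\<lambda>i. y * f1 i + 1 * f2 i) = 0"
    unfolding polar_comb p01 p02 by simp
  ultimately have "peval F ?w = x^2 * peval F f0 + (y^2 * peval F f1 + peval F f2)"
    unfolding peval_comb[OF hom] by simp
  also have "\<dots> = 0" using xy by (simp add: algebra_simps)
  finally have "peval F ?w = 0" .
  \<comment> \<open>Only the third unit vector has a nonzero last coordinate, and the
    orthogonalisation keeps its coefficient 1 in \<open>f2\<close>; hence the zero found is not the
    zero vector.\<close>
  moreover have "?w 2 = 1" by (simp add: f0_def f1_def f2_def g_def)
  then have "?w \<noteq> (\<lambda>_. 0)" by (metis zero_neq_one)
  ultimately show False using an by blast
qed

context irreducible_conic
begin

text \<open>A third point would be \<open>s u + t v\<close> with both coefficients nonzero, and the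
  form takes the value \<open>s * t * polar F u v\<close> there, which is nonzero on an irreducible
  conic.\<close>

lemma infinity_points_le_2:
  assumes "x \<in> proj_zeros F \<inter> line_at_infinity" "y \<in> proj_zeros F \<inter> line_at_infinity"
    "z \<in> proj_zeros F \<inter> line_at_infinity" "x \<noteq> y" "x \<noteq> z"
  shows "y = z"
proof (rule ccontr)
  assume "y \<noteq> z"
  have "\<exists>u. u \<noteq> (\<lambda>_. 0) \<and> x = proj_point u \<and> peval F u = 0 \<and> u 2 = 0" if "x \<in> proj_zeros F \<inter> line_at_infinity" for x
    using that by (metis IntD1 IntD2 hom proj_planeE proj_point_in_conic proj_point_in_infinity proj_zeros_subset subsetD)
  then obtain u v w where
    u: "u \<noteq> (\<lambda>_. 0)" "x = proj_point u" "peval F u = 0" "u 2 = 0" and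
    v: "v \<noteq> (\<lambda>_. 0)" "y = proj_point v" "peval F v = 0" "v 2 = 0" and
    w: "w \<noteq> (\<lambda>_. 0)" "z = proj_point w" "peval F w = 0" "w 2 = 0"
    using assms(1-3) by metis
  have c: "cross u v \<noteq> (\<lambda>_. 0)"
    using assms(4) u(1,2) v(1,2) proj_point_eq_cross by metis
  moreover have "dot (cross u v) w = 0" by (simp add: dot_def u v w)
  ultimately obtain s t where st: "w = (\<lambda>i. s * u i + t * v i)" using dot_cross_eq_0D by blast
  have "s \<noteq> 0"
  proof
    assume "s = 0"
    then have "w = (\<lambda>i. t * v i)" "t \<noteq> 0" using st w(1) by auto
    then show False using \<open>y \<noteq> z\<close> v(2) w(2) proj_point_scale by metis
  qed
  moreover have "t \<noteq> 0"
  proof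
    assume "t = 0"
    then have "w = (\<lambda>i. s * u i)" "s \<noteq> 0" using st w(1) by auto
    then show False using assms(5) u(2) w(2) proj_point_scale by metis
  qed
  moreover have "s * t * polar F u v = 0"
    using w(3) u(3) v(3) unfolding st peval_comb[OF hom] by simp
  ultimately show False using polar_nonzero[OF c u(3) v(3)] by simp
qed

lemma card_infinity_le_2: "card (proj_zeros F \<inter> line_at_infinity) \<le> 2"
proof (rule ccontr)
  assume "\<not> ?thesis"
  then have "3 \<le> card (proj_zeros F \<inter> line_at_infinity)" by simp
  then show False by (rule three_elements) (use infinity_points_le_2 in blast)
qed

text \<open>The coefficients of \<open>F (u + T v)\<close> in degrees 0 and 1 are
  \<open>peval F u\<close> and \<open>polar F u v\<close>. Multiplicity at least 2 along the whole
  line thus means that the polar of \<open>u\<close> contains the line.\<close>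

lemma tangent_at_iff:
  "tangent_at F line_at_infinity (proj_point u) \<longleftrightarrow> proj_point u \<in> proj_zeros F \<inter> line_at_infinity \<and>
     (\<forall>v. v \<noteq> (\<lambda>_. 0) \<longrightarrow> v 2 = 0 \<longrightarrow> polar F u v = 0)" if "u \<noteq> (\<lambda>_. 0)"
proof -
  have val: "peval (Poly_Mapping.map (\<lambda>c. [:c:]) F) (\<lambda>i. [:u i, v i:]) = [:peval F u, polar F u v, peval F v:]" for u v
  proof -
    have "peval (Poly_Mapping.map (\<lambda>c. [:c:]) F) w = [:cf F 0 0:] * (w 0 * w 0) + [:cf F 1 1:] * (w 1 * w 1) + [:cf F 2 2:] * (w 2 * w 2)
           + [:cf F 0 1:] * (w 0 * w 1) + [:cf F 0 2:] * (w 0 * w 2) + [:cf F 1 2:] * (w 1 * w 2)" for w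
      by (simp add: peval_form[OF homogeneous_map[OF hom]] cf_map)
    then show ?thesis by (simp add: peval_form[OF hom] polar_def algebra_simps)
  qed
  have dvd: "[:0, 1:] ^ 2 dvd [:a, b, c:] \<longleftrightarrow> a = 0 \<and> b = 0" for a b c :: 'a
  proof -
    have "[:0, 1:] ^ 2 = Polynomial.monom (1::'a) 2" by (simp add: monom_altdef)
    then show ?thesis by (simp add: monom_1_dvd_iff' less_2_cases_iff all_conj_distrib imp_disjL)
  qed
  \<comment> \<open>The class of the zero vector is not a projective point, so membership in the
    line already forces \<open>v\<close> to be nonzero.\<close>
  have inf: "v \<noteq> (\<lambda>_. 0) \<and> v 2 = 0" if "proj_point v \<in> line_at_infinity" for v :: "3 \<Rightarrow> 'a"
  proof -
    have "proj_point v \<in> proj_plane" "peval (pvar 2) v = 0"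
      using that self_mem_proj_point[of v] by (auto simp: line_at_infinity_def proj_zeros_def)
    moreover from this obtain w where w: "w \<noteq> (\<lambda>_. 0)" "proj_point v = proj_point w" by (elim proj_planeE)
    then obtain c where "c \<noteq> 0" "v = (\<lambda>i. c * w i)" unfolding proj_point_eq_iff mem_proj_point_iff by blast
    ultimately show ?thesis using w(1) by (auto simp: nonzero_3)
  qed
  show ?thesis
  proof
    assume "tangent_at F line_at_infinity (proj_point u)"
    then show "proj_point u \<in> proj_zeros F \<inter> line_at_infinity \<and> (\<forall>v. v \<noteq> (\<lambda>_. 0) \<longrightarrow> v 2 = 0 \<longrightarrow> polar F u v = 0)"
      unfolding tangent_at_def val dvd using self_mem_proj_point proj_point_in_infinity by blast
  next
    assume R: "proj_point u \<in> proj_zeros F \<inter> line_at_infinity \<and> (\<forall>v. v \<noteq> (\<lambda>_. 0) \<longrightarrow> v 2 = 0 \<longrightarrow> polar F u v = 0)"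
    show "tangent_at F line_at_infinity (proj_point u)"
      unfolding tangent_at_def val dvd
    proof (intro conjI allI impI)
      fix w v :: "3 \<Rightarrow> 'a" assume w: "w \<in> proj_point u \<and> proj_point v \<in> line_at_infinity"
      then obtain c where c: "w = (\<lambda>i. c * u i)" unfolding mem_proj_point_iff by blast
      show "peval F w = 0" using R that unfolding c peval_scale[OF hom] by (simp add: proj_point_in_conic hom)
      have "polar F w v = polar F v (\<lambda>i. c * u i + 0 * u i)" unfolding c by (simp add: polar_comm)
      then show "polar F w v = 0" using R inf w unfolding polar_comb by (simp add: polar_comm[of F v u])
    qed (use R in blast)
  qed
qed

text \<open>A second point of the conic on a tangent would have polar form 0 with the point of
  contact, making the line a component. Conversely, a line through \<open>u\<close> that is not
  contained in the polar of \<open>u\<close> meets the conic again.\<close>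

lemma ex_tangent_iff:
  "(\<exists>p. tangent_at F line_at_infinity p) \<longleftrightarrow> card (proj_zeros F \<inter> line_at_infinity) = 1"
proof
  assume "\<exists>p. tangent_at F line_at_infinity p"
  then obtain p where p: "tangent_at F line_at_infinity p" by blast
  then have pC: "p \<in> proj_zeros F \<inter> line_at_infinity" by (simp add: tangent_at_def)
  then obtain u where u: "u \<noteq> (\<lambda>_. 0)" "p = proj_point u" using proj_planeE proj_zeros_subset by (metis IntD1 subsetD)
  have "x = p" if x: "x \<in> proj_zeros F \<inter> line_at_infinity" for x
  proof (rule ccontr)
    assume "x \<noteq> p"
    obtain w where w: "w \<noteq> (\<lambda>_. 0)" "x = proj_point w" using x proj_planeE proj_zeros_subset by (metis IntD1 subsetD)
    have "polar F u w = 0" using p x u w by (simp add: tangent_at_iff proj_point_in_infinity)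
    moreover have "cross u w \<noteq> (\<lambda>_. 0)" using proj_point_eq_cross u w \<open>x \<noteq> p\<close> by metis
    ultimately show False using polar_nonzero x u w pC by (metis IntD1 hom proj_point_in_conic)
  qed
  then have "proj_zeros F \<inter> line_at_infinity = {p}" using pC by blast
  then show "card (proj_zeros F \<inter> line_at_infinity) = 1" by simp
next
  assume "card (proj_zeros F \<inter> line_at_infinity) = 1"
  then obtain p where p: "proj_zeros F \<inter> line_at_infinity = {p}" by (auto simp: card_1_singleton_iff)
  then obtain u where u: "u \<noteq> (\<lambda>_. 0)" "p = proj_point u" using proj_planeE proj_zeros_subset by (metis IntD1 insertI1 subsetD)
  have pin: "proj_point u \<in> proj_zeros F" "proj_point u \<in> line_at_infinity" using p u by auto
  then have u0: "peval F u = 0" "u 2 = 0" using u by (simp_all add: proj_point_in_conic hom proj_point_in_infinity)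
  have "polar F u v = 0" if v: "v \<noteq> (\<lambda>_. 0)" "v 2 = 0" for v
  proof (rule ccontr)
    assume nz: "polar F u v \<noteq> 0"
    \<comment> \<open>The root of \<open>s * polar F u v + peval F v\<close>, which is the form at
      \<open>s u + v\<close> because \<open>u\<close> is a zero. It gives the second intersection
      point.\<close>
    let ?s = "- peval F v / polar F u v"
    let ?w = "\<lambda>i. ?s * u i + 1 * v i"
    have "peval F ?w = 0" unfolding peval_comb[OF hom] u0 using nz by simp
    have ne: "v \<noteq> (\<lambda>i. c * u i)" for c
    proof
      assume "v = (\<lambda>i. c * u i)"
      then have "polar F u v = polar F u (\<lambda>i. c * u i + 0 * u i)" by simp
      then show False using nz u0 polar_self[OF hom, of u] unfolding polar_comb by simp
    qed
    then have "?w \<noteq> (\<lambda>i. c * u i)" for c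
    proof -
      have "?w = (\<lambda>i. c * u i) \<Longrightarrow> v = (\<lambda>i. (c - ?s) * u i)"
        by (auto simp: fun_eq_iff algebra_simps eq_diff_eq)
      then show ?thesis using ne by blast
    qed
    from this[of 0] this have "?w \<noteq> (\<lambda>_. 0)" "?w \<notin> proj_point u" by (auto simp: mem_proj_point_iff)
    moreover from this \<open>peval F ?w = 0\<close> have "proj_point ?w \<in> proj_zeros F \<inter> line_at_infinity"
      using u0 v by (simp add: proj_point_in_conic hom proj_point_in_infinity)
    then have "proj_point ?w = proj_point u" using p u by blast
    ultimately show False using proj_point_eq_iff by blast
  qed
  then show "\<exists>p. tangent_at F line_at_infinity p" using pin u tangent_at_iff by blast
qed

end

text \<open>The linear functional \<open>polar F p\<close> vanishes at \<open>p\<close>. Off its kernel, each translate of the line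
  spanned by \<open>p\<close> contains exactly one zero of \<open>F\<close>; on its kernel, the only zeros are the multiples of \<open>p\<close>.\<close>

lemma card_conic_vectors:
  fixes F :: "(3, 'a::{field,finite}) mpoly"
  assumes "irreducible_conic F" and p: "p \<noteq> (\<lambda>_. 0)" "peval F p = 0"
  shows "card {v. peval F v = 0} = CARD('a)^2"
proof -
  interpret irreducible_conic F by fact
  let ?q = "CARD('a)"
  let ?l = "polar F p"
  \<comment> \<open>Translation along \<open>e\<close>. The factor 1 puts the vector into the shape
    of \<open>peval_comb\<close> and \<open>polar_comb\<close>.\<close>
  let ?tr = "\<lambda>e. \<lambda>(v::3 \<Rightarrow> 'a, t). \<lambda>i. 1 * v i + t * e i"
  define U where "U = {v. ?l v \<noteq> 0}"
  define K where "K = {v. ?l v = 0}"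
  define Z1 where "Z1 = {v \<in> U. peval F v = 0}"
  have lp: "?l p = 0" using p polar_self[OF hom, of p] by simp
  have q0: "?q > 0" by simp
  obtain e0 where e0: "?l e0 \<noteq> 0" using nonsingular p by blast
  define e where "e = (\<lambda>i. 1 / ?l e0 * e0 i + 0 * p i)"
  have le: "?l e = 1" unfolding e_def polar_comb using e0 by simp
  \<comment> \<open>Splitting off the component along \<open>e\<close> identifies the whole space
    with \<open>K\<close> times the field, so the kernel has \<open>q^2\<close> elements.\<close>
  have "bij_betw (?tr e) (K \<times> UNIV) UNIV"
  proof (rule bij_betw_byWitness[of _ "\<lambda>w. (\<lambda>i. 1 * w i + - ?l w * e i, ?l w)"])
    show "\<forall>x\<in>K \<times> UNIV. (\<lambda>i. 1 * ?tr e x i + - ?l (?tr e x) * e i, ?l (?tr e x)) = x"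
    proof
      fix x assume "x \<in> K \<times> (UNIV :: 'a set)"
      then obtain v t where x: "x = (v, t)" "v \<in> K" by blast
      then have "?l (\<lambda>i. 1 * v i + t * e i) = t" unfolding polar_comb le K_def by simp
      then show "(\<lambda>i. 1 * ?tr e x i + - ?l (?tr e x) * e i, ?l (?tr e x)) = x" by (simp add: x)
    qed
    have "?l (\<lambda>i. 1 * w i + - ?l w * e i) = 0" for w unfolding polar_comb le by simp
    then show "(\<lambda>w. (\<lambda>i. 1 * w i + - ?l w * e i, ?l w)) ` UNIV \<subseteq> K \<times> UNIV"
      unfolding K_def by blast
  qed auto
  then have "card (K \<times> (UNIV :: 'a set)) = card (UNIV :: (3 \<Rightarrow> 'a) set)" by (rule bij_betw_same_card)
  then have K: "card K * ?q = ?q^3" by (simp add: card_cartesian_product card_fun)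
  \<comment> \<open>The quadratic term disappears because \<open>p\<close> is a zero, so along
    \<open>p\<close> the form is affine in \<open>t\<close> with slope \<open>?l v\<close>.\<close>
  have shift: "peval F (\<lambda>i. 1 * v i + t * p i) = peval F v + t * ?l v" "?l (\<lambda>i. 1 * v i + t * p i) = ?l v" for v t
    unfolding peval_comb[OF hom] polar_comb lp p(2) by (simp_all add: polar_comm)
  have "bij_betw (?tr p) (Z1 \<times> UNIV) U"
  proof (rule bij_betw_byWitness[of _ "\<lambda>w. (\<lambda>i. 1 * w i + - (peval F w / ?l w) * p i, peval F w / ?l w)"])
    show "\<forall>x\<in>Z1 \<times> UNIV. (\<lambda>i. 1 * ?tr p x i + - (peval F (?tr p x) / ?l (?tr p x)) * p i, peval F (?tr p x) / ?l (?tr p x)) = x"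
    proof
      fix x assume "x \<in> Z1 \<times> (UNIV :: 'a set)"
      then obtain v t where x: "x = (v, t)" and v: "v \<in> Z1" by blast
      show "(\<lambda>i. 1 * ?tr p x i + - (peval F (?tr p x) / ?l (?tr p x)) * p i, peval F (?tr p x) / ?l (?tr p x)) = x"
        using v unfolding x prod.case shift Z1_def U_def by simp
    qed
    show "?tr p ` (Z1 \<times> UNIV) \<subseteq> U"
      unfolding Z1_def U_def using shift by auto
    show "(\<lambda>w. (\<lambda>i. 1 * w i + - (peval F w / ?l w) * p i, peval F w / ?l w)) ` U \<subseteq> Z1 \<times> UNIV"
    proof safe
      fix w assume "w \<in> U"
      then show "(\<lambda>i. 1 * w i + - (peval F w / ?l w) * p i) \<in> Z1"
        unfolding Z1_def U_def mem_Collect_eq shift by simp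
    qed auto
  qed auto
  then have "card (Z1 \<times> (UNIV :: 'a set)) = card U" by (rule bij_betw_same_card)
  then have Z1: "card Z1 * ?q = card U" by (simp add: card_cartesian_product)
  have "U \<union> K = UNIV" by (auto simp: U_def K_def)
  moreover have "card (U \<union> K) = card U + card K" by (rule card_Un_disjoint) (auto simp: U_def K_def)
  ultimately have UK: "card U + card K = ?q^3" by (simp add: card_fun)
  have "{v \<in> K. peval F v = 0} = range (\<lambda>t i. t * p i)"
  proof
    show "{v \<in> K. peval F v = 0} \<subseteq> range (\<lambda>t i. t * p i)"
    proof safe
      fix v assume v: "v \<in> K" "peval F v = 0"
      then have "cross v p = (\<lambda>_. 0)" using polar_nonzero[of v p] p by (auto simp: K_def polar_comm)
      then show "v \<in> range (\<lambda>t i. t * p i)" using cross_eq_0D p(1) by blast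
    qed
    have "?l (\<lambda>i. t * p i + 0 * p i) = 0" for t unfolding polar_comb lp by simp
    then show "range (\<lambda>t i. t * p i) \<subseteq> {v \<in> K. peval F v = 0}"
      by (auto simp: K_def peval_scale[OF hom] p)
  qed
  moreover have "inj (\<lambda>t i. t * p i)" using inj_scale p(1) .
  ultimately have Z0: "card {v \<in> K. peval F v = 0} = ?q" by (simp add: card_image)
  have "{v. peval F v = 0} = Z1 \<union> {v \<in> K. peval F v = 0}" by (auto simp: Z1_def U_def K_def)
  moreover have "card (Z1 \<union> {v \<in> K. peval F v = 0}) = card Z1 + card {v \<in> K. peval F v = 0}"
    by (rule card_Un_disjoint) (auto simp: Z1_def U_def K_def)
  ultimately have tot: "card {v. peval F v = 0} = card Z1 + ?q" using Z0 by simp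
  have "card K = ?q^2" using K q0 by (simp add: power3_eq_cube power2_eq_square)
  then have "(card Z1 + ?q) * ?q = ?q^2 * ?q" using UK Z1 by (simp add: algebra_simps power3_eq_cube power2_eq_square)
  then show ?thesis using tot q0 by simp
qed

text \<open>A rational point exists in either parity, and then there are \<open>q^2\<close> zero
  vectors. Removing 0 and dividing by the \<open>q - 1\<close> scalars leaves \<open>q + 1\<close>
  points.\<close>

theorem card_irreducible_conic:
  fixes F :: "(3, 'a::{field,finite}) mpoly"
  assumes irr: "irreducible_conic F"
  shows "card (proj_zeros F) = CARD('a) + 1"
proof -
  interpret irreducible_conic F by fact
  let ?q = "CARD('a)" and ?V = "{v. v \<noteq> (\<lambda>_. 0) \<and> peval F v = 0}"
  obtain p where p: "p \<noteq> (\<lambda>_. 0)" "peval F p = 0"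
    using conic_has_point_char_2[OF hom] conic_has_point_odd[OF hom] by blast
  have "proj_zeros F = proj_point ` ?V"
  proof
    show "proj_zeros F \<subseteq> proj_point ` ?V"
    proof
      fix x assume x: "x \<in> proj_zeros F"
      then obtain v where "v \<noteq> (\<lambda>_. 0)" "x = proj_point v" using proj_planeE proj_zeros_subset by blast
      then show "x \<in> proj_point ` ?V" using x proj_point_in_conic[OF hom] by blast
    qed
  qed (use proj_point_in_conic[OF hom] in blast)
  moreover have "(?q - 1) * card (proj_point ` ?V) = card ?V"
    by (rule card_proj_points) (auto simp: peval_scale[OF hom] fun_eq_iff)
  moreover have "{v. peval F v = 0} = insert (\<lambda>_. 0) ?V" by (auto simp: peval_form[OF hom])
  then have "card {v. peval F v = 0} = Suc (card ?V)" by simp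
  ultimately have count: "(?q - 1) * card (proj_zeros F) + 1 = ?q^2"
    using card_conic_vectors[OF irr p] by simp
  have "?q > 1"
    using card_mono[of UNIV "{0, 1 :: 'a}"] by simp
  moreover define k where "k = ?q - 1"
  ultimately have k: "?q = Suc k" "k > 0" by simp_all
  have "k * card (proj_zeros F) = k * (k + 2)" using count k(1) by (simp add: power2_eq_square)
  from iffD1[OF nat_mult_eq_cancel1[OF k(2)] this] show ?thesis using k(1) by simp
qed

theorem card_affine_irreducible_conic:
  fixes F :: "(3, 'a::{field,finite}) mpoly"
  assumes "irreducible_conic F"
  shows "card {p. peval F (aff p) = 0} + card (proj_zeros F \<inter> line_at_infinity) = CARD('a) + 1"
  using card_irreducible_conic[OF assms] card_affine_part_infinity[OF proj_zeros_subset[of F]]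
    irreducible_conic.hom[OF assms] by (simp add: affine_part_conic)


section \<open>Nullity and codewords\<close>

text \<open>For a maximal independent subset \<open>I\<close> of \<open>\<sigma>\<close>, restriction to \<open>\<sigma> - I\<close> is a bijection from the
  codewords supported in \<open>\<sigma>\<close> onto all functions on \<open>\<sigma> - I\<close>.\<close>

lemma card_codewords_nullity:
  fixes V :: "('e \<Rightarrow> 'a::{field,finite}) set"
  assumes fin: "finite E" and sigma: "\<sigma> \<subseteq> E"
    and zero: "(\<lambda>_. 0) \<in> V"
    and add: "\<And>f g. f \<in> V \<Longrightarrow> g \<in> V \<Longrightarrow> (\<lambda>x. f x + g x) \<in> V"
    and scale: "\<And>c f. f \<in> V \<Longrightarrow> (\<lambda>x. c * f x) \<in> V"
    and ind: "\<And>\<tau>. \<tau> \<in> \<I> \<longleftrightarrow> \<tau> \<subseteq> E \<and> (\<forall>f\<in>V. (\<forall>x. x \<notin> \<tau> \<longrightarrow> f x = 0) \<longrightarrow> f = (\<lambda>_. 0))"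
  shows "card {f \<in> V. \<forall>x. x \<notin> \<sigma> \<longrightarrow> f x = 0} = CARD('a) ^ nullity \<I> \<sigma>"
proof -
  let ?W = "{f \<in> V. \<forall>x. x \<notin> \<sigma> \<longrightarrow> f x = 0}"
  let ?J = "{I \<in> \<I>. I \<subseteq> \<sigma>}"
  have finsig: "finite \<sigma>" using fin sigma finite_subset by blast
  have "?J \<subseteq> Pow \<sigma>" by blast
  then have finJ: "finite ?J" using finsig finite_subset by blast
  have "{} \<in> ?J" using ind by auto
  then have "card ` ?J \<noteq> {}" by blast
  then have "matroid_rank \<I> \<sigma> \<in> card ` ?J"
    unfolding matroid_rank_def using finJ by (intro Max_in) auto
  then obtain I where I: "I \<in> \<I>" "I \<subseteq> \<sigma>" "card I = matroid_rank \<I> \<sigma>" by auto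
  have finI: "finite I" using I(2) finsig finite_subset by blast
  have Iz: "f = (\<lambda>_. 0)" if "f \<in> V" "\<forall>x. x \<notin> I \<longrightarrow> f x = 0" for f
    using ind[of I] I(1) that by blast
  have max: "J \<in> \<I> \<Longrightarrow> J \<subseteq> \<sigma> \<Longrightarrow> card J \<le> card I" for J
    unfolding I(3) matroid_rank_def using finJ by (intro Max_ge) auto
  \<comment> \<open>By maximality of \<open>I\<close>, adding \<open>e\<close> creates a codeword
    supported on \<open>insert e I\<close> that is nonzero at \<open>e\<close>; it is normalised to
    1 there. These words are dual to the coordinates in \<open>\<sigma> - I\<close>, so any values
    on \<open>\<sigma> - I\<close> can be interpolated.\<close>
  have "\<exists>g\<in>V. (\<forall>x. x \<notin> insert e I \<longrightarrow> g x = 0) \<and> g e = 1" if e: "e \<in> \<sigma> - I" for e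
  proof -
    have "insert e I \<notin> \<I>"
      using max[of "insert e I"] e I(2) finI by auto
    then obtain f where f: "f \<in> V" "\<forall>x. x \<notin> insert e I \<longrightarrow> f x = 0" "f \<noteq> (\<lambda>_. 0)"
      using ind[of "insert e I"] e I(2) sigma by auto
    have "f e \<noteq> 0"
    proof
      assume "f e = 0"
      then have "\<forall>x. x \<notin> I \<longrightarrow> f x = 0" using f(2) by auto
      then show False using Iz f(1,3) by blast
    qed
    then show ?thesis using f scale[OF f(1), of "inverse (f e)"]
      by (intro bexI[of _ "\<lambda>x. inverse (f e) * f x"]) auto
  qed
  then obtain g where g: "\<And>e. e \<in> \<sigma> - I \<Longrightarrow> g e \<in> V \<and> (\<forall>x. x \<notin> insert e I \<longrightarrow> g e x = 0) \<and> g e e = 1"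
    by metis
  have sumV: "(\<lambda>x. \<Sum>e\<in>S. h e * g e x) \<in> V" if "finite S" "S \<subseteq> \<sigma> - I" for S h
    using that
  proof (induction S rule: finite_induct)
    case (insert e S)
    then have "(\<lambda>x. h e * g e x + (\<Sum>e\<in>S. h e * g e x)) \<in> V"
      using g by (intro add scale) auto
    then show ?case using insert by simp
  qed (simp add: zero)
  have "bij_betw (\<lambda>f. restrict f (\<sigma> - I)) ?W (PiE (\<sigma> - I) (\<lambda>_. UNIV))"
  proof (rule bij_betwI')
    fix f f' assume f: "f \<in> ?W" "f' \<in> ?W"
    show "restrict f (\<sigma> - I) = restrict f' (\<sigma> - I) \<longleftrightarrow> f = f'"
    proof
      assume eq: "restrict f (\<sigma> - I) = restrict f' (\<sigma> - I)"
      have agree: "f x = f' x" if "x \<notin> I" for x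
        using fun_cong[OF eq, of x] f that by (cases "x \<in> \<sigma>") auto
      have "(\<lambda>x. f x + - 1 * f' x) \<in> V" using f by (intro add scale) auto
      moreover have "\<forall>x. x \<notin> I \<longrightarrow> f x + - 1 * f' x = 0" using agree by simp
      ultimately have "(\<lambda>x. f x + - 1 * f' x) = (\<lambda>_. 0)" by (rule Iz)
      then show "f = f'" by (simp add: fun_eq_iff)
    qed simp
  next
    fix h assume h: "h \<in> PiE (\<sigma> - I) (\<lambda>_. UNIV :: 'a set)"
    let ?f = "\<lambda>x. \<Sum>e\<in>\<sigma> - I. h e * g e x"
    have "?f x = 0" if "x \<notin> \<sigma>" for x
    proof (rule sum.neutral, rule ballI)
      fix e assume "e \<in> \<sigma> - I"
      then show "h e * g e x = 0" using g[of e] that I(2) by auto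
    qed
    then have W: "?f \<in> ?W" using sumV finsig by simp
    have "?f x = h x" if x: "x \<in> \<sigma> - I" for x
    proof -
      have "?f x = (\<Sum>e\<in>\<sigma> - I. if e = x then h x else 0)"
        by (rule sum.cong) (use g x in auto)
      then show ?thesis using x finsig by simp
    qed
    then have "restrict ?f (\<sigma> - I) = h"
      using h by (auto simp: fun_eq_iff restrict_def PiE_def extensional_def)
    then have "h = restrict ?f (\<sigma> - I)" ..
    then show "\<exists>f\<in>?W. h = restrict f (\<sigma> - I)" using W by (rule bexI[where x = ?f])
  qed auto
  then have "card ?W = card (PiE (\<sigma> - I) (\<lambda>_. UNIV :: 'a set))" by (rule bij_betw_same_card)
  also have "\<dots> = CARD('a) ^ card (\<sigma> - I)" using finsig by (simp add: card_PiE)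
  also have "card (\<sigma> - I) = nullity \<I> \<sigma>"
    unfolding nullity_def I(3)[symmetric] using I(2) finI by (simp add: card_Diff_subset)
  finally show ?thesis .
qed

section \<open>Kernel vectors as linear relations between columns\<close>

lemma mult_mat_vec_col:
  fixes H :: "'a::comm_semiring_0 mat"
  assumes "c \<in> carrier_vec (dim_col H)" "i < dim_row H"
  shows "(H *\<^sub>v c) $ i = (\<Sum>j\<in>{1..dim_col H}. c $ (j - 1) * col H (j - 1) $ i)"
proof -
  have "(H *\<^sub>v c) $ i = (\<Sum>k<dim_col H. c $ k * col H k $ i)"
    using assms by (auto simp: scalar_prod_def lessThan_atLeast0 mult.commute intro!: sum.cong)
  also have "\<dots> = (\<Sum>j\<in>{1..dim_col H}. c $ (j - 1) * col H (j - 1) $ i)"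
    by (rule sum.reindex_bij_witness[of _ "\<lambda>j. j - 1" Suc]) auto
  finally show ?thesis .
qed

text \<open>A kernel vector supported on \<open>\<sigma>\<close> is the same as a linear relation
  between the columns indexed by \<open>\<sigma>\<close>. Relations of the family also account for
  repeated columns, which linear dependence of the set of columns would miss.\<close>

lemma parity_check_matroid_iff:
  fixes H :: "'a::field mat"
  assumes sub: "\<sigma> \<subseteq> {1..dim_col H}"
  shows "\<sigma> \<in> parity_check_matroid H \<longleftrightarrow>
    (\<forall>c\<in>mat_kernel H. (\<forall>j\<in>{1..dim_col H} - \<sigma>. c $ (j - 1) = 0) \<longrightarrow> c = 0\<^sub>v (dim_col H))"
proof -
  let ?n = "dim_col H" and ?r = "dim_row H"
  let ?\<phi> = "\<lambda>j. col H (j - 1)"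
  interpret vec_space "TYPE('a)" ?r .
  have fin: "finite \<sigma>" using sub finite_subset by blast
  have carr: "?\<phi> ` \<tau> \<subseteq> carrier_vec ?r" for \<tau> by auto
  have ker: "c \<in> mat_kernel H \<longleftrightarrow> c \<in> carrier_vec ?n \<and> H *\<^sub>v c = 0\<^sub>v ?r" for c
    unfolding mat_kernel_def by auto
  have sum_supp: "(\<Sum>j\<in>{1..?n}. c $ (j - 1) * ?\<phi> j $ i) = (\<Sum>j\<in>\<tau>. c $ (j - 1) * ?\<phi> j $ i)"
    if "\<tau> \<subseteq> {1..?n}" "\<forall>j\<in>{1..?n} - \<tau>. c $ (j - 1) = 0" for c \<tau> i
    using that by (intro sum.mono_neutral_right) auto
  show ?thesis
  proof
    assume ind: "\<sigma> \<in> parity_check_matroid H"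
    then have inj: "inj_on ?\<phi> \<sigma>" and nl: "\<not> lin_dep (?\<phi> ` \<sigma>)"
      by (auto simp: parity_check_matroid_def)
    show "\<forall>c\<in>mat_kernel H. (\<forall>j\<in>{1..?n} - \<sigma>. c $ (j - 1) = 0) \<longrightarrow> c = 0\<^sub>v ?n"
    proof (intro ballI impI, rule ccontr)
      fix c assume c: "c \<in> mat_kernel H" "\<forall>j\<in>{1..?n} - \<sigma>. c $ (j - 1) = 0" "c \<noteq> 0\<^sub>v ?n"
      \<comment> \<open>\<open>lin_dep\<close> concerns a set of vectors, so coefficients indexed by
        columns are transported along the inverse of the injective column map.\<close>
      define a where "a = (\<lambda>v. c $ (the_inv_into \<sigma> ?\<phi> v - 1))"
      have a: "a (?\<phi> j) = c $ (j - 1)" if "j \<in> \<sigma>" for j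
        unfolding a_def using the_inv_into_f_f[OF inj that] by simp
      have cc: "c \<in> carrier_vec ?n" using c ker by blast
      have "lincomb a (?\<phi> ` \<sigma>) = 0\<^sub>v ?r"
      proof (rule eq_vecI)
        show "dim_vec (lincomb a (?\<phi> ` \<sigma>)) = dim_vec (0\<^sub>v ?r)"
          using lincomb_dim[OF _ carr] fin by simp
      next
        fix i assume "i < dim_vec (0\<^sub>v ?r :: 'a vec)"
        then have i: "i < ?r" by simp
        have "lincomb a (?\<phi> ` \<sigma>) $ i = (\<Sum>v\<in>?\<phi> ` \<sigma>. a v * v $ i)" by (rule lincomb_index[OF i carr])
        also have "\<dots> = (\<Sum>j\<in>\<sigma>. c $ (j - 1) * ?\<phi> j $ i)"
          by (subst sum.reindex[OF inj]) (use a in \<open>auto intro!: sum.cong\<close>)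
        also have "\<dots> = (H *\<^sub>v c) $ i"
          unfolding mult_mat_vec_col[OF cc i] using sum_supp[OF sub c(2)] by simp
        finally show "lincomb a (?\<phi> ` \<sigma>) $ i = 0\<^sub>v ?r $ i" using c(1) ker by simp
      qed
      moreover obtain k where k: "k < ?n" "c $ k \<noteq> 0"
        using c(3) cc by (metis carrier_vecD eq_vecI index_zero_vec)
      then have Sk: "Suc k \<in> \<sigma>" using c(2) by force
      then have mem: "?\<phi> (Suc k) \<in> ?\<phi> ` \<sigma>" by (rule imageI)
      moreover have "a (?\<phi> (Suc k)) \<noteq> 0" using a[OF Sk] k by simp
      ultimately have "lin_dep (?\<phi> ` \<sigma>)"
        unfolding lin_dep_def using fin mem
        by (intro exI[of _ "?\<phi> ` \<sigma>"] exI[of _ a] exI[of _ "?\<phi> (Suc k)"] conjI) auto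
      then show False using nl by blast
    qed
  next
    assume C: "\<forall>c\<in>mat_kernel H. (\<forall>j\<in>{1..?n} - \<sigma>. c $ (j - 1) = 0) \<longrightarrow> c = 0\<^sub>v ?n"
    \<comment> \<open>A relation on \<open>\<sigma>\<close> extended by zero is a kernel vector,
      hence trivial by assumption.\<close>
    have kill: "b j = 0" if b: "\<And>i. i < ?r \<Longrightarrow> (\<Sum>j\<in>\<sigma>. b j * ?\<phi> j $ i) = 0" and j: "j \<in> \<sigma>" for b j
    proof -
      let ?c = "vec ?n (\<lambda>k. if Suc k \<in> \<sigma> then b (Suc k) else 0)"
      have cj: "?c $ (j - 1) = (if j \<in> \<sigma> then b j else 0)" if "j \<in> {1..?n}" for j
      proof -
        have "j - 1 < ?n" "Suc (j - 1) = j" using that by auto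
        then show ?thesis by simp
      qed
      have supp: "\<forall>j\<in>{1..?n} - \<sigma>. ?c $ (j - 1) = 0" using cj by auto
      have "H *\<^sub>v ?c = 0\<^sub>v ?r"
      proof (rule eq_vecI)
        fix i assume "i < dim_vec (0\<^sub>v ?r :: 'a vec)"
        then have i: "i < ?r" by simp
        have "(H *\<^sub>v ?c) $ i = (\<Sum>j\<in>\<sigma>. ?c $ (j - 1) * ?\<phi> j $ i)"
          using mult_mat_vec_col[OF _ i, of ?c] sum_supp[OF sub supp] by simp
        also have "\<dots> = (\<Sum>j\<in>\<sigma>. b j * ?\<phi> j $ i)"
          by (rule sum.cong) (use sub cj in auto)
        finally show "(H *\<^sub>v ?c) $ i = 0\<^sub>v ?r $ i" using b[OF i] i by simp
      qed simp
      then have "?c \<in> mat_kernel H" by (simp add: ker)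
      then have c0: "?c = 0\<^sub>v ?n" using C supp by blast
      have "j \<in> {1..?n}" using j sub by blast
      then show "b j = 0" using cj[of j] j unfolding c0 by auto
    qed
    have inj: "inj_on ?\<phi> \<sigma>"
    proof (rule inj_onI, rule ccontr)
      fix j j' assume jj: "j \<in> \<sigma>" "j' \<in> \<sigma>" "?\<phi> j = ?\<phi> j'" "j \<noteq> j'"
      \<comment> \<open>Two equal columns satisfy the relation with coefficients 1 and -1.\<close>
      let ?b = "\<lambda>k. if k = j then 1 else if k = j' then - 1 else (0::'a)"
      have "?b j = 0"
      proof (rule kill[of ?b j, OF _ jj(1)])
        fix i assume "i < ?r"
        have "(\<Sum>k\<in>\<sigma>. ?b k * ?\<phi> k $ i) = (\<Sum>k\<in>\<sigma>. (if k = j then ?\<phi> j $ i else 0) - (if k = j' then ?\<phi> j' $ i else 0))"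
          by (rule sum.cong) (use jj in auto)
        also have "\<dots> = 0" using jj fin by (simp add: sum_subtractf)
        finally show "(\<Sum>k\<in>\<sigma>. ?b k * ?\<phi> k $ i) = 0" .
      qed
      then show False by simp
    qed
    moreover have "\<not> lin_dep (?\<phi> ` \<sigma>)"
    proof
      assume "lin_dep (?\<phi> ` \<sigma>)"
      then obtain A a v where A: "finite A" "A \<subseteq> ?\<phi> ` \<sigma>" "lincomb a A = 0\<^sub>v ?r" "v \<in> A" "a v \<noteq> 0"
        unfolding lin_dep_def by auto
      then obtain j where j: "j \<in> \<sigma>" "v = ?\<phi> j" by blast
      let ?b = "\<lambda>j. if ?\<phi> j \<in> A then a (?\<phi> j) else 0"
      have "?b j = 0"
      proof (rule kill[of ?b j, OF _ j(1)])
        fix i assume i: "i < ?r"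
        have "(\<Sum>j\<in>\<sigma>. ?b j * ?\<phi> j $ i) = (\<Sum>v\<in>?\<phi> ` \<sigma>. (if v \<in> A then a v else 0) * v $ i)"
          by (subst sum.reindex[OF inj]) (simp only: comp_def)
        also have "\<dots> = (\<Sum>v\<in>A. (if v \<in> A then a v else 0) * v $ i)"
          by (rule sum.mono_neutral_right) (use fin A(2) in auto)
        also have "\<dots> = lincomb a A $ i"
          using A(2) carr by (subst lincomb_index[OF i]) auto
        finally show "(\<Sum>j\<in>\<sigma>. ?b j * ?\<phi> j $ i) = 0" using A(3) i by simp
      qed
      then show False using j A by simp
    qed
    ultimately show "\<sigma> \<in> parity_check_matroid H"
      using sub by (simp add: parity_check_matroid_def)
  qed
qed

text \<open>Codewords are turned into functions on the natural numbers that vanish off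
  \<open>{1..n}\<close>, the setting of \<open>card_codewords_nullity\<close>; the value at
  \<open>j\<close> is the vector entry \<open>j - 1\<close>.\<close>

lemma card_kernel_nullity:
  fixes H :: "'a::{field,finite} mat"
  assumes sub: "\<sigma> \<subseteq> {1..dim_col H}"
  shows "card {c \<in> mat_kernel H. \<forall>j\<in>{1..dim_col H} - \<sigma>. c $ (j - 1) = 0} = CARD('a) ^ nullity (parity_check_matroid H) \<sigma>"
proof -
  let ?n = "dim_col H"
  let ?E = "{1..?n}"
  let ?ext = "\<lambda>c j. if j \<in> ?E then c $ (j - 1) else (0::'a)"
  let ?V = "?ext ` mat_kernel H"
  have ker: "c \<in> mat_kernel H \<longleftrightarrow> c \<in> carrier_vec ?n \<and> H *\<^sub>v c = 0\<^sub>v (dim_row H)" for c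
    unfolding mat_kernel_def by auto
  have H: "H \<in> carrier_mat (dim_row H) ?n" by simp
  have inj: "inj_on ?ext (carrier_vec ?n)"
  proof (rule inj_onI)
    fix c d :: "'a vec" assume cd: "c \<in> carrier_vec ?n" "d \<in> carrier_vec ?n" "?ext c = ?ext d"
    show "c = d"
    proof (rule eq_vecI)
      fix i assume "i < dim_vec d"
      then show "c $ i = d $ i" using fun_cong[OF cd(3), of "Suc i"] cd by simp
    qed (use cd in simp)
  qed
  have ext0: "?ext c = (\<lambda>_. 0) \<longleftrightarrow> c = 0\<^sub>v ?n" if "c \<in> carrier_vec ?n" for c
  proof
    assume z: "?ext c = (\<lambda>_. 0)"
    show "c = 0\<^sub>v ?n"
    proof (rule eq_vecI)
      fix i assume "i < dim_vec (0\<^sub>v ?n :: 'a vec)"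
      then show "c $ i = 0\<^sub>v ?n $ i" using fun_cong[OF z, of "Suc i"] by simp
    qed (use that in simp)
  qed (auto simp: fun_eq_iff)
  have supp: "(\<forall>x. x \<notin> \<tau> \<longrightarrow> ?ext c x = 0) \<longleftrightarrow> (\<forall>j\<in>?E - \<tau>. c $ (j - 1) = 0)" for c \<tau>
    by auto
  have "card {f \<in> ?V. \<forall>x. x \<notin> \<sigma> \<longrightarrow> f x = 0} = CARD('a) ^ nullity (parity_check_matroid H) \<sigma>"
  proof (rule card_codewords_nullity[of ?E])
    have "0\<^sub>v ?n \<in> mat_kernel H" unfolding ker by (auto intro!: eq_vecI)
    then show "(\<lambda>_. 0) \<in> ?V" using ext0[of "0\<^sub>v ?n"] by force
  next
    fix f g assume "f \<in> ?V" "g \<in> ?V"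
    then obtain c d where cd: "c \<in> mat_kernel H" "d \<in> mat_kernel H" "f = ?ext c" "g = ?ext d" by blast
    then have "H *\<^sub>v (c + d) = 0\<^sub>v (dim_row H)"
      using mult_add_distrib_mat_vec[OF H, of c d] by (simp add: ker)
    then have "c + d \<in> mat_kernel H" using cd by (simp add: ker)
    moreover have "(\<lambda>x. f x + g x) = ?ext (c + d)" using cd by (auto simp: fun_eq_iff ker)
    ultimately show "(\<lambda>x. f x + g x) \<in> ?V" by blast
  next
    fix a :: 'a and f assume "f \<in> ?V"
    then obtain c where c: "c \<in> mat_kernel H" "f = ?ext c" by blast
    moreover have "a \<cdot>\<^sub>v 0\<^sub>v (dim_row H) = 0\<^sub>v (dim_row H)" by (auto intro!: eq_vecI)
    ultimately have "H *\<^sub>v (a \<cdot>\<^sub>v c) = 0\<^sub>v (dim_row H)"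
      using mult_mat_vec[OF H, of c a] by (simp add: ker)
    then have "a \<cdot>\<^sub>v c \<in> mat_kernel H" using c by (simp add: ker)
    moreover have "(\<lambda>x. a * f x) = ?ext (a \<cdot>\<^sub>v c)" using c by (auto simp: fun_eq_iff ker)
    ultimately show "(\<lambda>x. a * f x) \<in> ?V" by blast
  next
    fix \<tau>
    show "\<tau> \<in> parity_check_matroid H \<longleftrightarrow> \<tau> \<subseteq> ?E \<and> (\<forall>f\<in>?V. (\<forall>x. x \<notin> \<tau> \<longrightarrow> f x = 0) \<longrightarrow> f = (\<lambda>_. 0))"
    proof (cases "\<tau> \<subseteq> ?E")
      case True
      show ?thesis
        unfolding parity_check_matroid_iff[OF True] ball_simps supp
        using True ext0 ker by blast
    qed (auto simp: parity_check_matroid_def)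
  qed (use sub in auto)
  moreover have "{f \<in> ?V. \<forall>x. x \<notin> \<sigma> \<longrightarrow> f x = 0} = ?ext ` {c \<in> mat_kernel H. \<forall>j\<in>?E - \<sigma>. c $ (j - 1) = 0}"
    using supp[of \<sigma>] by blast
  moreover have "card (?ext ` {c \<in> mat_kernel H. \<forall>j\<in>?E - \<sigma>. c $ (j - 1) = 0}) = card {c \<in> mat_kernel H. \<forall>j\<in>?E - \<sigma>. c $ (j - 1) = 0}"
    by (rule card_image, rule inj_on_subset[OF inj]) (auto simp: ker)
  ultimately show ?thesis by simp
qed


section \<open>Affine lines and collinearity\<close>

definition aline :: "(3 \<Rightarrow> 'a::field) \<Rightarrow> (2 \<Rightarrow> 'a) set" where
  "aline n = {p. dot n (aff p) = 0}"

text \<open>The 3 by 3 determinant of the points in homogeneous coordinates. It is 0 when the points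
  are collinear, in particular when two of them coincide.\<close>

definition orient :: "(2 \<Rightarrow> 'a::field) \<Rightarrow> (2 \<Rightarrow> 'a) \<Rightarrow> (2 \<Rightarrow> 'a) \<Rightarrow> 'a" where
  "orient p r s = dot (cross (aff p) (aff r)) (aff s)"

abbreviation join :: "(2 \<Rightarrow> 'a::field) \<Rightarrow> (2 \<Rightarrow> 'a) \<Rightarrow> 3 \<Rightarrow> 'a" where
  "join p r \<equiv> cross (aff p) (aff r)"

lemma mem_aline: "p \<in> aline n \<longleftrightarrow> dot n (aff p) = 0"
  by (simp add: aline_def)

lemma affine_line_iff: "affine_line l \<longleftrightarrow> (\<exists>n. (n 0 \<noteq> 0 \<or> n 1 \<noteq> 0) \<and> l = aline n)"
proof
  assume "affine_line l"
  then obtain a b c where "a \<noteq> 0 \<or> b \<noteq> 0" "l = {p. a * p 0 + b * p 1 + c = 0}" by (auto simp: affine_line_def)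
  then show "\<exists>n. (n 0 \<noteq> 0 \<or> n 1 \<noteq> 0) \<and> l = aline n"
    by (intro exI[of _ "vec3 a b c"]) (auto simp: aline_def dot_def)
qed (auto simp: affine_line_def aline_def dot_def)

lemma orient_swap: "orient r p s = - orient p r s"
  and orient_swap_right: "orient p s r = - orient p r s"
  and orient_rot: "orient r s p = orient p r s"
  and orient_refl [simp]: "orient p p s = 0" "orient p r p = 0" "orient p r r = 0"
  by (simp_all add: orient_def dot_def algebra_simps)

lemma mem_join: "s \<in> aline (join p r) \<longleftrightarrow> orient p r s = 0"
  by (simp add: mem_aline orient_def)

lemma join_valid: "p \<noteq> r \<Longrightarrow> join p r 0 \<noteq> 0 \<or> join p r 1 \<noteq> 0"
  by (auto simp: fun_eq_2)

lemma join_nonzero: "p \<noteq> r \<Longrightarrow> join p r \<noteq> (\<lambda>_. 0)"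
  by (simp add: cross_aff_eq_0_iff)

lemma affine_line_join: "p \<noteq> r \<Longrightarrow> affine_line (aline (join p r))"
  using join_valid affine_line_iff by blast

text \<open>The adjugate identity expresses the determinant times \<open>n\<close> through the three
  dot products, all of which vanish.\<close>

lemma det_eq_0:
  fixes n :: "3 \<Rightarrow> 'a::field"
  assumes "n \<noteq> (\<lambda>_. 0)" "dot n u = 0" "dot n v = 0" "dot n w = 0"
  shows "dot (cross u v) w = 0"
proof -
  obtain i where i: "n i \<noteq> 0" using assms(1) by auto
  have "\<forall>i. dot (cross u v) w * n i = dot n u * cross v w i + dot n v * cross w u i + dot n w * cross u v i"
    unfolding all_3 by (simp add: dot_def algebra_simps)
  then have "dot (cross u v) w * n i = dot n u * cross v w i + dot n v * cross w u i + dot n w * cross u v i" ..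
  then have "dot (cross u v) w * n i = 0" using assms(2-4) by simp
  then show ?thesis using i by simp
qed

text \<open>Both \<open>a\<close> and \<open>b\<close> lie on the line through \<open>p\<close> and
  \<open>r\<close>, so \<open>p\<close>, \<open>a\<close>, \<open>b\<close> are collinear. This
  turns coincidences at a stray point \<open>r\<close> into collinearity of the given
  points.\<close>

lemma orient_transfer:
  assumes "p \<noteq> r" "orient p a r = 0" "orient p b r = 0" shows "orient p a b = 0"
proof -
  have "dot (join p r) (aff p) = 0" "dot (join p r) (aff a) = 0" "dot (join p r) (aff b) = 0"
    using assms(2,3) orient_swap_right[of p a r] orient_swap_right[of p b r] unfolding orient_def[symmetric] by simp_all
  then show ?thesis unfolding orient_def by (rule det_eq_0[OF join_nonzero[OF assms(1)]])
qed

lemma mem_joinE: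
  assumes "s \<in> aline (join p r)" "p \<noteq> r"
  obtains x y where "aff s = (\<lambda>i. x * aff p i + y * aff r i)"
  using dot_cross_eq_0D[OF join_nonzero[OF assms(2)], of "aff s"] assms(1) by (auto simp: mem_aline)

lemma aline_eq_join:
  assumes n: "n \<noteq> (\<lambda>_. 0)" and p: "p \<in> aline n" "r \<in> aline n" "p \<noteq> r"
  shows "aline n = aline (join p r)"
proof (intro subset_antisym subsetI)
  fix s assume "s \<in> aline n"
  then show "s \<in> aline (join p r)"
    using p(1,2) det_eq_0[OF n] by (simp add: mem_aline)
next
  fix s assume "s \<in> aline (join p r)"
  then obtain x y where "aff s = (\<lambda>i. x * aff p i + y * aff r i)"
    using mem_joinE p(3) by blast
  then have "dot n (aff s) = x * dot n (aff p) + y * dot n (aff r)" by (simp add: dot_def algebra_simps)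
  then show "s \<in> aline n" using p(1,2) by (simp add: mem_aline)
qed

lemma affine_line_eq_join:
  "affine_line l \<Longrightarrow> p \<in> l \<Longrightarrow> r \<in> l \<Longrightarrow> p \<noteq> r \<Longrightarrow> l = aline (join p r)"
  using aline_eq_join by (metis affine_line_iff)

lemma collinear_points_iff:
  assumes "a \<noteq> b" shows "collinear_points {a, b, c} \<longleftrightarrow> orient a b c = 0"
proof
  assume "collinear_points {a, b, c}"
  then obtain l where "affine_line l" "{a, b, c} \<subseteq> l" by (auto simp: collinear_points_def)
  then show "orient a b c = 0" using affine_line_eq_join[of l a b] assms mem_join by auto
next
  assume "orient a b c = 0"
  then show "collinear_points {a, b, c}"
    unfolding collinear_points_def using affine_line_join[OF assms] by (intro exI[of _ "aline (join a b)"]) (simp add: mem_join)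
qed

text \<open>A horizontal or vertical line through \<open>p\<close> suffices. It serves as the free
  second factor of a line pair that has to pass through \<open>p\<close> and avoid
  \<open>r\<close>.\<close>

lemma separating_line:
  assumes "p \<noteq> r" obtains n :: "3 \<Rightarrow> 'a::field" where "p \<in> aline n" "r \<notin> aline n"
proof (cases "p 0 = r 0")
  case True
  then show ?thesis using assms that[of "vec3 0 1 (- p 1)"] by (auto simp: mem_aline dot_def fun_eq_2)
next
  case False
  then show ?thesis using assms that[of "vec3 1 0 (- p 0)"] by (auto simp: mem_aline dot_def fun_eq_2)
qed

lemma card_affine_line:
  fixes l :: "(2 \<Rightarrow> 'a::{field,finite}) set"
  assumes "affine_line l" shows "card l = CARD('a)"
proof -
  obtain n where n: "n 0 \<noteq> 0 \<or> n 1 \<noteq> 0" and l: "l = aline n" using assms affine_line_iff by blast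
  have "\<exists>f. bij_betw f (UNIV :: 'a set) l"
  proof (cases "n 1 = 0")
    case True
    have "bij_betw (\<lambda>y. vec2 (- n 2 / n 0) y) UNIV l"
      by (rule bij_betw_byWitness[of _ "\<lambda>p. p 1"])
        (use True n in \<open>auto simp: l aline_def dot_def fun_eq_2 field_simps eq_neg_iff_add_eq_0 neg_eq_iff_add_eq_0\<close>)
    then show ?thesis by blast
  next
    case False
    have "bij_betw (\<lambda>x. vec2 x (- (n 0 * x + n 2) / n 1)) UNIV l"
      by (rule bij_betw_byWitness[of _ "\<lambda>p. p 0"])
        (use False in \<open>auto simp: l aline_def dot_def fun_eq_2 field_simps eq_neg_iff_add_eq_0 neg_eq_iff_add_eq_0\<close>)
    then show ?thesis by blast
  qed
  then show ?thesis using bij_betw_same_card by metis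
qed

lemma card_affine_plane: "card (UNIV :: (2 \<Rightarrow> 'a::finite) set) = CARD('a)^2"
  by (simp add: card_fun)

lemma card_Int_lines:
  fixes l m :: "(2 \<Rightarrow> 'a::{field,finite}) set"
  assumes "affine_line l" "affine_line m" "l \<noteq> m" shows "card (l \<inter> m) \<le> 1"
proof (rule ccontr)
  assume "\<not> ?thesis"
  then obtain p r where "p \<in> l \<inter> m" "r \<in> l \<inter> m" "p \<noteq> r"
    using card_le_Suc0_iff_eq[of "l \<inter> m"] by auto
  then show False using affine_line_eq_join[of l p r] affine_line_eq_join[of m p r] assms by auto
qed


section \<open>Quadrics through a set of points\<close>

text \<open>The zero form is included, which makes this a vector space whose cardinality records its
  dimension.\<close>

definition vanishing :: "(2 \<Rightarrow> 'a::field) set \<Rightarrow> (3, 'a) mpoly set" where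
  "vanishing Z = {F. homogeneous 2 F \<and> (\<forall>p\<in>Z. peval F (aff p) = 0)}"

text \<open>The closure operator of the Galois connection between point sets and sets of
  quadrics.\<close>

definition base_locus :: "(2 \<Rightarrow> 'a::field) set \<Rightarrow> (2 \<Rightarrow> 'a) set" where
  "base_locus Z = {p. \<forall>F\<in>vanishing Z. peval F (aff p) = 0}"

lemma vanishing_mono: "Z \<subseteq> W \<Longrightarrow> vanishing W \<subseteq> vanishing Z"
  by (auto simp: vanishing_def)

lemma subset_base_locus: "Z \<subseteq> base_locus Z"
  by (auto simp: base_locus_def vanishing_def)

lemma base_locus_mono: "Z \<subseteq> W \<Longrightarrow> base_locus Z \<subseteq> base_locus W"
  using vanishing_mono[of Z W] unfolding base_locus_def by blast

lemma vanishing_base_locus [simp]: "vanishing (base_locus Z) = vanishing Z"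
  using vanishing_mono[OF subset_base_locus[of Z]] by (auto simp: base_locus_def vanishing_def)

lemma base_locus_eqI: "vanishing Z = vanishing W \<Longrightarrow> base_locus Z = base_locus W"
  by (simp add: base_locus_def)

text \<open>Scalar multiplication is written as a product with a constant polynomial, so the ring
  laws apply to it.\<close>

definition scaled :: "'a::comm_semiring_1 \<Rightarrow> (3, 'a) mpoly \<Rightarrow> (3, 'a) mpoly" where
  "scaled c F = single 0 c * F"

lemma homogeneous_scaled: "homogeneous d F \<Longrightarrow> homogeneous d (scaled c F)"
  unfolding scaled_def using homogeneous_mult[of 0 _ d F] homogeneous_single[of 0 0 c]
  by (simp add: mon_degree_def)

lemma peval_scaled [simp]: "peval (scaled c F) v = c * peval F v"
  by (simp add: scaled_def peval_mult peval_single)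

lemma form_range:
  "{F :: (3, 'a::comm_ring_1) mpoly. homogeneous 2 F} = range (\<lambda>(a, b, c, d, e, g). form a b c d e g)"
proof
  show "{F :: (3, 'a) mpoly. homogeneous 2 F} \<subseteq> range (\<lambda>(a, b, c, d, e, g). form a b c d e g)"
  proof safe
    fix F :: "(3, 'a) mpoly" assume "homogeneous 2 F"
    from form_cf[OF this] show "F \<in> range (\<lambda>(a, b, c, d, e, g). form a b c d e g)"
      by (intro image_eqI[of _ _ "(cf F 0 0, cf F 1 1, cf F 2 2, cf F 0 1, cf F 0 2, cf F 1 2)"]) auto
  qed
qed (auto simp: homogeneous_form)

lemma card_forms: "card {F :: (3, 'a::{field,finite}) mpoly. homogeneous 2 F} = CARD('a)^6"
proof -
  have "inj (\<lambda>(a, b, c, d, e, g). form a b c d e (g :: 'a))"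
  proof (rule injI, clarsimp)
    fix a b c d e g a' b' c' d' e' g' :: 'a
    assume eq: "form a b c d e g = form a' b' c' d' e' g'"
    from arg_cong[OF eq, of "\<lambda>F. cf F 0 0"] arg_cong[OF eq, of "\<lambda>F. cf F 1 1"] arg_cong[OF eq, of "\<lambda>F. cf F 2 2"]
      arg_cong[OF eq, of "\<lambda>F. cf F 0 1"] arg_cong[OF eq, of "\<lambda>F. cf F 0 2"] arg_cong[OF eq, of "\<lambda>F. cf F 1 2"]
    show "a = a' \<and> b = b' \<and> c = c' \<and> d = d' \<and> e = e' \<and> g = g'" by simp
  qed
  then show ?thesis
    unfolding form_range by (simp add: card_image eval_nat_numeral)
qed

lemma finite_forms: "finite {F :: (3, 'a::{field,finite}) mpoly. homogeneous 2 F}"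
  unfolding form_range by simp

lemma finite_vanishing: "finite (vanishing (Z :: (2 \<Rightarrow> 'a::{field,finite}) set))"
  by (rule finite_subset[OF _ finite_forms]) (auto simp: vanishing_def)

lemma card_vanishing_empty: "card (vanishing ({} :: (2 \<Rightarrow> 'a::{field,finite}) set)) = CARD('a)^6"
  using card_forms[where 'a = 'a] by (simp add: vanishing_def)

text \<open>Evaluation at \<open>p\<close> is a nonzero functional on the quadrics through
  \<open>Z\<close>, with kernel \<open>vanishing (insert p Z)\<close>. A quadric \<open>G\<close>
  normalised to 1 at \<open>p\<close> splits the space as kernel times field.\<close>

lemma card_vanishing_insert:
  fixes Z :: "(2 \<Rightarrow> 'a::{field,finite}) set"
  assumes "p \<notin> base_locus Z"
  shows "card (vanishing Z) = CARD('a) * card (vanishing (insert p Z))"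
proof -
  obtain G0 where G0: "G0 \<in> vanishing Z" "peval G0 (aff p) \<noteq> 0" using assms by (auto simp: base_locus_def)
  define G where "G = scaled (inverse (peval G0 (aff p))) G0"
  have G: "G \<in> vanishing Z" "peval G (aff p) = 1"
    using G0 by (auto simp: G_def vanishing_def homogeneous_scaled)
  have neg: "scaled t G + scaled (- t) G = 0" for t
    by (simp add: scaled_def distrib_right[symmetric] single_add[symmetric])
  have comb: "F + scaled t G \<in> vanishing Z" if "F \<in> vanishing Z" for F t
    using that G by (auto simp: vanishing_def peval_add intro!: homogeneous_add homogeneous_scaled)
  have "bij_betw (\<lambda>(F, t). F + scaled t G) (vanishing (insert p Z) \<times> UNIV) (vanishing Z)"
  proof (rule bij_betw_byWitness[of _ "\<lambda>F. (F + scaled (- peval F (aff p)) G, peval F (aff p))"])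
    show "\<forall>x\<in>vanishing (insert p Z) \<times> UNIV.
        ((case x of (F, t) \<Rightarrow> F + scaled t G) + scaled (- peval (case x of (F, t) \<Rightarrow> F + scaled t G) (aff p)) G,
         peval (case x of (F, t) \<Rightarrow> F + scaled t G) (aff p)) = x"
    proof
      fix x assume "x \<in> vanishing (insert p Z) \<times> (UNIV :: 'a set)"
      then obtain F t where x: "x = (F, t)" "F \<in> vanishing (insert p Z)" by blast
      then have "peval (F + scaled t G) (aff p) = t" by (simp add: peval_add G vanishing_def)
      then show "((case x of (F, t) \<Rightarrow> F + scaled t G) + scaled (- peval (case x of (F, t) \<Rightarrow> F + scaled t G) (aff p)) G,
         peval (case x of (F, t) \<Rightarrow> F + scaled t G) (aff p)) = x"
        using neg[of t] by (simp add: x add.assoc)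
    qed
    show "\<forall>F\<in>vanishing Z. (case (F + scaled (- peval F (aff p)) G, peval F (aff p)) of (F, t) \<Rightarrow> F + scaled t G) = F"
      using neg by (simp add: add.assoc add.commute)
    show "(\<lambda>(F, t). F + scaled t G) ` (vanishing (insert p Z) \<times> UNIV) \<subseteq> vanishing Z"
      using comb vanishing_mono[of Z "insert p Z"] by auto
    have "peval (F + scaled (- peval F (aff p)) G) (aff p) = 0" for F by (simp add: peval_add G)
    then show "(\<lambda>F. (F + scaled (- peval F (aff p)) G, peval F (aff p))) ` vanishing Z \<subseteq> vanishing (insert p Z) \<times> UNIV"
      using comb by (auto simp: vanishing_def)
  qed
  from bij_betw_same_card[OF this] show ?thesis by (simp add: card_cartesian_product mult.commute)
qed

text \<open>Line pairs are the test quadrics for base loci. Repeated factors and the line at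
  infinity are allowed.\<close>

lemma not_in_base_locus:
  assumes "Z \<subseteq> aline n \<union> aline m" "r \<notin> aline n" "r \<notin> aline m" shows "r \<notin> base_locus Z"
proof -
  have "lin n * lin m \<in> vanishing Z"
    using assms(1) by (auto simp: vanishing_def homogeneous_lin_mult peval_mult mem_aline)
  moreover have "peval (lin n * lin m) (aff r) \<noteq> 0" using assms(2,3) by (simp add: peval_mult mem_aline)
  ultimately show ?thesis by (auto simp: base_locus_def)
qed

lemma aline_infinity: "aline (vec3 0 0 1) = {}"
  by (simp add: aline_def dot_def)

text \<open>The square of \<open>z\<close> vanishes at no affine point.\<close>

lemma base_locus_empty: "base_locus {} = {}"
  using not_in_base_locus[of "{}" "vec3 0 0 1" "vec3 0 0 1"] by (auto simp: aline_infinity)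

lemma base_locus_2: "base_locus {p, r} = {p, r}"
proof (rule equalityI[OF _ subset_base_locus], rule subsetI, rule ccontr)
  fix s assume s: "s \<in> base_locus {p, r}" "s \<notin> {p, r}"
  then obtain n where "p \<in> aline n" "s \<notin> aline n" using separating_line[of p s] by blast
  moreover obtain m where "r \<in> aline m" "s \<notin> aline m" using separating_line[of r s] s by blast
  ultimately show False using not_in_base_locus[of "{p, r}" n m s] s(1) by auto
qed

lemma base_locus_1: "base_locus {p} = {p}"
  using base_locus_2[of p p] by simp

text \<open>Write \<open>c\<close> as \<open>s a + t b\<close>. Comparing last coordinates gives
  \<open>s + t = 1\<close>, so both coefficients are nonzero because \<open>c\<close> differs from
  \<open>a\<close> and \<open>b\<close>; the value at \<open>c\<close> is then \<open>s * t\<close>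
  times the polar form.\<close>

lemma polar_zero_if_collinear:
  assumes hom: "homogeneous 2 F" and d: "a \<noteq> b" "a \<noteq> c" "b \<noteq> c" and col: "orient a b c = 0"
    and z: "peval F (aff a) = 0" "peval F (aff b) = 0" "peval F (aff c) = 0"
  shows "polar F (aff a) (aff b) = 0"
proof -
  obtain s t where st: "aff c = (\<lambda>i. s * aff a i + t * aff b i)"
    using mem_joinE[OF _ d(1), of c] col mem_join by blast
  have "s + t = 1" using fun_cong[OF st, of 2] by simp
  then have "s \<noteq> 0" "t \<noteq> 0"
    using d(2,3) fun_cong[OF st, of 0] fun_cong[OF st, of 1] by (auto simp: fun_eq_2)
  moreover have "s * t * polar F (aff a) (aff b) = 0"
    using z(3) z(1,2) unfolding st peval_comb[OF hom] by simp
  ultimately show ?thesis by simp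
qed

lemma vanishes_on_join:
  assumes hom: "homogeneous 2 F" and d: "a \<noteq> b" "a \<noteq> c" "b \<noteq> c" and col: "orient a b c = 0"
    and z: "peval F (aff a) = 0" "peval F (aff b) = 0" "peval F (aff c) = 0"
    and r: "r \<in> aline (join a b)"
  shows "peval F (aff r) = 0"
proof -
  obtain s t where st: "aff r = (\<lambda>i. s * aff a i + t * aff b i)"
    using mem_joinE[OF r d(1)] .
  show ?thesis
    unfolding st peval_comb[OF hom] using z polar_zero_if_collinear[OF assms(1-8)] by simp
qed

lemma join_subset_base_locus:
  assumes d: "a \<noteq> b" "a \<noteq> c" "b \<noteq> c" and col: "orient a b c = 0"
  shows "aline (join a b) \<subseteq> base_locus {a, b, c}"
  using vanishes_on_join[OF _ d col] by (auto simp: base_locus_def vanishing_def)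

lemma base_locus_line:
  assumes "affine_line l" shows "base_locus l = l"
proof -
  obtain n where "l = aline n" using assms affine_line_iff by blast
  then show ?thesis
    using not_in_base_locus[of l n n] subset_base_locus[of l] by auto
qed

lemma base_locus_collinear:
  assumes l: "affine_line l" "a \<in> l" "b \<in> l" "c \<in> l" and d: "a \<noteq> b" "a \<noteq> c" "b \<noteq> c"
  shows "base_locus {a, b, c} = l"
proof
  have "l = aline (join a b)" using affine_line_eq_join l d by blast
  moreover from this have "orient a b c = 0" using l(4) mem_join by blast
  ultimately show "l \<subseteq> base_locus {a, b, c}" using join_subset_base_locus[OF d] by simp
  show "base_locus {a, b, c} \<subseteq> l"
    using base_locus_mono[of "{a, b, c}" l] base_locus_line l by auto
qed

text \<open>The side \<open>a b\<close> together with a line through \<open>c\<close> avoiding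
  \<open>r\<close> excludes any \<open>r\<close> off that side. If \<open>r\<close> lies on the side
  \<open>a b\<close>, it is off \<open>a c\<close>, and the same argument applies to that
  side.\<close>

lemma base_locus_triangle:
  assumes t: "orient a b c \<noteq> 0" shows "base_locus {a, b, c} = {a, b, c}"
proof (rule equalityI[OF _ subset_base_locus], rule subsetI, rule ccontr)
  fix r assume r: "r \<in> base_locus {a, b, c}" "r \<notin> {a, b, c}"
  show False
  proof (cases "orient a b r = 0")
    case False
    obtain m where "c \<in> aline m" "r \<notin> aline m" using separating_line[of c r] r by blast
    then show False
      using not_in_base_locus[of "{a, b, c}" "join a b" m r] r(1) False by (auto simp: mem_join)
  next
    case True
    then have "orient a c r \<noteq> 0" using orient_transfer[of a r b c] t r by auto
    moreover obtain m where "b \<in> aline m" "r \<notin> aline m" using separating_line[of b r] r by blast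
    ultimately show False
      using not_in_base_locus[of "{a, b, c}" "join a c" m r] r(1) by (auto simp: mem_join)
  qed
qed

text \<open>A common zero lies on both line pairs \<open>ab, cd\<close> and \<open>ac, bd\<close>. A
  line of the first pair and a line of the second share exactly one vertex, and meeting elsewhere
  would make three vertices collinear.\<close>

lemma base_locus_quadrangle:
  assumes t: "orient a b c \<noteq> 0" "orient a b d \<noteq> 0" "orient a c d \<noteq> 0" "orient b c d \<noteq> 0"
  shows "base_locus {a, b, c, d} = {a, b, c, d}"
proof (rule equalityI[OF _ subset_base_locus], rule subsetI, rule ccontr)
  fix r assume r: "r \<in> base_locus {a, b, c, d}" "r \<notin> {a, b, c, d}"
  have "r \<in> aline (join a b) \<or> r \<in> aline (join c d)"
    using not_in_base_locus[of "{a, b, c, d}" "join a b" "join c d" r] r by (auto simp: mem_join)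
  moreover have "r \<in> aline (join a c) \<or> r \<in> aline (join b d)"
    using not_in_base_locus[of "{a, b, c, d}" "join a c" "join b d" r] r by (auto simp: mem_join)
  ultimately consider "orient a b r = 0" "orient a c r = 0" | "orient a b r = 0" "orient b d r = 0"
    | "orient c d r = 0" "orient a c r = 0" | "orient c d r = 0" "orient b d r = 0"
    by (auto simp: mem_join)
  then show False
  proof cases
    case 1
    then show False using orient_transfer[of a r b c] r t by auto
  next
    case 2
    then have "orient b a r = 0" using orient_swap[of a b r] by simp
    then have "orient b a d = 0" using orient_transfer[of b r a d] 2 r by auto
    then show False using orient_swap[of a b d] t by simp
  next
    case 3
    then have "orient c a r = 0" using orient_swap[of a c r] by simp
    then have "orient c a d = 0" using orient_transfer[of c r a d] 3 r by auto
    then show False using orient_swap[of a c d] t by simp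
  next
    case 4
    then have "orient d c r = 0" "orient d b r = 0" using orient_swap[of c d r] orient_swap[of b d r] by simp_all
    then have "orient d b c = 0" using orient_transfer[of d r b c] r by auto
    then show False using orient_rot[of b c d] t by simp
  qed
qed

lemma base_locus_line_point:
  assumes l: "affine_line l" shows "base_locus (insert p l) = insert p l"
proof (rule equalityI[OF _ subset_base_locus], rule subsetI, rule ccontr)
  fix r assume r: "r \<in> base_locus (insert p l)" "r \<notin> insert p l"
  obtain n where n: "l = aline n" using l affine_line_iff by blast
  obtain m where "p \<in> aline m" "r \<notin> aline m" using separating_line[of p r] r by blast
  then show False using not_in_base_locus[of "insert p l" n m r] r n by auto
qed


section \<open>Classification of the flats\<close>

text \<open>The index counts the dimension of the space of quadrics through \<open>Z\<close>, not
  that of \<open>Z\<close>: larger flats have smaller index, matching the nullity of the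
  complement.\<close>

definition flat :: "nat \<Rightarrow> (2 \<Rightarrow> 'a::{field,finite}) set \<Rightarrow> bool" where
  "flat i Z \<longleftrightarrow> base_locus Z = Z \<and> card (vanishing Z) = CARD('a) ^ i"

lemma card_field_gt_1: "CARD('a::{field,finite}) > 1"
  using card_mono[of UNIV "{0, 1 :: 'a}"] by simp

text \<open>A subset through which no more quadrics pass than through \<open>Z\<close> has the same
  quadrics, hence the same closure.\<close>

lemma flat_eq_base_locus:
  fixes Z :: "(2 \<Rightarrow> 'a::{field,finite}) set"
  assumes "flat i Z" "B \<subseteq> Z" "card (vanishing B) = CARD('a) ^ i" shows "Z = base_locus B"
proof -
  have "vanishing Z = vanishing B"
    using assms vanishing_mono[OF assms(2)] by (intro card_subset_eq[OF finite_vanishing]) (auto simp: flat_def)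
  then show ?thesis using base_locus_eqI[of Z B] assms(1) by (simp add: flat_def)
qed

lemma card_vanishing_Suc:
  fixes B :: "(2 \<Rightarrow> 'a::{field,finite}) set"
  assumes "card (vanishing B) = CARD('a) ^ Suc j" "p \<notin> base_locus B"
  shows "card (vanishing (insert p B)) = CARD('a) ^ j"
  using card_vanishing_insert[OF assms(2)] assms(1) card_field_gt_1[where 'a = 'a] by simp

text \<open>As long as \<open>i \<le> j\<close>, more quadrics pass through \<open>B\<close> than
  through \<open>Z\<close>, so the base locus of \<open>B\<close> cannot contain \<open>Z\<close>,
  and a point outside it cuts the number by exactly \<open>q\<close>.\<close>

lemma flat_grow:
  fixes Z :: "(2 \<Rightarrow> 'a::{field,finite}) set"
  assumes Z: "flat i Z" and B: "B \<subseteq> Z" "card (vanishing B) = CARD('a) ^ Suc j" and ij: "i \<le> j"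
  obtains p where "p \<in> Z" "p \<notin> base_locus B" "card (vanishing (insert p B)) = CARD('a) ^ j"
proof -
  have "\<not> Z \<subseteq> base_locus B"
  proof
    assume "Z \<subseteq> base_locus B"
    from vanishing_mono[OF this] have "vanishing B \<subseteq> vanishing Z" by simp
    from card_mono[OF finite_vanishing this] have "CARD('a) ^ Suc j \<le> CARD('a) ^ i"
      using Z unfolding B(2) flat_def by simp
    from power_le_imp_le_exp[OF card_field_gt_1 this] show False using ij by simp
  qed
  then show ?thesis using that card_vanishing_Suc[OF B(2)] by blast
qed

section \<open>Conditions imposed by few points and by a line\<close>

lemma card_vanishing_1: "card (vanishing {p :: 2 \<Rightarrow> 'a::{field,finite}}) = CARD('a) ^ 5"
  by (rule card_vanishing_Suc) (simp_all add: card_vanishing_empty base_locus_empty)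

lemma card_vanishing_2:
  "p \<noteq> r \<Longrightarrow> card (vanishing {p, r :: 2 \<Rightarrow> 'a::{field,finite}}) = CARD('a) ^ 4"
  by (rule card_vanishing_Suc) (simp_all add: card_vanishing_1 base_locus_1)

lemma card_vanishing_3:
  "p \<noteq> r \<Longrightarrow> p \<noteq> s \<Longrightarrow> r \<noteq> s \<Longrightarrow> card (vanishing {p, r, s :: 2 \<Rightarrow> 'a::{field,finite}}) = CARD('a) ^ 3"
  by (rule card_vanishing_Suc) (simp_all add: card_vanishing_2 base_locus_2)

text \<open>A line has three points because \<open>q \<ge> 3\<close>, and a quadric through three of
  its points contains it; so a line imposes exactly three conditions.\<close>

lemma card_vanishing_line:
  fixes l :: "(2 \<Rightarrow> 'a::{field,finite}) set"
  assumes q: "CARD('a) \<ge> 3" and l: "affine_line l" shows "card (vanishing l) = CARD('a) ^ 3"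
proof -
  obtain a b c where abc: "a \<in> l" "b \<in> l" "c \<in> l" "a \<noteq> b" "a \<noteq> c" "b \<noteq> c"
    using three_elements card_affine_line[OF l] q by metis
  then have "base_locus {a, b, c} = l" by (intro base_locus_collinear l)
  then have "vanishing l = vanishing {a, b, c}" by (metis vanishing_base_locus)
  then show ?thesis using card_vanishing_3[of a b c] abc by simp
qed

lemma card_vanishing_line_point:
  fixes l :: "(2 \<Rightarrow> 'a::{field,finite}) set"
  assumes "CARD('a) \<ge> 3" "affine_line l" "p \<notin> l" shows "card (vanishing (insert p l)) = CARD('a) ^ 2"
  using assms card_vanishing_line base_locus_line by (intro card_vanishing_Suc) (auto simp: numeral_3_eq_3)

lemma flat_contains_line:
  assumes "flat i Z" "a \<in> Z" "b \<in> Z" "c \<in> Z" "a \<noteq> b" "a \<noteq> c" "b \<noteq> c" "orient a b c = 0"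
  shows "aline (join a b) \<subseteq> Z"
  using join_subset_base_locus[OF assms(5-8)] base_locus_mono[of "{a, b, c}" Z] assms(1-4)
  by (auto simp: flat_def)

lemma card_vanishing_eq_6_iff:
  fixes Z :: "(2 \<Rightarrow> 'a::{field,finite}) set"
  shows "card (vanishing Z) = CARD('a) ^ 6 \<longleftrightarrow> Z = {}"
proof
  assume eq: "card (vanishing Z) = CARD('a) ^ 6"
  show "Z = {}"
  proof (rule ccontr)
    assume "Z \<noteq> {}"
    then obtain p where "{p} \<subseteq> Z" by blast
    from card_mono[OF finite_vanishing vanishing_mono[OF this]] have "CARD('a) ^ 6 \<le> CARD('a) ^ 5"
      by (simp add: eq card_vanishing_1)
    from power_le_imp_le_exp[OF card_field_gt_1 this] show False by simp
  qed
qed (simp add: card_vanishing_empty)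

lemma flat_6_iff: "flat 6 Z \<longleftrightarrow> Z = {}"
  by (auto simp: flat_def card_vanishing_eq_6_iff base_locus_empty)

lemma flat_leE1:
  fixes Z :: "(2 \<Rightarrow> 'a::{field,finite}) set"
  assumes "flat i Z" "i \<le> 5" obtains a where "a \<in> Z"
  using flat_grow[OF assms(1), of "{}" 5] assms(2) card_vanishing_empty[where 'a = 'a] by auto

lemma flat_leE2:
  fixes Z :: "(2 \<Rightarrow> 'a::{field,finite}) set"
  assumes "flat i Z" "i \<le> 4" obtains a b where "a \<in> Z" "b \<in> Z" "b \<noteq> a"
proof -
  obtain a where a: "a \<in> Z" using flat_leE1[OF assms(1)] assms(2) by auto
  obtain b where "b \<in> Z" "b \<notin> base_locus {a}"
    using flat_grow[OF assms(1), of "{a}" 4] assms(2) a card_vanishing_1[of a] by auto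
  then show ?thesis using that a by (auto simp: base_locus_1)
qed

lemma flat_leE3:
  fixes Z :: "(2 \<Rightarrow> 'a::{field,finite}) set"
  assumes "flat i Z" "i \<le> 3" obtains a b c where "a \<in> Z" "b \<in> Z" "c \<in> Z" "a \<noteq> b" "a \<noteq> c" "b \<noteq> c"
proof -
  obtain a b where ab: "a \<in> Z" "b \<in> Z" "b \<noteq> a" using flat_leE2[OF assms(1)] assms(2) by auto
  obtain c where "c \<in> Z" "c \<notin> base_locus {a, b}"
    using flat_grow[OF assms(1), of "{a, b}" 3] assms(2) ab card_vanishing_2[of a b] by auto
  then show ?thesis using that[of a b c] ab by (auto simp: base_locus_2)
qed

lemma flat_5_iff:
  fixes Z :: "(2 \<Rightarrow> 'a::{field,finite}) set"
  shows "flat 5 Z \<longleftrightarrow> (\<exists>p. Z = {p})"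
proof
  assume Z: "flat 5 Z"
  then obtain a where "a \<in> Z" using flat_leE1 by blast
  then have "Z = base_locus {a}" using flat_eq_base_locus[OF Z, of "{a}"] card_vanishing_1[of a] by simp
  then show "\<exists>p. Z = {p}" by (auto simp: base_locus_1)
qed (auto simp: flat_def card_vanishing_1 base_locus_1)

lemma flat_4_iff:
  fixes Z :: "(2 \<Rightarrow> 'a::{field,finite}) set"
  shows "flat 4 Z \<longleftrightarrow> card Z = 2"
proof
  assume Z: "flat 4 Z"
  then obtain a b where ab: "a \<in> Z" "b \<in> Z" "b \<noteq> a" using flat_leE2 by blast
  then have "Z = base_locus {a, b}" using flat_eq_base_locus[OF Z, of "{a, b}"] card_vanishing_2[of a b] by simp
  then show "card Z = 2" using ab by (simp add: base_locus_2)
qed (auto simp: flat_def card_vanishing_2 base_locus_2 card_2_iff)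

lemma triangles_iff: "Z \<in> triangles \<longleftrightarrow> (\<exists>a b c. Z = {a, b, c} \<and> orient a b c \<noteq> 0)"
proof
  assume "Z \<in> triangles"
  then obtain a b c where "Z = {a, b, c}" "a \<noteq> b" "\<not> collinear_points {a, b, c}"
    by (auto simp: triangles_def card_3_iff)
  then show "\<exists>a b c. Z = {a, b, c} \<and> orient a b c \<noteq> 0" using collinear_points_iff by blast
next
  assume "\<exists>a b c. Z = {a, b, c} \<and> orient a b c \<noteq> 0"
  then obtain a b c where Z: "Z = {a, b, c}" "orient a b c \<noteq> 0" by blast
  then have d: "a \<noteq> b" "a \<noteq> c" "b \<noteq> c" by auto
  then show "Z \<in> triangles" using Z collinear_points_iff[OF d(1)] by (auto simp: triangles_def)
qed

text \<open>Any three points impose independent conditions, so the flat is the base locus of three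
  of its points: their line if they are collinear, nothing more otherwise.\<close>

lemma flat_3_iff:
  fixes Z :: "(2 \<Rightarrow> 'a::{field,finite}) set"
  assumes q: "CARD('a) \<ge> 3"
  shows "flat 3 Z \<longleftrightarrow> affine_line Z \<or> Z \<in> triangles"
proof
  assume Z: "flat 3 Z"
  then obtain a b c where abc: "a \<in> Z" "b \<in> Z" "c \<in> Z" "a \<noteq> b" "a \<noteq> c" "b \<noteq> c" using flat_leE3 by blast
  then have eq: "Z = base_locus {a, b, c}" using flat_eq_base_locus[OF Z, of "{a, b, c}"] card_vanishing_3[of a b c] by simp
  show "affine_line Z \<or> Z \<in> triangles"
  proof (cases "orient a b c = 0")
    case True
    have "base_locus {a, b, c} = aline (join a b)"
      by (rule base_locus_collinear[OF affine_line_join]) (use True abc in \<open>auto simp: mem_join\<close>)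
    then show ?thesis using eq affine_line_join[OF abc(4)] by simp
  next
    case False
    then show ?thesis using eq base_locus_triangle triangles_iff by metis
  qed
next
  assume "affine_line Z \<or> Z \<in> triangles"
  then show "flat 3 Z"
  proof
    assume "affine_line Z"
    then show ?thesis using card_vanishing_line[OF q] base_locus_line by (auto simp: flat_def)
  next
    assume "Z \<in> triangles"
    then obtain a b c where Z: "Z = {a, b, c}" "orient a b c \<noteq> 0" using triangles_iff by metis
    then have "a \<noteq> b" "a \<noteq> c" "b \<noteq> c" by auto
    then show ?thesis using base_locus_triangle Z card_vanishing_3 by (auto simp: flat_def)
  qed
qed

lemma quadrangles_iff:
  "Z \<in> quadrangles \<longleftrightarrow> (\<exists>a b c d. Z = {a, b, c, d} \<and> orient a b c \<noteq> 0 \<and> orient a b d \<noteq> 0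
     \<and> orient a c d \<noteq> 0 \<and> orient b c d \<noteq> 0)"
proof
  assume Z: "Z \<in> quadrangles"
  then have "card Z = Suc 3" by (simp add: quadrangles_def)
  then obtain a T where T: "Z = insert a T" "a \<notin> T" "card T = 3" unfolding card_Suc_eq by blast
  then obtain b c d where bcd: "T = {b, c, d}" "b \<noteq> c" "b \<noteq> d" "c \<noteq> d" by (auto simp: card_3_iff)
  have d: "a \<noteq> b" "a \<noteq> c" "a \<noteq> d" using T(2) bcd(1) by auto
  have nc: "\<not> collinear_points {x, y, z}" if "{x, y, z} \<subseteq> Z" "x \<noteq> y" "x \<noteq> z" "y \<noteq> z" for x y z
    using Z that by (auto simp: quadrangles_def)
  have "Z = {a, b, c, d}" using T bcd by simp
  moreover have "orient a b c \<noteq> 0" using nc[of a b c] collinear_points_iff[of a b c] T bcd d by auto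
  moreover have "orient a b d \<noteq> 0" using nc[of a b d] collinear_points_iff[of a b d] T bcd d by auto
  moreover have "orient a c d \<noteq> 0" using nc[of a c d] collinear_points_iff[of a c d] T bcd d by auto
  moreover have "orient b c d \<noteq> 0" using nc[of b c d] collinear_points_iff[of b c d] T bcd d by auto
  ultimately show "\<exists>a b c d. Z = {a, b, c, d} \<and> orient a b c \<noteq> 0 \<and> orient a b d \<noteq> 0
     \<and> orient a c d \<noteq> 0 \<and> orient b c d \<noteq> 0" by blast
next
  assume "\<exists>a b c d. Z = {a, b, c, d} \<and> orient a b c \<noteq> 0 \<and> orient a b d \<noteq> 0
     \<and> orient a c d \<noteq> 0 \<and> orient b c d \<noteq> 0"
  then obtain a b c d where Z: "Z = {a, b, c, d}" and o: "orient a b c \<noteq> 0" "orient a b d \<noteq> 0"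
     "orient a c d \<noteq> 0" "orient b c d \<noteq> 0" by blast
  then have d: "a \<noteq> b" "a \<noteq> c" "b \<noteq> c" "a \<noteq> d" "b \<noteq> d" "c \<noteq> d" by auto
  then have card: "card Z = 4" by (simp add: Z)
  have "\<not> collinear_points T" if T: "T \<subseteq> Z" "card T = 3" for T
  proof -
    have "finite T" using T(2) card_ge_0_finite by force
    then have "card (Z - T) = 1" using T card by (simp add: card_Diff_subset)
    then obtain x where x: "Z - T = {x}" by (auto simp: card_1_singleton_iff)
    then have "T = Z - {x}" "x \<in> Z" using T(1) by auto
    then have "T = {b, c, d} \<or> T = {a, c, d} \<or> T = {a, b, d} \<or> T = {a, b, c}"
      using d unfolding Z by auto
    then show ?thesis using o d by (metis collinear_points_iff)
  qed
  then show "Z \<in> quadrangles" using card by (simp add: quadrangles_def)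
qed

text \<open>Three collinear points of the flat bring in their whole line, which imposes only three
  conditions, so one further point completes it. Without such a triple, four points in general
  position already do.\<close>

lemma flat_2_iff:
  fixes Z :: "(2 \<Rightarrow> 'a::{field,finite}) set"
  assumes q: "CARD('a) \<ge> 3"
  shows "flat 2 Z \<longleftrightarrow> Z \<in> line_and_point_sets \<or> Z \<in> quadrangles"
proof
  assume Z: "flat 2 Z"
  show "Z \<in> line_and_point_sets \<or> Z \<in> quadrangles"
  proof (cases "\<exists>a\<in>Z. \<exists>b\<in>Z. \<exists>c\<in>Z. a \<noteq> b \<and> a \<noteq> c \<and> b \<noteq> c \<and> orient a b c = 0")
    case True
    then obtain a b c where abc: "a \<in> Z" "b \<in> Z" "c \<in> Z" "a \<noteq> b" "a \<noteq> c" "b \<noteq> c" "orient a b c = 0" by blast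
    let ?l = "aline (join a b)"
    have l: "affine_line ?l" by (rule affine_line_join[OF abc(4)])
    have sub: "?l \<subseteq> Z" by (rule flat_contains_line[OF Z abc])
    obtain p where p: "p \<in> Z" "p \<notin> base_locus ?l"
      using flat_grow[OF Z sub, of 2] card_vanishing_line[OF q l] by (auto simp: numeral_3_eq_3 numeral_2_eq_2)
    then have pl: "p \<notin> ?l" using base_locus_line[OF l] by simp
    have "Z = base_locus (insert p ?l)"
      using flat_eq_base_locus[OF Z, of "insert p ?l"] card_vanishing_line_point[OF q l pl] p sub by simp
    then show ?thesis using base_locus_line_point[OF l] l pl by (auto simp: line_and_point_sets_def)
  next
    case False
    then have nc: "orient x y z \<noteq> 0" if "x \<in> Z" "y \<in> Z" "z \<in> Z" "x \<noteq> y" "x \<noteq> z" "y \<noteq> z" for x y z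
      using that by blast
    obtain a b c where abc: "a \<in> Z" "b \<in> Z" "c \<in> Z" "a \<noteq> b" "a \<noteq> c" "b \<noteq> c" using flat_leE3[OF Z] by auto
    obtain d where d: "d \<in> Z" "d \<notin> base_locus {a, b, c}" "card (vanishing (insert d {a, b, c})) = CARD('a) ^ 2"
      using flat_grow[OF Z, of "{a, b, c}" 2] card_vanishing_3[of a b c] abc by (auto simp: numeral_3_eq_3 numeral_2_eq_2)
    then have dn: "d \<noteq> a" "d \<noteq> b" "d \<noteq> c" using subset_base_locus[of "{a, b, c}"] by auto
    have o: "orient a b c \<noteq> 0" "orient a b d \<noteq> 0" "orient a c d \<noteq> 0" "orient b c d \<noteq> 0"
      using nc abc d(1) dn by metis+
    have "insert d {a, b, c} = {a, b, c, d}" by auto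
    then have "Z = base_locus {a, b, c, d}"
      using flat_eq_base_locus[OF Z _ d(3)] abc d(1) by simp
    then have "Z = {a, b, c, d}" using base_locus_quadrangle[OF o] by simp
    then show ?thesis using quadrangles_iff[of Z] o by blast
  qed
next
  assume "Z \<in> line_and_point_sets \<or> Z \<in> quadrangles"
  then show "flat 2 Z"
  proof
    assume "Z \<in> line_and_point_sets"
    then obtain p l where "Z = insert p l" "affine_line l" "p \<notin> l" by (auto simp: line_and_point_sets_def)
    then show ?thesis
      using card_vanishing_line_point[OF q, of l p] base_locus_line_point[of l p] by (simp add: flat_def)
  next
    assume "Z \<in> quadrangles"
    then obtain a b c d where Z: "Z = {a, b, c, d}" and o: "orient a b c \<noteq> 0" "orient a b d \<noteq> 0"
     "orient a c d \<noteq> 0" "orient b c d \<noteq> 0" using quadrangles_iff[of Z] by blast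
    then have d: "a \<noteq> b" "a \<noteq> c" "b \<noteq> c" "a \<noteq> d" "b \<noteq> d" "c \<noteq> d" by auto
    have "base_locus {b, c, d} = {b, c, d}" by (rule base_locus_triangle[OF o(4)])
    then have "card (vanishing {a, b, c, d}) = CARD('a) ^ 2"
      using d card_vanishing_3[of b c d] card_vanishing_Suc[of "{b, c, d}" 2 a] by (simp add: eval_nat_numeral)
    then show ?thesis using base_locus_quadrangle[OF o] Z by (simp add: flat_def)
  qed
qed

section \<open>Flats cut out by a single quadric\<close>

lemma inj_scaled:
  fixes F :: "(3, 'a::field) mpoly"
  assumes "F \<noteq> 0" shows "inj (\<lambda>c. scaled c F)"
proof (rule injI)
  fix c d assume "scaled c F = scaled d F"
  then have "(single 0 c - single 0 d) * F = 0"
    by (simp add: scaled_def left_diff_distrib)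
  then have "single 0 c = (single 0 d :: (3, 'a) mpoly)" using assms by simp
  from arg_cong[OF this, of "\<lambda>F. lookup F 0"] show "c = d" by simp
qed

lemma scaled_subset_vanishing: "F \<in> vanishing Z \<Longrightarrow> range (\<lambda>c. scaled c F) \<subseteq> vanishing Z"
  by (auto simp: vanishing_def homogeneous_scaled)

lemma vanishing_eq_scaled:
  fixes Z :: "(2 \<Rightarrow> 'a::{field,finite}) set"
  assumes "card (vanishing Z) = CARD('a)" "F \<in> vanishing Z" "F \<noteq> 0"
  shows "vanishing Z = range (\<lambda>c. scaled c F)"
  using card_subset_eq[OF finite_vanishing scaled_subset_vanishing[OF assms(2)]] assms(1)
  by (simp add: card_image inj_scaled[OF assms(3)])

text \<open>The \<open>q\<close> quadrics through the flat are the multiples of any nonzero one, so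
  closing up adds exactly the zeros of that one.\<close>

lemma flat_1_zero_set:
  fixes Z :: "(2 \<Rightarrow> 'a::{field,finite}) set"
  assumes "flat 1 Z" "F \<in> vanishing Z" "F \<noteq> 0"
  shows "Z = {p. peval F (aff p) = 0}"
proof -
  have "Z = base_locus Z" "vanishing Z = range (\<lambda>c. scaled c F)"
    using vanishing_eq_scaled[OF _ assms(2,3)] assms(1) by (simp_all add: flat_def)
  then have "Z = {p. \<forall>c. peval (scaled c F) (aff p) = 0}" unfolding base_locus_def by auto
  then show ?thesis by (auto intro: exI[of _ 1] dest: spec[of _ 1])
qed

text \<open>The multiples of \<open>F\<close> give at least \<open>q\<close> quadrics through
  \<open>Z\<close>, and a subset \<open>B\<close> imposing five conditions shows that there are no
  others.\<close>

lemma flat_1I: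
  fixes F :: "(3, 'a::{field,finite}) mpoly"
  assumes F: "homogeneous 2 F" "F \<noteq> 0" and Z: "Z = {p. peval F (aff p) = 0}"
    and B: "B \<subseteq> Z" "card (vanishing B) = CARD('a)"
  shows "flat 1 Z"
proof -
  have FZ: "F \<in> vanishing Z" using F(1) by (simp add: Z vanishing_def)
  have "vanishing Z \<subseteq> vanishing B" by (rule vanishing_mono[OF B(1)])
  then have "card (vanishing Z) \<le> CARD('a)" using card_mono[OF finite_vanishing] B(2) by metis
  moreover have "CARD('a) \<le> card (vanishing Z)"
    using card_mono[OF finite_vanishing scaled_subset_vanishing[OF FZ]] by (simp add: card_image inj_scaled[OF F(2)])
  moreover have "base_locus Z = Z"
    using subset_base_locus[of Z] FZ by (auto simp: base_locus_def Z)
  ultimately show ?thesis by (simp add: flat_def)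
qed

lemma irreducible_conic_arc:
  assumes "irreducible_conic F" and d: "a \<noteq> b" "a \<noteq> c" "b \<noteq> c"
    and z: "peval F (aff a) = 0" "peval F (aff b) = 0" "peval F (aff c) = 0"
  shows "orient a b c \<noteq> 0"
proof
  interpret irreducible_conic F by fact
  assume "orient a b c = 0"
  then have "polar F (aff a) (aff b) = 0" by (rule polar_zero_if_collinear[OF hom d _ z])
  then show False using polar_nonzero[OF join_nonzero[OF d(1)] z(1,2)] by simp
qed

text \<open>Being an arc is the nonvanishing of determinants, which survives the extension of
  scalars. Each linear factor over the closure therefore contains at most two of the points, and
  \<open>2 + 2 < 5\<close>.\<close>

lemma irreducible_if_arc:
  fixes F :: "(3, 'a::field) mpoly"
  assumes F: "homogeneous 2 F" "F \<noteq> 0" and S: "card S = 5" "\<And>p. p \<in> S \<Longrightarrow> peval F (aff p) = 0"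
    and arc: "\<And>a b c. a \<in> S \<Longrightarrow> b \<in> S \<Longrightarrow> c \<in> S \<Longrightarrow> a \<noteq> b \<Longrightarrow> a \<noteq> c \<Longrightarrow> b \<noteq> c \<Longrightarrow> orient a b c \<noteq> 0"
  shows "irreducible_conic F"
proof -
  have qf: "quadratic_form F" using F by (simp add: quadratic_form_def)
  have False if split: "extend_scalars F = lin n * lin m" for n m
  proof -
    have nm: "n \<noteq> (\<lambda>_. 0)" "m \<noteq> (\<lambda>_. 0)"
      using split F(2) lin_zero_iff[of n] lin_zero_iff[of m] extend_scalars_eq_0_iff[of F] by auto
    let ?A = "\<lambda>n. {p \<in> S. dot n (to_ac \<circ> aff p) = 0}"
    have fin: "finite S" using S(1) card_ge_0_finite by force
    have le: "card (?A k) \<le> 2" if k: "k \<noteq> (\<lambda>_. 0)" for k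
    proof (rule ccontr)
      assume "\<not> ?thesis"
      then have "3 \<le> card (?A k)" by simp
      then obtain a b c where abc: "a \<in> ?A k" "b \<in> ?A k" "c \<in> ?A k" "a \<noteq> b" "a \<noteq> c" "b \<noteq> c"
        by (rule three_elements)
      have "dot (cross (to_ac \<circ> aff a) (to_ac \<circ> aff b)) (to_ac \<circ> aff c) = 0"
        using abc by (intro det_eq_0[OF k]) auto
      moreover have "dot (cross (to_ac \<circ> aff a) (to_ac \<circ> aff b)) (to_ac \<circ> aff c) = to_ac (orient a b c)"
        unfolding cross_extend by (simp add: dot_def orient_def)
      ultimately have "orient a b c = 0" by simp
      then show False using arc[of a b c] abc by auto
    qed
    have "p \<in> ?A n \<or> p \<in> ?A m" if "p \<in> S" for p
    proof -
      have "peval (extend_scalars F) (to_ac \<circ> aff p) = 0" using S(2)[OF that] by (simp add: peval_extend F(1))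
      then show ?thesis using that by (simp add: split peval_mult)
    qed
    then have "S \<subseteq> ?A n \<union> ?A m" by blast
    then have "card S \<le> card (?A n \<union> ?A m)" using fin by (intro card_mono) auto
    also have "\<dots> \<le> card (?A n) + card (?A m)" by (rule card_Un_le)
    finally show False using le[OF nm(1)] le[OF nm(2)] S(1) by simp
  qed
  then show ?thesis using absolutely_irreducible_iff[OF qf] qf by unfold_locales blast+
qed

text \<open>The second line has \<open>q - 1 \<ge> 2\<close> points off the first, and two of them
  together with the first line impose \<open>3 + 1 + 1 = 5\<close> conditions.\<close>

lemma flat_1_two_lines:
  fixes l m :: "(2 \<Rightarrow> 'a::{field,finite}) set"
  assumes q: "CARD('a) \<ge> 3" and l: "affine_line l" and m: "affine_line m" and ne: "l \<noteq> m"
  shows "flat 1 (l \<union> m)"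
proof -
  have fin: "finite (l \<inter> m)" by simp
  have "card (m - l) = card m - card (l \<inter> m)" by (simp add: card_Diff_subset_Int Int_commute)
  then have "card (m - l) \<ge> 2" using card_affine_line[OF m] card_Int_lines[OF l m ne] q by linarith
  then have "\<not> card (m - l) \<le> Suc 0" by simp
  then have "\<not> (\<forall>a\<in>m - l. \<forall>b\<in>m - l. a = b)" using card_le_Suc0_iff_eq[of "m - l"] by simp
  then obtain a b where ab: "a \<in> m" "b \<in> m" "a \<notin> l" "b \<notin> l" "a \<noteq> b" by blast
  obtain n k where n: "n 0 \<noteq> 0 \<or> n 1 \<noteq> 0" "l = aline n" and k: "k 0 \<noteq> 0 \<or> k 1 \<noteq> 0" "m = aline k"
    using l m affine_line_iff by metis
  have "b \<notin> base_locus (insert a l)" using base_locus_line_point[OF l] ab by simp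
  then have card: "card (vanishing (insert b (insert a l))) = CARD('a)"
    using card_vanishing_Suc[of "insert a l" 1 b] card_vanishing_line_point[OF q l ab(3)] by (simp add: numeral_2_eq_2)
  show ?thesis
  proof (rule flat_1I[OF homogeneous_lin_mult _ _ _ card])
    have "n \<noteq> (\<lambda>_. 0)" "k \<noteq> (\<lambda>_. 0)" using n k by auto
    then show "lin n * lin k \<noteq> 0" by (simp add: lin_zero_iff)
    show "l \<union> m = {p. peval (lin n * lin k) (aff p) = 0}" by (auto simp: n k aline_def peval_mult)
  qed (use ab in auto)
qed

text \<open>Four of the points form a quadrangle, which is its own base locus, so the fifth imposes
  a further condition.\<close>

lemma flat_1_conic:
  fixes F :: "(3, 'a::{field,finite}) mpoly"
  assumes irr: "irreducible_conic F" and Z: "Z = {p. peval F (aff p) = 0}" and card: "card Z \<ge> 5"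
  shows "flat 1 Z"
proof -
  interpret irreducible_conic F by fact
  obtain T where T: "T \<subseteq> Z" "card T = Suc (Suc 3)" using obtain_subset_with_card_n[OF card] by auto
  then obtain e T' where e: "T = insert e T'" "e \<notin> T'" "card T' = Suc 3" unfolding card_Suc_eq[of T] by blast
  then obtain d T'' where d: "T' = insert d T''" "d \<notin> T''" "card T'' = 3" unfolding card_Suc_eq by blast
  then obtain a b c where abc: "T'' = {a, b, c}" "a \<noteq> b" "a \<noteq> c" "b \<noteq> c" by (auto simp: card_3_iff)
  have dd: "a \<noteq> d" "b \<noteq> d" "c \<noteq> d" "e \<notin> {a, b, c, d}" using e d abc by auto
  have z: "peval F (aff a) = 0" "peval F (aff b) = 0" "peval F (aff c) = 0" "peval F (aff d) = 0"
    using T(1) e d abc by (auto simp: Z)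
  have o: "orient a b c \<noteq> 0" "orient a b d \<noteq> 0" "orient a c d \<noteq> 0" "orient b c d \<noteq> 0"
    using irreducible_conic_arc[OF irr] z abc dd by metis+
  have "d \<notin> base_locus {a, b, c}" using base_locus_triangle[OF o(1)] dd by auto
  then have 4: "card (vanishing (insert d {a, b, c})) = CARD('a) ^ 2"
    using card_vanishing_3[of a b c] abc card_vanishing_Suc[of "{a, b, c}" 2 d] by (simp add: eval_nat_numeral)
  have eq: "insert d {a, b, c} = {a, b, c, d}" by auto
  have "e \<notin> base_locus (insert d {a, b, c})" unfolding eq base_locus_quadrangle[OF o] using dd by simp
  then have card': "card (vanishing (insert e (insert d {a, b, c}))) = CARD('a)"
    using 4 card_vanishing_Suc[of "insert d {a, b, c}" 1 e] by (simp add: eval_nat_numeral)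
  have sub: "insert e (insert d {a, b, c}) \<subseteq> Z" using T(1) e d abc by simp
  have "F \<noteq> 0" using quadratic by (simp add: quadratic_form_def)
  then show ?thesis by (rule flat_1I[OF hom _ Z sub card'])
qed

theorem flat_1_iff:
  fixes Z :: "(2 \<Rightarrow> 'a::{field,finite}) set"
  assumes q: "CARD('a) \<ge> 3"
  shows "flat 1 Z \<longleftrightarrow> (\<exists>l m. affine_line l \<and> affine_line m \<and> l \<noteq> m \<and> Z = l \<union> m)
    \<or> (\<exists>F. irreducible_conic F \<and> Z = {p. peval F (aff p) = 0} \<and> card Z \<ge> 5)"
proof
  assume Z: "flat 1 Z"
  show "(\<exists>l m. affine_line l \<and> affine_line m \<and> l \<noteq> m \<and> Z = l \<union> m)
    \<or> (\<exists>F. irreducible_conic F \<and> Z = {p. peval F (aff p) = 0} \<and> card Z \<ge> 5)"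
  proof (cases "\<exists>a\<in>Z. \<exists>b\<in>Z. \<exists>c\<in>Z. a \<noteq> b \<and> a \<noteq> c \<and> b \<noteq> c \<and> orient a b c = 0")
    case True
    then obtain a b c where abc: "a \<in> Z" "b \<in> Z" "c \<in> Z" "a \<noteq> b" "a \<noteq> c" "b \<noteq> c" "orient a b c = 0" by blast
    let ?l = "aline (join a b)"
    have l: "affine_line ?l" by (rule affine_line_join[OF abc(4)])
    have sub: "?l \<subseteq> Z" by (rule flat_contains_line[OF Z abc])
    obtain p where p: "p \<in> Z" "p \<notin> base_locus ?l"
      using flat_grow[OF Z sub, of 2] card_vanishing_line[OF q l] by (auto simp: numeral_3_eq_3 numeral_2_eq_2)
    then have pl: "p \<notin> ?l" using base_locus_line[OF l] by simp
    obtain r where r: "r \<in> Z" "r \<notin> base_locus (insert p ?l)" "card (vanishing (insert r (insert p ?l))) = CARD('a) ^ 1"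
      using flat_grow[OF Z, of "insert p ?l" 1] card_vanishing_line_point[OF q l pl] sub p(1) by (auto simp: numeral_2_eq_2)
    then have rp: "r \<noteq> p" using base_locus_line_point[OF l] by simp
    \<comment> \<open>The second line has to join the two points added to the first one: this line
      pair then passes through the whole generating set and must be the defining quadric.\<close>
    let ?m = "aline (join p r)" and ?F = "lin (join a b) * lin (join p r)"
    have m: "affine_line ?m" using affine_line_join rp by metis
    have eq: "Z = base_locus (insert r (insert p ?l))"
      using flat_eq_base_locus[OF Z _ r(3)] r(1) p(1) sub by simp
    have "?F \<in> vanishing (insert r (insert p ?l))"
      by (auto simp: vanishing_def homogeneous_lin_mult peval_mult mem_aline orient_def[symmetric])
    then have "?F \<in> vanishing Z" unfolding eq vanishing_base_locus .
    moreover have "?F \<noteq> 0" using join_nonzero[OF abc(4)] join_nonzero[OF rp] rp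
      by (simp add: lin_zero_iff cross_aff_eq_0_iff)
    ultimately have "Z = {p. peval ?F (aff p) = 0}" by (rule flat_1_zero_set[OF Z])
    also have "\<dots> = ?l \<union> ?m" by (auto simp: peval_mult aline_def)
    finally have "Z = ?l \<union> ?m" .
    moreover have "?l \<noteq> ?m" using pl by (auto simp: mem_join)
    ultimately show ?thesis using l m by blast
  next
    case False
    then have nc: "orient x y z \<noteq> 0" if "x \<in> Z" "y \<in> Z" "z \<in> Z" "x \<noteq> y" "x \<noteq> z" "y \<noteq> z" for x y z
      using that by blast
    obtain a b c where abc: "a \<in> Z" "b \<in> Z" "c \<in> Z" "a \<noteq> b" "a \<noteq> c" "b \<noteq> c" using flat_leE3[OF Z] by auto
    obtain d where d: "d \<in> Z" "d \<notin> base_locus {a, b, c}" "card (vanishing (insert d {a, b, c})) = CARD('a) ^ 2"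
      using flat_grow[OF Z, of "{a, b, c}" 2] card_vanishing_3[of a b c] abc by (auto simp: numeral_3_eq_3 numeral_2_eq_2)
    obtain e where e: "e \<in> Z" "e \<notin> base_locus (insert d {a, b, c})"
      using flat_grow[OF Z _ d(3)[unfolded numeral_2_eq_2]] abc d(1) by auto
    let ?S = "{e, d, a, b, c}"
    have "d \<notin> {a, b, c}" "e \<notin> insert d {a, b, c}"
      using d(2) e(2) subset_base_locus[of "{a, b, c}"] subset_base_locus[of "insert d {a, b, c}"] by auto
    then have S: "card ?S = 5" "?S \<subseteq> Z" using abc d(1) e(1) by auto
    have "card (vanishing Z) > 1" using Z card_field_gt_1[where 'a = 'a] by (simp add: flat_def)
    then have "\<not> vanishing Z \<subseteq> {0}" using card_mono[of "{0}" "vanishing Z"] by auto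
    then obtain F where F: "F \<in> vanishing Z" "F \<noteq> 0" by blast
    have "irreducible_conic F"
    proof (rule irreducible_if_arc[OF _ F(2) S(1)])
      show "homogeneous 2 F" using F(1) by (simp add: vanishing_def)
      show "\<And>p. p \<in> ?S \<Longrightarrow> peval F (aff p) = 0" using S(2) F(1) by (auto simp: vanishing_def)
      show "\<And>x y z. x \<in> ?S \<Longrightarrow> y \<in> ?S \<Longrightarrow> z \<in> ?S \<Longrightarrow> x \<noteq> y \<Longrightarrow> x \<noteq> z \<Longrightarrow> y \<noteq> z \<Longrightarrow> orient x y z \<noteq> 0"
        using nc S(2) by blast
    qed
    moreover have "Z = {p. peval F (aff p) = 0}" by (rule flat_1_zero_set[OF Z F])
    moreover have "card Z \<ge> 5" using card_mono[OF _ S(2)] S(1) by simp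
    ultimately show ?thesis by blast
  qed
qed (use flat_1_two_lines[OF q] flat_1_conic in blast)


section \<open>The types of conics\<close>

lemma proj_line_iff: "proj_line l \<longleftrightarrow> (\<exists>n. n \<noteq> (\<lambda>_. 0) \<and> l = proj_zeros (lin n))"
proof
  assume "proj_line l"
  then obtain G where "G \<noteq> 0" "homogeneous 1 G" "l = proj_zeros G" by (auto simp: proj_line_def)
  moreover from this obtain n where "G = lin n" using lin_eqI by blast
  ultimately show "\<exists>n. n \<noteq> (\<lambda>_. 0) \<and> l = proj_zeros (lin n)" using lin_zero_iff by blast
next
  assume "\<exists>n. n \<noteq> (\<lambda>_. 0) \<and> l = proj_zeros (lin n)"
  then show "proj_line l" using homogeneous_lin lin_zero_iff unfolding proj_line_def by metis
qed

lemma affine_part_line: "affine_part (proj_zeros (lin n)) = aline n"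
  by (simp add: affine_part_def embed_eq proj_point_in_line aline_def)

lemma proj_zeros_lin_mult: "proj_zeros (lin n * lin m) = proj_zeros (lin n) \<union> proj_zeros (lin m)"
proof -
  have "x \<in> proj_zeros (lin n * lin m) \<longleftrightarrow> x \<in> proj_zeros (lin n) \<union> proj_zeros (lin m)" if "x \<in> proj_plane" for x
  proof -
    obtain v where "v \<noteq> (\<lambda>_. 0)" "x = proj_point v" using \<open>x \<in> proj_plane\<close> by (elim proj_planeE)
    then show ?thesis by (simp add: proj_point_in_conic homogeneous_lin_mult proj_point_in_line peval_mult)
  qed
  then show ?thesis using proj_zeros_subset by blast
qed

lemma line_at_infinity_eq: "n 0 = 0 \<Longrightarrow> n 1 = 0 \<Longrightarrow> n \<noteq> (\<lambda>_. 0) \<Longrightarrow> proj_zeros (lin n) = line_at_infinity"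
proof -
  assume n: "n 0 = 0" "n 1 = 0" "n \<noteq> (\<lambda>_. 0)"
  then have n2: "n 2 \<noteq> 0" by (simp add: nonzero_3)
  have "x \<in> proj_zeros (lin n) \<longleftrightarrow> x \<in> line_at_infinity" if "x \<in> proj_plane" for x
  proof -
    obtain v where "v \<noteq> (\<lambda>_. 0)" "x = proj_point v" using \<open>x \<in> proj_plane\<close> by (elim proj_planeE)
    then show ?thesis using n n2 by (simp add: proj_point_in_infinity proj_point_in_line dot_def)
  qed
  then show ?thesis using proj_zeros_subset unfolding line_at_infinity_def by blast
qed

lemma affine_part_infinity: "affine_part line_at_infinity = {}"
  by (auto simp: affine_part_def embed_eq proj_point_in_infinity)

lemma affine_part_Un: "affine_part (C \<union> D) = affine_part C \<union> affine_part D"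
  by (auto simp: affine_part_def)

text \<open>If the affine parts coincided, two distinct affine points would both equal the unique
  common point \<open>p\<close>.\<close>

lemma line_pair_affine_part:
  fixes l m :: "(3 \<Rightarrow> 'a::{field,finite}) set set"
  assumes "proj_line l" "proj_line m" "l \<noteq> line_at_infinity" "m \<noteq> line_at_infinity" "l \<inter> m = {p}"
  shows "\<exists>l' m'. affine_line l' \<and> affine_line m' \<and> l' \<noteq> m' \<and> affine_part (l \<union> m) = l' \<union> m'"
proof -
  obtain n k where n: "n \<noteq> (\<lambda>_. 0)" "l = proj_zeros (lin n)" and k: "k \<noteq> (\<lambda>_. 0)" "m = proj_zeros (lin k)"
    using assms(1,2) proj_line_iff by metis
  have "n 0 \<noteq> 0 \<or> n 1 \<noteq> 0" "k 0 \<noteq> 0 \<or> k 1 \<noteq> 0"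
    using line_at_infinity_eq n k assms(3,4) by blast+
  then have lines: "affine_line (aline n)" "affine_line (aline k)" using affine_line_iff by blast+
  have "aline n \<noteq> aline k"
  proof
    assume eq: "aline n = aline k"
    have "card (aline n) > 1" using card_affine_line[OF lines(1)] card_field_gt_1[where 'a = 'a] by simp
    then have "\<not> (\<forall>a\<in>aline n. \<forall>b\<in>aline n. a = b)" using card_le_Suc0_iff_eq[of "aline n"] by simp
    then obtain a b where ab: "a \<in> aline n" "b \<in> aline n" "a \<noteq> b" by blast
    then have "embed a \<in> l \<inter> m" "embed b \<in> l \<inter> m"
      using eq by (auto simp: n k embed_eq proj_point_in_line aline_def)
    then show False using assms(5) ab(3) inj_embed by (auto dest: injD)
  qed
  moreover have "affine_part (l \<union> m) = aline n \<union> aline k"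
    by (simp add: affine_part_Un n k affine_part_line)
  ultimately show ?thesis using lines by blast
qed

text \<open>The projective closures meet in the point with coordinates \<open>cross n k\<close>. It
  lies at infinity exactly when the affine lines are parallel, which decides between the two
  types.\<close>

lemma line_pair_type:
  fixes l m :: "(2 \<Rightarrow> 'a::{field,finite}) set"
  assumes l: "affine_line l" and m: "affine_line m" and ne: "l \<noteq> m"
  obtains C where "if l \<inter> m = {} then conic_type_e C else conic_type_d C" "affine_part C = l \<union> m"
proof -
  obtain n k where n: "n 0 \<noteq> 0 \<or> n 1 \<noteq> 0" "l = aline n" and k: "k 0 \<noteq> 0 \<or> k 1 \<noteq> 0" "m = aline k"
    using l m affine_line_iff by metis
  have nz: "n \<noteq> (\<lambda>_. 0)" "k \<noteq> (\<lambda>_. 0)" using n k by auto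
  let ?l = "proj_zeros (lin n)" and ?m = "proj_zeros (lin k)"
  let ?C = "proj_zeros (lin n * lin k)" and ?p = "proj_point (cross n k)"
  have aff: "affine_part ?l = l" "affine_part ?m = m" by (simp_all add: affine_part_line n k)
  have lm: "proj_line ?l" "proj_line ?m" using proj_line_iff nz by blast+
  have conic: "conic ?C"
    unfolding conic_def quadratic_form_def using nz homogeneous_lin_mult
    by (intro exI[of _ "lin n * lin k"]) (auto simp: lin_zero_iff)
  have C: "?C = ?l \<union> ?m" by (rule proj_zeros_lin_mult)
  have "l \<noteq> {}" "m \<noteq> {}" using card_affine_line[OF l] card_affine_line[OF m] by auto
  then have inf: "?l \<noteq> line_at_infinity" "?m \<noteq> line_at_infinity"
    using aff affine_part_infinity by metis+
  have ne': "?l \<noteq> ?m" using aff ne by metis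
  have cz: "cross n k \<noteq> (\<lambda>_. 0)"
  proof
    assume "cross n k = (\<lambda>_. 0)"
    then obtain s where s: "n = (\<lambda>i. s * k i)" using cross_eq_0D nz by blast
    then have "s \<noteq> 0" using nz by auto
    moreover have "dot (\<lambda>i. s * k i) v = s * dot k v" for v by (simp add: dot_def algebra_simps)
    ultimately have "aline n = aline k" unfolding s aline_def by simp
    then show False using ne n k by simp
  qed
  have int: "?l \<inter> ?m = {?p}"
  proof (rule equalityI; rule subsetI)
    fix x assume x: "x \<in> ?l \<inter> ?m"
    then obtain v where v: "v \<noteq> (\<lambda>_. 0)" "x = proj_point v" using proj_planeE proj_zeros_subset by blast
    then have "dot n v = 0" "dot k v = 0" using x by (simp_all add: proj_point_in_line)
    \<comment> \<open>The vector triple product: a common zero of both lines is proportional to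
      \<open>cross n k\<close>.\<close>
    moreover have "cross v (cross n k) = (\<lambda>i. dot k v * n i - dot n v * k i)"
      by (simp add: fun_eq_3 dot_def algebra_simps)
    ultimately show "x \<in> {?p}" using v cz by (simp add: proj_point_eq_cross)
  qed (auto simp: proj_point_in_line cz dot_def algebra_simps)
  have "?p \<in> line_at_infinity \<longleftrightarrow> l \<inter> m = {}"
  proof
    assume "?p \<in> line_at_infinity"
    moreover have "embed a \<notin> line_at_infinity" for a :: "2 \<Rightarrow> 'a"
      using affine_part_infinity[where 'a = 'a] by (auto simp: affine_part_def)
    ultimately have "embed a \<notin> {?p}" for a :: "2 \<Rightarrow> 'a" by (metis singletonD)
    then have "embed a \<notin> ?l \<inter> ?m" for a :: "2 \<Rightarrow> 'a" using int by simp
    then show "l \<inter> m = {}" using aff by (auto simp: affine_part_def)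
  next
    assume emp: "l \<inter> m = {}"
    show "?p \<in> line_at_infinity"
    proof (rule ccontr)
      assume "?p \<notin> line_at_infinity"
      then have c2: "cross n k 2 \<noteq> 0" using cz proj_point_in_infinity by blast
      let ?a = "vec2 (cross n k 0 / cross n k 2) (cross n k 1 / cross n k 2)"
      have "?p = embed ?a" by (rule proj_point_eq_embed[of "cross n k", OF c2])
      then have "embed ?a \<in> ?l \<inter> ?m" using int by simp
      then have "?a \<in> l \<inter> m" using aff by (auto simp: affine_part_def)
      then show False using emp by simp
    qed
  qed
  moreover have "conic_type_e ?C" if "?p \<in> line_at_infinity"
    unfolding conic_type_e_def
    by (intro conjI exI[of _ ?l] exI[of _ ?m] exI[of _ ?p] conic lm ne' inf C int that)
  moreover have "conic_type_d ?C" if "?p \<notin> line_at_infinity"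
    unfolding conic_type_d_def
    by (intro conjI exI[of _ ?l] exI[of _ ?m] exI[of _ ?p] conic lm ne' C int that)
  ultimately have "if l \<inter> m = {} then conic_type_e ?C else conic_type_d ?C" by simp
  moreover have "affine_part ?C = l \<union> m" by (simp add: C affine_part_Un aff)
  ultimately show thesis by (rule that)
qed

lemma type_d_or_e_affine_part:
  fixes C :: "(3 \<Rightarrow> 'a::{field,finite}) set set"
  assumes "conic_type_d C \<or> conic_type_e C"
  shows "\<exists>l m. affine_line l \<and> affine_line m \<and> l \<noteq> m \<and> affine_part C = l \<union> m"
  using assms
proof
  assume "conic_type_d C"
  then obtain l m p where lm: "proj_line l" "proj_line m" "C = l \<union> m" "l \<inter> m = {p}" "p \<notin> line_at_infinity"
    unfolding conic_type_d_def by blast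
  \<comment> \<open>The common point \<open>p\<close> lies on both lines but not at
    infinity.\<close>
  then have "l \<noteq> line_at_infinity" "m \<noteq> line_at_infinity" by blast+
  then show ?thesis using line_pair_affine_part[OF lm(1,2) _ _ lm(4)] lm(3) by blast
next
  assume "conic_type_e C"
  then obtain l m p where lm: "proj_line l" "proj_line m" "C = l \<union> m" "l \<inter> m = {p}"
      "l \<noteq> line_at_infinity" "m \<noteq> line_at_infinity"
    unfolding conic_type_e_def by blast
  then show ?thesis using line_pair_affine_part[OF lm(1,2,5,6,4)] by blast
qed

lemma affine_parts_de_iff:
  fixes Z :: "(2 \<Rightarrow> 'a::{field,finite}) set"
  shows "(\<exists>C. (conic_type_e C \<or> conic_type_d C) \<and> Z = affine_part C) \<longleftrightarrow>
    (\<exists>l m. affine_line l \<and> affine_line m \<and> l \<noteq> m \<and> Z = l \<union> m)"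
proof
  assume "\<exists>C. (conic_type_e C \<or> conic_type_d C) \<and> Z = affine_part C"
  then show "\<exists>l m. affine_line l \<and> affine_line m \<and> l \<noteq> m \<and> Z = l \<union> m"
    using type_d_or_e_affine_part by blast
next
  assume "\<exists>l m. affine_line l \<and> affine_line m \<and> l \<noteq> m \<and> Z = l \<union> m"
  then obtain l m where "affine_line l" "affine_line m" "l \<noteq> m" "Z = l \<union> m" by blast
  then obtain C where "if l \<inter> m = {} then conic_type_e C else conic_type_d C" "affine_part C = Z"
    using line_pair_type by metis
  then show "\<exists>C. (conic_type_e C \<or> conic_type_d C) \<and> Z = affine_part C" by (metis (full_types))
qed

text \<open>A uniform description of the irreducible types: (h), (g) and (f) correspond to
  \<open>k = 0\<close>, \<open>1\<close> and \<open>2\<close>, so that the dependence on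
  \<open>q\<close> becomes one inequality.\<close>

definition conic_meeting_infinity :: "nat \<Rightarrow> (3 \<Rightarrow> 'a::field) set set \<Rightarrow> bool" where
  "conic_meeting_infinity k C \<longleftrightarrow>
     (\<exists>F. irreducible_conic F \<and> C = proj_zeros F \<and> card (C \<inter> line_at_infinity) = k)"

lemma conic_type_f_iff: "conic_type_f C \<longleftrightarrow> conic_meeting_infinity 2 C"
  unfolding conic_type_f_def conic_meeting_infinity_def irreducible_conic_def by blast

lemma conic_type_g_iff: "conic_type_g C \<longleftrightarrow> conic_meeting_infinity 1 C"
  unfolding conic_type_g_def conic_meeting_infinity_def
  using irreducible_conic.ex_tangent_iff irreducible_conic_def by blast

text \<open>Over a finite field cardinality 0 does mean empty, whereas \<open>card\<close> also
  assigns 0 to infinite sets.\<close>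

lemma conic_type_h_iff:
  fixes C :: "(3 \<Rightarrow> 'a::{field,finite}) set set"
  shows "conic_type_h C \<longleftrightarrow> conic_meeting_infinity 0 C"
proof -
  have "card (C \<inter> line_at_infinity) = 0 \<longleftrightarrow> C \<inter> line_at_infinity = {}" by simp
  then show ?thesis
    unfolding conic_type_h_def conic_meeting_infinity_def irreducible_conic_def by blast
qed

text \<open>An irreducible conic with \<open>k\<close> points at infinity has
  \<open>q + 1 - k\<close> affine points; requiring at least five of them is the inequality
  \<open>k + 4 \<le> q\<close>.\<close>

theorem flat_1_iff_conic:
  fixes Z :: "(2 \<Rightarrow> 'a::{field,finite}) set"
  assumes q: "CARD('a) \<ge> 3"
  shows "flat 1 Z \<longleftrightarrow> (\<exists>C. (conic_type_e C \<or> conic_type_d C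
    \<or> (\<exists>k\<le>2. k + 4 \<le> CARD('a) \<and> conic_meeting_infinity k C)) \<and> Z = affine_part C)"
proof -
  have "(\<exists>F. irreducible_conic F \<and> Z = {p. peval F (aff p) = 0} \<and> card Z \<ge> 5) \<longleftrightarrow>
    (\<exists>C. (\<exists>k\<le>2. k + 4 \<le> CARD('a) \<and> conic_meeting_infinity k C) \<and> Z = affine_part C)"
  proof
    assume "\<exists>F. irreducible_conic F \<and> Z = {p. peval F (aff p) = 0} \<and> card Z \<ge> 5"
    then obtain F where F: "irreducible_conic F" "Z = {p. peval F (aff p) = 0}" "card Z \<ge> 5" by blast
    let ?k = "card (proj_zeros F \<inter> line_at_infinity)"
    have "?k \<le> 2" by (rule irreducible_conic.card_infinity_le_2[OF F(1)])
    moreover have "?k + 4 \<le> CARD('a)" using card_affine_irreducible_conic[OF F(1)] F(2,3) by simp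
    moreover have "conic_meeting_infinity ?k (proj_zeros F)" using F(1) unfolding conic_meeting_infinity_def by blast
    moreover have "Z = affine_part (proj_zeros F)" using F by (simp add: affine_part_conic irreducible_conic.hom)
    ultimately show "\<exists>C. (\<exists>k\<le>2. k + 4 \<le> CARD('a) \<and> conic_meeting_infinity k C) \<and> Z = affine_part C" by blast
  next
    assume "\<exists>C. (\<exists>k\<le>2. k + 4 \<le> CARD('a) \<and> conic_meeting_infinity k C) \<and> Z = affine_part C"
    then obtain k F where F: "irreducible_conic F" "Z = affine_part (proj_zeros F)"
      "card (proj_zeros F \<inter> line_at_infinity) = k" "k + 4 \<le> CARD('a)"
      unfolding conic_meeting_infinity_def by blast
    then have "Z = {p. peval F (aff p) = 0}" by (simp add: affine_part_conic irreducible_conic.hom)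
    moreover from this have "card Z \<ge> 5" using card_affine_irreducible_conic[OF F(1)] F(3,4) by simp
    ultimately show "\<exists>F. irreducible_conic F \<and> Z = {p. peval F (aff p) = 0} \<and> card Z \<ge> 5" using F(1) by blast
  qed
  then show ?thesis
    unfolding flat_1_iff[OF q] affine_parts_de_iff[symmetric] by blast
qed


section \<open>Counting configurations\<close>

text \<open>Every line is either \<open>y = s x + t\<close>, giving \<open>q^2\<close> of them, or
  \<open>x = c\<close>, giving \<open>q\<close>; the parameters are unique and the two families
  disjoint.\<close>

lemma card_affine_lines: "card {l :: (2 \<Rightarrow> 'a::{field,finite}) set. affine_line l} = CARD('a)^2 + CARD('a)"
proof -
  let ?f = "\<lambda>(s, t). {p :: 2 \<Rightarrow> 'a. p 1 = s * p 0 + t}" and ?g = "\<lambda>c. {p :: 2 \<Rightarrow> 'a. p 0 = c}"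
  have "{l :: (2 \<Rightarrow> 'a) set. affine_line l} = range ?f \<union> range ?g"
  proof (intro equalityI subsetI)
    fix l :: "(2 \<Rightarrow> 'a) set" assume "l \<in> {l. affine_line l}"
    then obtain a b c where abc: "a \<noteq> 0 \<or> b \<noteq> 0" "l = {p. a * p 0 + b * p 1 + c = 0}" by (auto simp: affine_line_def)
    show "l \<in> range ?f \<union> range ?g"
    proof (cases "b = 0")
      case True
      then have "l = ?g (- c / a)" using abc by (auto simp: field_simps eq_neg_iff_add_eq_0)
      then show ?thesis by blast
    next
      case False
      have key: "a * x + b * y + c = 0 \<longleftrightarrow> y = - a / b * x + - c / b" for x y
      proof -
        have "y = - a / b * x + - c / b \<longleftrightarrow> b * y = b * (- a / b * x + - c / b)" using False by simp
        also have "b * (- a / b * x + - c / b) = - (a * x + c)" using False by (simp add: right_diff_distrib)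
        finally show ?thesis by (simp add: eq_neg_iff_add_eq_0 algebra_simps)
      qed
      have "l = ?f (- a / b, - c / b)" by (simp only: abc(2) key prod.case)
      then show ?thesis by blast
    qed
  next
    fix l assume "l \<in> range ?f \<union> range ?g"
    then show "l \<in> {l. affine_line l}"
    proof
      assume "l \<in> range ?f"
      then obtain s t where "l = {p. p 1 = s * p 0 + t}" by auto
      then have "l = {p. s * p 0 + (- 1) * p 1 + t = 0}" by (auto simp: algebra_simps)
      then show ?thesis unfolding affine_line_def mem_Collect_eq by (intro exI[of _ s] exI[of _ "- 1"] exI[of _ t]) simp
    next
      assume "l \<in> range ?g"
      then obtain c where "l = {p. p 0 = c}" by auto
      then have "l = {p. 1 * p 0 + 0 * p 1 + - c = 0}" by auto
      then show ?thesis unfolding affine_line_def mem_Collect_eq by (intro exI[of _ 1] exI[of _ 0] exI[of _ "- c"]) simp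
    qed
  qed
  moreover have "card (range ?f \<union> range ?g) = card (range ?f) + card (range ?g)"
  proof (rule card_Un_disjoint)
    show "range ?f \<inter> range ?g = {}"
    proof (rule ccontr)
      assume "range ?f \<inter> range ?g \<noteq> {}"
      then obtain s t c where eq: "{p :: 2 \<Rightarrow> 'a. p 1 = s * p 0 + t} = {p. p 0 = c}" by auto
      have "vec2 c y \<in> {p. p 0 = c}" for y by simp
      then have "y = s * c + t" for y unfolding eq[symmetric] by simp
      then show False by (metis zero_neq_one)
    qed
  qed auto
  moreover have "inj ?f"
  proof (rule injI, clarify)
    fix s t s' t' :: 'a assume eq: "{p :: 2 \<Rightarrow> 'a. p 1 = s * p 0 + t} = {p. p 1 = s' * p 0 + t'}"
    have "vec2 0 t \<in> {p. p 1 = s * p 0 + t}" "vec2 1 (s + t) \<in> {p. p 1 = s * p 0 + t}" by simp_all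
    then show "s = s' \<and> t = t'" unfolding eq by simp
  qed
  moreover have "inj ?g"
  proof (rule injI)
    fix c d assume eq: "?g c = ?g d"
    have "vec2 c 0 \<in> ?g c" by simp
    then show "c = d" unfolding eq by simp
  qed
  ultimately show ?thesis by (simp add: card_image power2_eq_square)
qed

lemma card_line_compl:
  fixes l :: "(2 \<Rightarrow> 'a::{field,finite}) set"
  assumes "affine_line l" shows "card (- l) = CARD('a)^2 - CARD('a)"
  using card_affine_line[OF assms] card_affine_plane[where 'a = 'a] by (simp add: Compl_eq_Diff_UNIV card_Diff_subset)

text \<open>The set determines its line: two different lines in it would share at least
  \<open>q - 1 \<ge> 2\<close> points. So these sets correspond to pairs of a line and a point off
  it.\<close>

lemma card_line_and_point_sets:
  assumes q: "CARD('a::{field,finite}) \<ge> 3"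
  shows "card (line_and_point_sets :: (2 \<Rightarrow> 'a) set set) = (CARD('a)^2 + CARD('a)) * (CARD('a)^2 - CARD('a))"
proof -
  let ?S = "Sigma {l :: (2 \<Rightarrow> 'a) set. affine_line l} (\<lambda>l. - l)"
  have eq: "line_and_point_sets = (\<lambda>(l, p). insert p l) ` ?S"
    unfolding line_and_point_sets_def by force
  have "inj_on (\<lambda>(l, p). insert p l) ?S"
  proof (rule inj_onI, clarsimp)
    fix l m :: "(2 \<Rightarrow> 'a) set" and p r
    assume l: "affine_line l" "p \<notin> l" and m: "affine_line m" "r \<notin> m" and eq: "insert p l = insert r m"
    have "l = m"
    proof (rule ccontr)
      assume "l \<noteq> m"
      have "l - {r} \<subseteq> l \<inter> m" using eq by auto
      then have "card (l - {r}) \<le> card (l \<inter> m)" by (intro card_mono) auto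
      moreover have "card l - 1 \<le> card (l - {r})" by (cases "r \<in> l") auto
      ultimately show False using card_Int_lines[OF l(1) m(1) \<open>l \<noteq> m\<close>] card_affine_line[OF l(1)] q by linarith
    qed
    then show "l = m \<and> p = r" using eq l m by auto
  qed
  then have "card (line_and_point_sets :: (2 \<Rightarrow> 'a) set set) = card ?S" by (simp add: eq card_image)
  also have "\<dots> = (\<Sum>l\<in>{l :: (2 \<Rightarrow> 'a) set. affine_line l}. card (- l))" by simp
  also have "\<dots> = (\<Sum>l\<in>{l :: (2 \<Rightarrow> 'a) set. affine_line l}. CARD('a)^2 - CARD('a))"
    by (rule sum.cong) (auto simp: card_line_compl)
  finally show ?thesis by (simp add: card_affine_lines)
qed

text \<open>Double counting of pairs of a set in \<open>B\<close> and one of its points, each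
  regarded as a set in \<open>A\<close> and a point extending it.\<close>

lemma card_extensions:
  fixes A B :: "'b::finite set set"
  assumes B: "\<And>S. S \<in> B \<Longrightarrow> card S = Suc k" "\<And>S x. S \<in> B \<Longrightarrow> x \<in> S \<Longrightarrow> S - {x} \<in> A"
    and ext: "\<And>T. T \<in> A \<Longrightarrow> card {x. x \<notin> T \<and> insert x T \<in> B} = n"
  shows "Suc k * card B = n * card A"
proof -
  let ?E = "\<lambda>T. {x. x \<notin> T \<and> insert x T \<in> B}"
  have "bij_betw (\<lambda>(S, x). (S - {x}, x)) (Sigma B (\<lambda>S. S)) (Sigma A ?E)"
    by (rule bij_betw_byWitness[of _ "\<lambda>(T, x). (insert x T, x)"]) (use B(2) in \<open>auto simp: insert_absorb\<close>)
  then have "card (Sigma B (\<lambda>S. S)) = card (Sigma A ?E)" by (rule bij_betw_same_card)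
  moreover have "card (Sigma B (\<lambda>S. S)) = (\<Sum>S\<in>B. card S)" "card (Sigma A ?E) = (\<Sum>T\<in>A. card (?E T))"
    by (simp_all add: card_SigmaI)
  moreover have "(\<Sum>S\<in>B. card S) = (\<Sum>S\<in>B. Suc k)" by (rule sum.cong) (use B(1) in auto)
  moreover have "(\<Sum>T\<in>A. card (?E T)) = (\<Sum>T\<in>A. n)" by (rule sum.cong) (use ext in auto)
  ultimately show ?thesis by (simp add: mult.commute)
qed

lemma card_pairs: "card {S :: (2 \<Rightarrow> 'a::finite) set. card S = 2} = CARD('a)^2 choose 2"
  using n_subsets[of "UNIV :: (2 \<Rightarrow> 'a) set" 2] card_affine_plane[where 'a = 'a] by simp

lemma triangle_insert_iff:
  "a \<noteq> b \<Longrightarrow> x \<notin> {a, b} \<and> {x, a, b} \<in> triangles \<longleftrightarrow> x \<notin> aline (join a b)"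
proof -
  assume ab: "a \<noteq> b"
  have "{x, a, b} = {a, b, x}" by auto
  then have "{x, a, b} \<in> triangles \<longleftrightarrow> card {a, b, x} = 3 \<and> orient a b x \<noteq> 0"
    using collinear_points_iff[OF ab, of x] by (simp add: triangles_def)
  then show ?thesis using ab by (auto simp: mem_join card_insert_if)
qed

lemma three_card_triangles:
  "3 * card (triangles :: (2 \<Rightarrow> 'a::{field,finite}) set set) = (CARD('a)^2 - CARD('a)) * (CARD('a)^2 choose 2)"
proof -
  have "Suc 2 * card (triangles :: (2 \<Rightarrow> 'a) set set) = (CARD('a)^2 - CARD('a)) * card {S :: (2 \<Rightarrow> 'a) set. card S = 2}"
  proof (rule card_extensions)
    fix S :: "(2 \<Rightarrow> 'a) set" assume "S \<in> triangles"
    then show S: "card S = Suc 2" by (simp add: triangles_def)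
    show "S - {x} \<in> {S. card S = 2}" if "x \<in> S" for x using S that by simp
  next
    fix T :: "(2 \<Rightarrow> 'a) set" assume "T \<in> {S. card S = 2}"
    then obtain a b where T: "T = {a, b}" "a \<noteq> b" by (auto simp: card_2_iff)
    have "{x. x \<notin> T \<and> insert x T \<in> triangles} = - aline (join a b)"
      unfolding T(1) triangle_insert_iff[OF T(2)] by auto
    then show "card {x. x \<notin> T \<and> insert x T \<in> triangles} = CARD('a)^2 - CARD('a)"
      using card_line_compl[OF affine_line_join[OF T(2)]] by simp
  qed
  then show ?thesis by (simp add: card_pairs)
qed

lemma quadrangle_insert_iff:
  assumes t: "orient a b c \<noteq> 0"
  shows "x \<notin> {a, b, c} \<and> insert x {a, b, c} \<in> quadrangles \<longleftrightarrow>
    x \<notin> aline (join a b) \<union> aline (join a c) \<union> aline (join b c)"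
proof -
  have d: "a \<noteq> b" "a \<noteq> c" "b \<noteq> c" using t by auto
  have eq: "insert x {a, b, c} = {a, b, c, x}" by auto
  show ?thesis
  proof
    assume x: "x \<notin> {a, b, c} \<and> insert x {a, b, c} \<in> quadrangles"
    then have nc: "\<not> collinear_points T" if "T \<subseteq> insert x {a, b, c}" "card T = 3" for T
      using that unfolding quadrangles_def by blast
    have "\<not> collinear_points {a, b, x}" "\<not> collinear_points {a, c, x}" "\<not> collinear_points {b, c, x}"
      by (rule nc; use d x in auto)+
    then show "x \<notin> aline (join a b) \<union> aline (join a c) \<union> aline (join b c)"
      using d by (simp add: collinear_points_iff mem_join)
  next
    assume "x \<notin> aline (join a b) \<union> aline (join a c) \<union> aline (join b c)"
    then have o: "orient a b x \<noteq> 0" "orient a c x \<noteq> 0" "orient b c x \<noteq> 0" by (auto simp: mem_join)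
    then have "x \<notin> {a, b, c}" by auto
    moreover have "insert x {a, b, c} \<in> quadrangles"
      unfolding eq quadrangles_iff using t o by blast
    ultimately show "x \<notin> {a, b, c} \<and> insert x {a, b, c} \<in> quadrangles" by blast
  qed
qed

text \<open>Inclusion and exclusion: three lines of \<open>q\<close> points, each vertex counted
  twice.\<close>

lemma card_triangle_sides:
  fixes a b c :: "2 \<Rightarrow> 'a::{field,finite}"
  assumes t: "orient a b c \<noteq> 0"
  shows "card (aline (join a b) \<union> aline (join a c) \<union> aline (join b c)) = 3 * CARD('a) - 3"
proof -
  have d: "a \<noteq> b" "a \<noteq> c" "b \<noteq> c" using t by auto
  let ?A = "aline (join a b)" and ?B = "aline (join a c)" and ?C = "aline (join b c)"
  have q: "CARD('a) \<ge> 2" using card_field_gt_1[where 'a = 'a] by simp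
  have card: "card ?A = CARD('a)" "card ?B = CARD('a)" "card ?C = CARD('a)"
    using card_affine_line affine_line_join d by metis+
  have mem: "a \<in> ?A" "b \<in> ?A" "a \<in> ?B" "c \<in> ?B" "b \<in> ?C" "c \<in> ?C" by (simp_all add: mem_join)
  have out: "c \<notin> ?A" "b \<notin> ?B" "a \<notin> ?C"
    using t orient_swap_right[of a c b] orient_rot[of b c a] by (simp_all add: mem_join)
  have int: "l \<inter> m = {p}" if "affine_line l" "affine_line m" "l \<noteq> m" "p \<in> l" "p \<in> m" for l m :: "(2 \<Rightarrow> 'a) set" and p
    using card_Int_lines[OF that(1-3)] that(4,5) card_le_Suc0_iff_eq[of "l \<inter> m"] by auto
  have lines: "affine_line ?A" "affine_line ?B" "affine_line ?C" using affine_line_join d by blast+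
  have "?A \<inter> ?B = {a}" by (rule int) (use lines mem out in auto)
  moreover have "?A \<inter> ?C = {b}" by (rule int) (use lines mem out in auto)
  moreover have "?B \<inter> ?C = {c}" by (rule int) (use lines mem out in auto)
  ultimately have AB: "card (?A \<inter> ?B) = 1" and "(?A \<union> ?B) \<inter> ?C = {b, c}" by auto
  then have ABC: "card ((?A \<union> ?B) \<inter> ?C) = 2" using d by simp
  have "card (?A \<union> ?B) + 1 = 2 * CARD('a)" using card_Un_Int[of ?A ?B] card AB by simp
  moreover have "card (?A \<union> ?B \<union> ?C) + 2 = card (?A \<union> ?B) + CARD('a)"
    using card_Un_Int[of "?A \<union> ?B" ?C] card ABC by simp
  ultimately show ?thesis by simp
qed

text \<open>A triangle extends to a quadrangle by precisely the points off its three sides.\<close>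

lemma four_card_quadrangles:
  "4 * card (quadrangles :: (2 \<Rightarrow> 'a::{field,finite}) set set)
    = (CARD('a)^2 - (3 * CARD('a) - 3)) * card (triangles :: (2 \<Rightarrow> 'a) set set)"
proof -
  have "Suc 3 * card (quadrangles :: (2 \<Rightarrow> 'a) set set) = (CARD('a)^2 - (3 * CARD('a) - 3)) * card (triangles :: (2 \<Rightarrow> 'a) set set)"
  proof (rule card_extensions)
    fix S :: "(2 \<Rightarrow> 'a) set" assume S: "S \<in> quadrangles"
    then show card: "card S = Suc 3" by (simp add: quadrangles_def)
    show "S - {x} \<in> triangles" if x: "x \<in> S" for x
    proof -
      have "card (S - {x}) = 3" using card x by simp
      moreover from this have "\<not> collinear_points (S - {x})" using S unfolding quadrangles_def by blast
      ultimately show ?thesis by (simp add: triangles_def)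
    qed
  next
    fix T :: "(2 \<Rightarrow> 'a) set" assume "T \<in> triangles"
    then obtain a b c where T: "T = {a, b, c}" "orient a b c \<noteq> 0" using triangles_iff by metis
    have "{x. x \<notin> T \<and> insert x T \<in> quadrangles} = - (aline (join a b) \<union> aline (join a c) \<union> aline (join b c))"
      unfolding T(1) quadrangle_insert_iff[OF T(2)] by auto
    then show "card {x. x \<notin> T \<and> insert x T \<in> quadrangles} = CARD('a)^2 - (3 * CARD('a) - 3)"
      using card_triangle_sides[OF T(2)] card_affine_plane[where 'a = 'a]
      by (simp add: Compl_eq_Diff_UNIV card_Diff_subset)
  qed
  then show ?thesis by simp
qed

text \<open>The passage to real numbers replaces truncated subtraction and integer division by the
  field operations of the closed formula.\<close>

lemma real_card_triangles:
  fixes q :: nat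
  assumes "q = CARD('a::{field,finite})"
  shows "real (card (triangles :: (2 \<Rightarrow> 'a) set set)) = real q ^ 2 * (real q ^ 2 - 1) * (real q ^ 2 - real q) / 6"
proof -
  have "2 * (q^2 choose 2) = q^2 * (q^2 - 1)"
    unfolding choose_two by (intro dvd_mult_div_cancel) auto
  then have "2 * real (q^2 choose 2) = real q ^ 2 * real (q^2 - 1)" by (metis of_nat_mult of_nat_numeral of_nat_power)
  moreover have "q \<ge> 1" using assms by simp
  then have diff: "real (q^2 - 1) = real q ^ 2 - 1" "real (q^2 - q) = real q ^ 2 - real q"
    by (simp_all add: of_nat_diff power2_eq_square)
  moreover have "3 * real (card (triangles :: (2 \<Rightarrow> 'a) set set)) = real (q^2 - q) * real (q^2 choose 2)"
    using arg_cong[OF three_card_triangles[where 'a = 'a], of real] assms by simp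
  then have "6 * real (card (triangles :: (2 \<Rightarrow> 'a) set set)) = real (q^2 - q) * (2 * real (q^2 choose 2))" by simp
  ultimately have "6 * real (card (triangles :: (2 \<Rightarrow> 'a) set set)) = (real q ^ 2 - real q) * (real q ^ 2 * (real q ^ 2 - 1))"
    by (simp only:)
  then show ?thesis by (simp add: mult_ac)
qed

lemma real_card_quadrangles:
  fixes q :: nat
  assumes q: "q = CARD('a::{field,finite})" "q \<ge> 3"
  shows "real (card (quadrangles :: (2 \<Rightarrow> 'a) set set))
    = real q ^ 2 * (real q ^ 2 - 1) * (real q ^ 2 - real q) * (real q ^ 2 - 3 * real q + 3) / 24"
proof -
  \<comment> \<open>This keeps the subtraction of natural numbers \<open>q^2 - (3 * q - 3)\<close>
    from being truncated.\<close>
  have "3 * q \<le> q^2" using q(2) by (simp add: power2_eq_square)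
  then have "real (q^2 - (3 * q - 3)) = real q ^ 2 - 3 * real q + 3"
    using q(2) by (simp add: of_nat_diff)
  moreover have "4 * real (card (quadrangles :: (2 \<Rightarrow> 'a) set set)) = real (q^2 - (3 * q - 3)) * real (card (triangles :: (2 \<Rightarrow> 'a) set set))"
    using arg_cong[OF four_card_quadrangles[where 'a = 'a], of real] q(1) by simp
  ultimately show ?thesis unfolding real_card_triangles[OF q(1)] by (simp add: mult_ac)
qed


section \<open>The evaluation code\<close>

text \<open>On each axis a quadratic polynomial in one variable vanishes at 0, 1 and a third field
  element, hence identically; \<open>q \<ge> 3\<close> supplies that element. The mixed coefficient
  is then the value at \<open>(1, 1)\<close>.\<close>

lemma form_coeffs_eq_if_affine_zero:
  fixes a b c d e g :: "'a::{field,finite}"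
  assumes q: "CARD('a) \<ge> 3"
    and z: "\<And>x y. a * (x * x) + b * (y * y) + c + d * (x * y) + e * x + g * y = 0"
  shows "a = 0 \<and> b = 0 \<and> c = 0 \<and> d = 0 \<and> e = 0 \<and> g = 0"
proof -
  have "\<not> (UNIV :: 'a set) \<subseteq> {0, 1}"
    using q card_mono[of "{0, 1 :: 'a}" UNIV] by auto
  then obtain t :: 'a where t: "t \<noteq> 0" "t \<noteq> 1" by blast
  have two: "a = 0 \<and> e = 0" if "\<And>x. a * (x * x) + e * x = 0" for a e :: 'a
  proof -
    have "a + e = 0" "t * (a * t + e) = 0" using that[of 1] that[of t] by (simp_all add: algebra_simps)
    then have ae: "a + e = 0" "a * t + e = 0" using t(1) by simp_all
    have "a * (t - 1) = (a * t + e) - (a + e)" by (simp add: algebra_simps)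
    then have "a = 0" using ae t(2) by simp
    then show ?thesis using ae by simp
  qed
  have c: "c = 0" using z[of 0 0] by simp
  have ae: "a = 0 \<and> e = 0" by (rule two) (use z[of _ 0] c in simp)
  have bg: "b = 0 \<and> g = 0" by (rule two) (use z[of 0 _] c in simp)
  show ?thesis using z[of 1 1] ae bg c by simp
qed

lemma affine_form_eqI:
  fixes F G :: "(3, 'a::{field,finite}) mpoly"
  assumes q: "CARD('a) \<ge> 3" and hom: "homogeneous 2 F" "homogeneous 2 G"
    and eq: "\<And>p. peval F (aff p) = peval G (aff p)"
  shows "F = G"
proof -
  have "(cf F 0 0 - cf G 0 0) * (x * x) + (cf F 1 1 - cf G 1 1) * (y * y) + (cf F 2 2 - cf G 2 2)
    + (cf F 0 1 - cf G 0 1) * (x * y) + (cf F 0 2 - cf G 0 2) * x + (cf F 1 2 - cf G 1 2) * y = 0" for x y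
    using eq[of "vec2 x y"] unfolding peval_form[OF hom(1)] peval_form[OF hom(2)] by (simp add: algebra_simps)
  from form_coeffs_eq_if_affine_zero[OF q this] show ?thesis by (intro form_eqI hom) auto
qed

lemma mon_degree_le_2_cases:
  fixes m :: "2 \<Rightarrow>\<^sub>0 nat"
  defines "t \<equiv> \<lambda>i::2. single i (1::nat)"
  assumes "mon_degree m \<le> 2"
  shows "m \<in> {t 0 + t 0, t 1 + t 1, 0, t 0 + t 1, t 0, t 1}"
proof -
  let ?l = "lookup m"
  have eq: "m = n \<longleftrightarrow> ?l 0 = lookup n 0 \<and> ?l 1 = lookup n 1" for n
    unfolding poly_mapping_eq_iff fun_eq_2 ..
  have s: "?l 0 + ?l 1 \<le> 2"
    using assms(2) by (simp add: mon_degree_UNIV UNIV_2)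
  then have "?l 0 = 0 \<or> ?l 0 = 1 \<or> ?l 0 = 2" "?l 1 = 0 \<or> ?l 1 = 1 \<or> ?l 1 = 2" by linarith+
  then show ?thesis
    unfolding eq insert_iff t_def using s by (elim disjE) (simp_all add: lookup_add lookup_single)
qed

text \<open>Homogenisation and its inverse, setting \<open>z = 1\<close>, stated for functions so
  that it can be substituted inside the definition of the code.\<close>

lemma peval_degree_le_2_iff:
  fixes h :: "(2 \<Rightarrow> 'a::field) \<Rightarrow> 'a"
  shows "(\<exists>f. total_degree f \<le> 2 \<and> h = peval f) \<longleftrightarrow> (\<exists>F. homogeneous 2 F \<and> h = (\<lambda>p. peval F (aff p)))"
proof
  let ?t = "\<lambda>i::2. single i (1::nat)"
  have dist: "distinct [?t 0 + ?t 0, ?t 1 + ?t 1, 0, ?t 0 + ?t 1, ?t 0, ?t 1]"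
    unfolding distinct.simps list.set insert_iff empty_iff poly_mapping_eq_iff fun_eq_2 lookup_add lookup_single
    by (simp add: when_def)
  have mon: "(\<Prod>i\<in>UNIV. p i ^ lookup (?t k + ?t l) i) = p k * p l"
    "(\<Prod>i\<in>UNIV. p i ^ lookup (0 :: 2 \<Rightarrow>\<^sub>0 nat) i) = 1"
    "(\<Prod>i\<in>UNIV. p i ^ lookup (?t k) i) = p k" for p :: "2 \<Rightarrow> 'a" and k l
    by (simp_all add: lookup_add power_add prod.distrib prod_power_single[simplified])
  {
    assume "\<exists>f. total_degree f \<le> 2 \<and> h = peval f"
    then obtain f where f: "total_degree f \<le> 2" "h = peval f" by blast
    let ?c = "lookup f"
    let ?F = "form (?c (?t 0 + ?t 0)) (?c (?t 1 + ?t 1)) (?c 0) (?c (?t 0 + ?t 1)) (?c (?t 0)) (?c (?t 1))"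
    have "keys f \<subseteq> {?t 0 + ?t 0, ?t 1 + ?t 1, 0, ?t 0 + ?t 1, ?t 0, ?t 1}"
      using f(1) mon_degree_le_2_cases unfolding total_degree_le_iff by blast
    from peval_superset[OF _ this] have "peval f p = peval ?F (aff p)" for p
      unfolding peval_form[OF homogeneous_form] cf_form by (simp only: finite.intros sum_6[OF dist] mon aff_simps mult_1_right simp_thms)
    then show "\<exists>F. homogeneous 2 F \<and> h = (\<lambda>p. peval F (aff p))"
      using homogeneous_form f(2) by blast
  next
    assume "\<exists>F. homogeneous 2 F \<and> h = (\<lambda>p. peval F (aff p))"
    then obtain F where F: "homogeneous 2 F" "h = (\<lambda>p. peval F (aff p))" by blast
    let ?s = "single :: (2 \<Rightarrow>\<^sub>0 nat) \<Rightarrow> 'a \<Rightarrow> _"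
    let ?f = "?s (?t 0 + ?t 0) (cf F 0 0) + ?s (?t 1 + ?t 1) (cf F 1 1) + ?s 0 (cf F 2 2)
      + ?s (?t 0 + ?t 1) (cf F 0 1) + ?s (?t 0) (cf F 0 2) + ?s (?t 1) (cf F 1 2)"
    have h: "h = peval ?f"
      unfolding F(2) peval_form[OF F(1)] peval_add peval_single mon by (simp add: fun_eq_iff)
    have add: "total_degree (f + g) \<le> 2" if "total_degree f \<le> 2" "total_degree g \<le> 2" for f g :: "(2, 'a) mpoly"
      using that keys_add[of f g] unfolding total_degree_le_iff by blast
    have single: "total_degree (?s m c) \<le> 2" if "mon_degree m \<le> 2" for m c
      using that unfolding total_degree_le_iff by (simp add: keys_single)
    have "total_degree ?f \<le> 2"
      by (intro add single) (simp_all add: mon_degree_add, simp add: mon_degree_def)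
    then show "\<exists>f. total_degree f \<le> 2 \<and> h = peval f" using h by blast
  }
qed

lemma RM_code_2_eq:
  "RM_code P 2 = (\<lambda>F. vec (CARD('a)^2) (\<lambda>i. peval F (aff (P (Suc i))))) ` {F :: (3, 'a::{field,finite}) mpoly. homogeneous 2 F}"
proof -
  have "RM_code P 2 = {vec (CARD('a)^2) (\<lambda>i. h (P (Suc i))) | h. \<exists>f. total_degree f \<le> 2 \<and> h = peval f}"
    unfolding RM_code_def eval_vec_def by blast
  also have "\<dots> = {vec (CARD('a)^2) (\<lambda>i. h (P (Suc i))) | h. \<exists>F. homogeneous 2 F \<and> h = (\<lambda>p. peval F (aff p))}"
    unfolding peval_degree_le_2_iff ..
  finally show ?thesis by auto
qed

section \<open>Translation from point sets to index sets\<close>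

locale parity_check_setup =
  fixes P :: "nat \<Rightarrow> (2 \<Rightarrow> 'a::{field,finite})" and H :: "'a mat" and E :: "nat set"
  assumes E: "E = {1..CARD('a)^2}" and P: "bij_betw P E UNIV"
    and H: "parity_check_matrix (CARD('a)^2) (conic_code P) H"
begin

abbreviation "M \<equiv> parity_check_matroid H"

lemma dim_H: "dim_col H = CARD('a)^2" and kernel: "mat_kernel H = conic_code P"
  using H by (auto simp: parity_check_matrix_def)

lemma index_compl_eq: "index_compl P Z = {j \<in> E. P j \<notin> Z}"
  by (simp add: index_compl_def E)

lemma P_onto: obtains j where "j \<in> E" "P j = p"
  using P by (metis UNIV_I bij_betw_imp_surj_on imageE)

text \<open>Complementation reverses inclusion, so minimal index sets correspond to maximal point
  sets.\<close>

lemma index_compl_subset_iff: "index_compl P Z \<subseteq> index_compl P W \<longleftrightarrow> W \<subseteq> Z"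
proof
  assume sub: "index_compl P Z \<subseteq> index_compl P W"
  show "W \<subseteq> Z"
  proof
    fix p assume "p \<in> W"
    moreover obtain j where "j \<in> E" "P j = p" by (rule P_onto)
    ultimately show "p \<in> Z" using sub by (auto simp: index_compl_eq)
  qed
qed (auto simp: index_compl_eq)

lemma inj_index_compl: "inj (index_compl P)"
  by (rule injI) (metis equalityI index_compl_subset_iff order_refl)

lemma subset_E_cases:
  assumes "\<sigma> \<subseteq> E" obtains Z where "\<sigma> = index_compl P Z"
proof -
  have inj: "inj_on P E" using P by (rule bij_betw_imp_inj_on)
  have "\<sigma> = index_compl P (- P ` \<sigma>)"
    using assms inj_onD[OF inj] by (auto simp: index_compl_eq)
  then show ?thesis by (rule that)
qed

lemma card_index_compl: "card (index_compl P Z) = card (- Z)"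
proof -
  have "bij_betw P (index_compl P Z) (- Z)"
    unfolding bij_betw_def
  proof
    show "inj_on P (index_compl P Z)"
      by (rule inj_on_subset[OF bij_betw_imp_inj_on[OF P]]) (auto simp: index_compl_eq)
    show "P ` index_compl P Z = - Z"
    proof
      show "- Z \<subseteq> P ` index_compl P Z"
      proof
        fix p assume "p \<in> - Z"
        moreover obtain j where "j \<in> E" "P j = p" by (rule P_onto)
        ultimately show "p \<in> P ` index_compl P Z" by (auto simp: index_compl_eq)
      qed
    qed (auto simp: index_compl_eq)
  qed
  then show ?thesis by (rule bij_betw_same_card)
qed

text \<open>Codewords supported on the complement of \<open>Z\<close> are the evaluations of the
  quadrics vanishing on \<open>Z\<close>, and for \<open>q \<ge> 3\<close> evaluation is injective
  on forms.\<close>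

lemma nullity_index_compl:
  assumes q: "CARD('a) \<ge> 3"
  shows "CARD('a) ^ nullity M (index_compl P Z) = card (vanishing Z)"
proof -
  let ?n = "CARD('a)^2"
  let ?ev = "\<lambda>F. vec ?n (\<lambda>i. peval F (aff (P (Suc i))))"
  have ker: "mat_kernel H = ?ev ` {F. homogeneous 2 F}"
    using q by (simp add: kernel conic_code_def RM_code_2_eq)
  have ev: "?ev F $ (j - 1) = peval F (aff (P j))" if "j \<in> E" for F j
  proof -
    have "j - 1 < ?n" "Suc (j - 1) = j" using that by (auto simp: E)
    then show ?thesis by simp
  qed
  have inj: "inj_on ?ev {F. homogeneous 2 F}"
  proof (rule inj_onI)
    fix F G assume FG: "F \<in> {F. homogeneous 2 F}" "G \<in> {F. homogeneous 2 F}" "?ev F = ?ev G"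
    have "peval F (aff p) = peval G (aff p)" for p
    proof -
      obtain j where "j \<in> E" "P j = p" by (rule P_onto)
      then show ?thesis using ev[of j F] ev[of j G] FG(3) by simp
    qed
    then show "F = G" using affine_form_eqI[OF q] FG(1,2) by blast
  qed
  have "{c \<in> mat_kernel H. \<forall>j\<in>E - index_compl P Z. c $ (j - 1) = 0} = ?ev ` vanishing Z" (is "?L = _")
  proof -
    have "(\<forall>j\<in>E - index_compl P Z. ?ev F $ (j - 1) = 0) \<longleftrightarrow> (\<forall>p\<in>Z. peval F (aff p) = 0)" for F
    proof
      assume z: "\<forall>j\<in>E - index_compl P Z. ?ev F $ (j - 1) = 0"
      show "\<forall>p\<in>Z. peval F (aff p) = 0"
      proof
        fix p assume "p \<in> Z"
        moreover obtain j where "j \<in> E" "P j = p" by (rule P_onto)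
        ultimately show "peval F (aff p) = 0" using z ev[of j F] by (auto simp: index_compl_eq)
      qed
    next
      assume "\<forall>p\<in>Z. peval F (aff p) = 0"
      then show "\<forall>j\<in>E - index_compl P Z. ?ev F $ (j - 1) = 0" using ev[of _ F] by (auto simp: index_compl_eq)
    qed
    then show ?thesis unfolding ker vanishing_def by blast
  qed
  then have "card ?L = card (vanishing Z)"
    using inj by (simp add: card_image inj_on_subset[OF inj] vanishing_def subset_eq)
  moreover have "card ?L = CARD('a) ^ nullity M (index_compl P Z)"
  proof -
    have "index_compl P Z \<subseteq> {1..dim_col H}" by (auto simp: index_compl_eq dim_H E)
    from card_kernel_nullity[OF this] show ?thesis by (simp only: dim_H E)
  qed
  ultimately show ?thesis by simp
qed

lemma nullity_sets_eq:
  assumes q: "CARD('a) \<ge> 3"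
  shows "nullity_sets E M i = index_compl P ` {Z. card (vanishing Z) = CARD('a) ^ i}"
proof -
  have iff: "nullity M (index_compl P Z) = i \<longleftrightarrow> card (vanishing Z) = CARD('a) ^ i" for Z
    unfolding nullity_index_compl[OF q, symmetric] using q by (simp add: power_inject_exp)
  show ?thesis
  proof (intro equalityI subsetI)
    fix \<sigma> assume s: "\<sigma> \<in> nullity_sets E M i"
    then obtain Z where "\<sigma> = index_compl P Z" using subset_E_cases by (auto simp: nullity_sets_def)
    then show "\<sigma> \<in> index_compl P ` {Z. card (vanishing Z) = CARD('a) ^ i}"
      using s iff by (auto simp: nullity_sets_def)
  next
    fix \<sigma> assume "\<sigma> \<in> index_compl P ` {Z. card (vanishing Z) = CARD('a) ^ i}"
    then show "\<sigma> \<in> nullity_sets E M i" using iff by (auto simp: nullity_sets_def index_compl_eq)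
  qed
qed

text \<open>The base locus of \<open>Z\<close> is the largest set with the same quadrics as
  \<open>Z\<close>. Hence \<open>Z\<close> is maximal among sets with its number of quadrics exactly
  when it is closed.\<close>

lemma minimal_nullity_sets:
  assumes q: "CARD('a) \<ge> 3"
  shows "minimal_sets (nullity_sets E M i) = index_compl P ` {Z. flat i Z}"
proof -
  have iff: "(\<forall>W. card (vanishing W) = CARD('a) ^ i \<longrightarrow> Z \<subseteq> W \<longrightarrow> W = Z) \<longleftrightarrow> base_locus Z = Z"
    if Z: "card (vanishing Z) = CARD('a) ^ i" for Z :: "(2 \<Rightarrow> 'a) set"
  proof
    assume "\<forall>W. card (vanishing W) = CARD('a) ^ i \<longrightarrow> Z \<subseteq> W \<longrightarrow> W = Z"
    moreover have "card (vanishing (base_locus Z)) = CARD('a) ^ i" by (simp add: Z)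
    ultimately show "base_locus Z = Z" using subset_base_locus[of Z] by blast
  next
    assume Zc: "base_locus Z = Z"
    show "\<forall>W. card (vanishing W) = CARD('a) ^ i \<longrightarrow> Z \<subseteq> W \<longrightarrow> W = Z"
    proof (intro allI impI)
      fix W :: "(2 \<Rightarrow> 'a) set" assume W: "card (vanishing W) = CARD('a) ^ i" "Z \<subseteq> W"
      have "vanishing W = vanishing Z"
        using vanishing_mono[OF W(2)] W(1) Z by (intro card_subset_eq[OF finite_vanishing]) auto
      then have "W \<subseteq> base_locus Z" using subset_base_locus[of W] base_locus_eqI by metis
      then show "W = Z" using Zc W(2) by simp
    qed
  qed
  have "minimal_sets (nullity_sets E M i) =
    index_compl P ` {Z. card (vanishing Z) = CARD('a) ^ i \<and> (\<forall>W. card (vanishing W) = CARD('a) ^ i \<longrightarrow> Z \<subseteq> W \<longrightarrow> W = Z)}"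
    unfolding minimal_sets_def nullity_sets_eq[OF q] ball_simps index_compl_subset_iff
    using inj_index_compl by (auto simp: index_compl_subset_iff inj_eq)
  also have "{Z :: (2 \<Rightarrow> 'a) set. card (vanishing Z) = CARD('a) ^ i \<and> (\<forall>W. card (vanishing W) = CARD('a) ^ i \<longrightarrow> Z \<subseteq> W \<longrightarrow> W = Z)}
    = {Z. flat i Z}"
    unfolding flat_def using iff by blast
  finally show ?thesis .
qed

lemma minimal_N_1:
  assumes q: "CARD('a) \<ge> 3"
  shows "minimal_sets (nullity_sets E M 1) = {index_compl P (affine_part C) | C.
    conic_type_e C \<or> conic_type_d C \<or> (\<exists>k\<le>2. k + 4 \<le> CARD('a) \<and> conic_meeting_infinity k C)}"
  unfolding minimal_nullity_sets[OF q] flat_1_iff_conic[OF q] by blast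

section \<open>The field with two elements\<close>

lemma UNIV_field_2:
  assumes q: "CARD('a) = 2" shows "(UNIV :: 'a set) = {0, 1}"
  by (rule sym, rule card_subset_eq) (use q in auto)

text \<open>Every function on the four points of the plane is interpolated by the four given
  monomials.\<close>

lemma conic_code_2:
  assumes q: "CARD('a) = 2" shows "conic_code P = carrier_vec (CARD('a)^2)"
proof -
  let ?n = "CARD('a)^2"
  let ?S = "eval_vec P ` {pvar 0 ^ 2, pvar 0 * pvar 1, pvar 1 ^ 2, 1}"
  interpret vec_space "TYPE('a)" ?n .
  have S: "?S \<subseteq> carrier_vec ?n" by (auto simp: eval_vec_def)
  have code: "conic_code P = span ?S" using q by (simp add: conic_code_def)
  have "c \<in> span ?S" if c: "c \<in> carrier_vec ?n" for c
  proof -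
    \<comment> \<open>The word as a function on points: \<open>inv_into E P\<close> returns an index
      starting at 1, while vector entries start at 0.\<close>
    define g where "g = (\<lambda>p. c $ (inv_into E P p - 1))"
    \<comment> \<open>Moebius inversion on the four points, using that 0 and 1 equal their own
      squares.\<close>
    let ?a = "g (vec2 0 0)" and ?b = "g (vec2 1 0) - g (vec2 0 0)" and ?d = "g (vec2 0 1) - g (vec2 0 0)"
      and ?e = "g (vec2 1 1) - g (vec2 1 0) - g (vec2 0 1) + g (vec2 0 0)"
    have g: "g p = ?b * p 0 ^ 2 + (?e * (p 0 * p 1) + (?d * p 1 ^ 2 + ?a))" for p
    proof -
      have "p = vec2 (p 0) (p 1)" by (simp add: fun_eq_2)
      moreover have "p 0 \<in> {0, 1}" "p 1 \<in> {0, 1}" using UNIV_field_2[OF q] by blast+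
      ultimately show ?thesis by (elim insertE emptyE; simp)
    qed
    let ?w = "?b \<cdot>\<^sub>v eval_vec P (pvar 0 ^ 2) + (?e \<cdot>\<^sub>v eval_vec P (pvar 0 * pvar 1) + (?d \<cdot>\<^sub>v eval_vec P (pvar 1 ^ 2) + ?a \<cdot>\<^sub>v eval_vec P 1))"
    have "c = ?w"
    proof (rule eq_vecI)
      fix i assume "i < dim_vec ?w"
      then have i: "i < ?n" by (simp add: eval_vec_def)
      then have "Suc i \<in> E" by (simp add: E)
      then have "g (P (Suc i)) = c $ i"
        unfolding g_def using inv_into_f_f[OF bij_betw_imp_inj_on[OF P]] by simp
      then show "c $ i = ?w $ i"
        using g[of "P (Suc i)"] i by (simp add: eval_vec_def peval_power peval_mult)
    qed (use c in \<open>simp add: eval_vec_def\<close>)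
    moreover have mem: "a \<cdot>\<^sub>v v \<in> span ?S" if "v \<in> ?S" for a v
      by (rule smult_in_span[OF S span_mem[OF S that]])
    have "?w \<in> span ?S"
      by (intro span_add1[OF S] mem) auto
    ultimately show ?thesis by simp
  qed
  moreover have "span ?S \<subseteq> carrier_vec ?n" using span_closed[OF S] by blast
  ultimately show ?thesis using code by blast
qed

text \<open>All unit vectors are codewords, so every single column is dependent and only the empty
  set is independent.\<close>

lemma nullity_2:
  assumes q: "CARD('a) = 2" and s: "\<sigma> \<subseteq> E"
  shows "nullity M \<sigma> = card \<sigma>"
proof -
  have "\<tau> = {}" if t: "\<tau> \<in> M" for \<tau>
  proof (rule ccontr)
    assume "\<tau> \<noteq> {}"
    then obtain j where j: "j \<in> \<tau>" by blast
    have sub: "\<tau> \<subseteq> {1..dim_col H}" using t by (auto simp: parity_check_matroid_def)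
    then have j1: "j \<in> {1..dim_col H}" using j by blast
    let ?c = "unit_vec (dim_col H) (j - 1) :: 'a vec"
    have "?c \<in> mat_kernel H" unfolding kernel conic_code_2[OF q] by (simp add: dim_H)
    moreover have "\<forall>i\<in>{1..dim_col H} - \<tau>. ?c $ (i - 1) = 0"
    proof
      fix i assume i: "i \<in> {1..dim_col H} - \<tau>"
      then have "i \<noteq> j" using j by blast
      then have "i - 1 \<noteq> j - 1" "i - 1 < dim_col H" "j - 1 < dim_col H" using i j1 by auto
      then show "?c $ (i - 1) = 0" by simp
    qed
    ultimately have "?c = 0\<^sub>v (dim_col H)" using t unfolding parity_check_matroid_iff[OF sub] by blast
    moreover have "j - 1 < dim_col H" using j1 by auto
    ultimately show False by (metis index_unit_vec(2) index_zero_vec(1) zero_neq_one)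
  qed
  moreover have "{} \<in> M"
  proof (subst parity_check_matroid_iff)
    show "\<forall>c\<in>mat_kernel H. (\<forall>j\<in>{1..dim_col H} - {}. c $ (j - 1) = 0) \<longrightarrow> c = 0\<^sub>v (dim_col H)"
    proof (intro ballI impI eq_vecI)
      fix c i assume c: "\<forall>j\<in>{1..dim_col H} - {}. c $ (j - 1) = 0" and "i < dim_vec (0\<^sub>v (dim_col H) :: 'a vec)"
      then show "c $ i = 0\<^sub>v (dim_col H) $ i" using bspec[OF c, of "Suc i"] by simp
    qed (simp add: mat_kernel_def)
  qed simp
  ultimately have "{I \<in> M. I \<subseteq> \<sigma>} = {{}}" by auto
  then show ?thesis by (simp add: nullity_def matroid_rank_def)
qed

lemma minimal_nullity_sets_2:
  assumes q: "CARD('a) = 2"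
  shows "minimal_sets (nullity_sets E M i) = {\<sigma>. \<sigma> \<subseteq> E \<and> card \<sigma> = i}"
proof -
  have eq: "nullity_sets E M i = {\<sigma>. \<sigma> \<subseteq> E \<and> card \<sigma> = i}"
    using nullity_2[OF q] by (auto simp: nullity_sets_def)
  have "finite E" by (simp add: E)
  then have "\<tau> = \<sigma>" if "\<sigma> \<subseteq> E" "\<tau> \<subseteq> \<sigma>" "card \<tau> = card \<sigma>" for \<sigma> \<tau>
    using that by (meson card_subset_eq finite_subset)
  then show ?thesis unfolding eq minimal_sets_def by auto
qed

text \<open>Here lines have two points, so any three points \<open>a\<close>, \<open>b\<close>,
  \<open>c\<close> form the union of the lines \<open>ab\<close> and \<open>ac\<close>, which meet
  in \<open>a\<close> and give type (d). Conversely, three affine points leave a complement of one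
  point.\<close>

lemma minimal_N_1_2:
  assumes q: "CARD('a) = 2"
  shows "minimal_sets (nullity_sets E M 1) = {index_compl P (affine_part C) | C.
    (conic_type_d C \<or> conic_type_h C) \<and> card (affine_part C) = 3}"
proof -
  have compl: "card (index_compl P Z) = 4 - card Z" for Z
    using card_affine_plane[where 'a = 'a] q by (simp add: card_index_compl Compl_eq_Diff_UNIV card_Diff_subset)
  show ?thesis
    unfolding minimal_nullity_sets_2[OF q]
  proof (intro equalityI subsetI)
    fix \<sigma> assume "\<sigma> \<in> {\<sigma>. \<sigma> \<subseteq> E \<and> card \<sigma> = 1}"
    then have s: "\<sigma> \<subseteq> E" "card \<sigma> = 1" by auto
    obtain Z where Z: "\<sigma> = index_compl P Z" using subset_E_cases[OF s(1)] .
    then have "4 - card Z = 1" using compl s(2) by simp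
    then have card: "card Z = 3" by simp
    then obtain a b c where abc: "Z = {a, b, c}" "a \<noteq> b" "a \<noteq> c" "b \<noteq> c" by (auto simp: card_3_iff)
    have line: "aline (join x y) = {x, y}" if "x \<noteq> y" for x y :: "2 \<Rightarrow> 'a"
      by (rule sym, rule card_subset_eq)
        (use that card_affine_line[OF affine_line_join[OF that]] q in \<open>auto simp: mem_join\<close>)
    have "aline (join a b) \<noteq> aline (join a c)" unfolding line[OF abc(2)] line[OF abc(3)] using abc by auto
    then obtain C where C: "if aline (join a b) \<inter> aline (join a c) = {} then conic_type_e C else conic_type_d C"
      "affine_part C = aline (join a b) \<union> aline (join a c)"
      using line_pair_type[OF affine_line_join[OF abc(2)] affine_line_join[OF abc(3)]] by metis
    have "conic_type_d C" using C(1) unfolding line[OF abc(2)] line[OF abc(3)] by simp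
    moreover have "affine_part C = Z" unfolding C(2) line[OF abc(2)] line[OF abc(3)] abc(1) by auto
    ultimately show "\<sigma> \<in> {index_compl P (affine_part C) | C. (conic_type_d C \<or> conic_type_h C) \<and> card (affine_part C) = 3}"
      using Z card by blast
  next
    fix \<sigma> assume "\<sigma> \<in> {index_compl P (affine_part C) | C. (conic_type_d C \<or> conic_type_h C) \<and> card (affine_part C) = 3}"
    then show "\<sigma> \<in> {\<sigma>. \<sigma> \<subseteq> E \<and> card \<sigma> = 1}" using compl by (auto simp: index_compl_eq)
  qed
qed

end

theorem theorem5p2:
  fixes P :: "nat \<Rightarrow> (2 \<Rightarrow> 'a::{field,finite})"
    and H :: "'a mat"
    and q :: nat and E :: "nat set" and N :: "nat \<Rightarrow> nat set set"
  assumes q: "q = CARD('a)"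
    and E: "E = {1..q ^ 2}"
    and P: "bij_betw P E UNIV"
    and H: "parity_check_matrix (q ^ 2) (conic_code P) H"
    and N: "\<And>i. N i = nullity_sets E (parity_check_matroid H) i"
  shows
    "(q \<ge> 7 \<longrightarrow> minimal_sets (N 1) =
        {index_compl P (affine_part C) | C. conic_type_e C \<or> conic_type_d C \<or>
           conic_type_h C \<or> conic_type_g C \<or> conic_type_f C}) \<and>
     (q = 5 \<longrightarrow> minimal_sets (N 1) =
        {index_compl P (affine_part C) | C. conic_type_e C \<or> conic_type_d C \<or>
           conic_type_h C \<or> conic_type_g C}) \<and>
     (q = 4 \<longrightarrow> minimal_sets (N 1) =
        {index_compl P (affine_part C) | C. conic_type_e C \<or> conic_type_d C \<or>
           conic_type_h C}) \<and>
     (q = 3 \<longrightarrow> minimal_sets (N 1) =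
        {index_compl P (affine_part C) | C. conic_type_e C \<or> conic_type_d C}) \<and>
     (q = 2 \<longrightarrow> minimal_sets (N 1) =
        {index_compl P (affine_part C) | C. (conic_type_d C \<or> conic_type_h C) \<and>
           card (affine_part C) = 3}) \<and>
     (q \<ge> 3 \<longrightarrow>
       minimal_sets (N 2) =
         index_compl P ` line_and_point_sets \<union> index_compl P ` quadrangles \<and>
       real (card (index_compl P ` line_and_point_sets)) =
         (real q ^ 2 + real q) * (real q ^ 2 - real q) \<and>
       real (card (index_compl P ` quadrangles)) =
         real q ^ 2 * (real q ^ 2 - 1) * (real q ^ 2 - real q) *
           (real q ^ 2 - 3 * real q + 3) / 24 \<and>
       minimal_sets (N 3) =
         index_compl P ` {l. affine_line l} \<union> index_compl P ` triangles \<and>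
       card (index_compl P ` {l. affine_line l}) = q ^ 2 + q \<and>
       real (card (index_compl P ` triangles)) =
         real q ^ 2 * (real q ^ 2 - 1) * (real q ^ 2 - real q) / 6 \<and>
       minimal_sets (N 4) = index_compl P ` {S. card S = 2} \<and>
       card (index_compl P ` {S. card S = 2}) = (q ^ 2) choose 2 \<and>
       minimal_sets (N 5) = {index_compl P {p} | p. True} \<and>
       card {index_compl P {p} | p. True} = q ^ 2 \<and>
       N 6 = {E} \<and> minimal_sets (N 6) = {E}) \<and>
     (q = 2 \<longrightarrow> (\<forall>i\<le>4. minimal_sets (N i) = {\<sigma>. \<sigma> \<subseteq> E \<and> card \<sigma> = i}))"
proof -
  interpret parity_check_setup P H E
    using E P H unfolding q by unfold_locales
  \<comment> \<open>With \<open>k + 4 \<le> q\<close>, the values 0, 1, 2 of \<open>k\<close> become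
    available at \<open>q = 4\<close>, 5, 6 respectively; this is the source of the case distinction
    on \<open>q\<close>.\<close>
  have le_2: "k \<le> 2 \<longleftrightarrow> k = 0 \<or> k = 1 \<or> k = 2" for k :: nat by auto
  note types = conic_type_f_iff conic_type_g_iff conic_type_h_iff
  have N1: "minimal_sets (N 1) = {index_compl P (affine_part C) | C.
    conic_type_e C \<or> conic_type_d C \<or> (\<exists>k\<le>2. k + 4 \<le> q \<and> conic_meeting_infinity k C)}" if "q \<ge> 3"
    using minimal_N_1 that by (simp add: N q)
  have a7: "minimal_sets (N 1) = {index_compl P (affine_part C) | C. conic_type_e C \<or> conic_type_d C \<or>
           conic_type_h C \<or> conic_type_g C \<or> conic_type_f C}" if "q \<ge> 7"
  proof -
    have "(\<exists>k\<le>2. k + 4 \<le> q \<and> conic_meeting_infinity k C) \<longleftrightarrow> conic_type_h C \<or> conic_type_g C \<or> conic_type_f C"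
      for C :: "(3 \<Rightarrow> 'a) set set"
      unfolding types le_2 using that by auto
    then show ?thesis using N1 that by simp
  qed
  have a5: "minimal_sets (N 1) = {index_compl P (affine_part C) | C. conic_type_e C \<or> conic_type_d C \<or>
           conic_type_h C \<or> conic_type_g C}" if "q = 5"
  proof -
    have "(\<exists>k\<le>2. k + 4 \<le> q \<and> conic_meeting_infinity k C) \<longleftrightarrow> conic_type_h C \<or> conic_type_g C"
      for C :: "(3 \<Rightarrow> 'a) set set"
      unfolding types le_2 using that by auto
    then show ?thesis using N1 that by simp
  qed
  have a4: "minimal_sets (N 1) = {index_compl P (affine_part C) | C. conic_type_e C \<or> conic_type_d C \<or>
           conic_type_h C}" if "q = 4"
  proof -
    have "(\<exists>k\<le>2. k + 4 \<le> q \<and> conic_meeting_infinity k C) \<longleftrightarrow> conic_type_h C"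
      for C :: "(3 \<Rightarrow> 'a) set set"
      unfolding types le_2 using that by auto
    then show ?thesis using N1 that by simp
  qed
  have a3: "minimal_sets (N 1) = {index_compl P (affine_part C) | C. conic_type_e C \<or> conic_type_d C}" if "q = 3"
    using N1 that by simp
  have a2: "minimal_sets (N 1) = {index_compl P (affine_part C) | C. (conic_type_d C \<or> conic_type_h C) \<and>
           card (affine_part C) = 3}" if "q = 2"
    using minimal_N_1_2 that by (simp add: N q)
  \<comment> \<open>Complementation is injective, so the numbers of point configurations are also
    the numbers of minimal sets.\<close>
  have card_img: "card (index_compl P ` \<Z>) = card \<Z>" for \<Z>
    by (rule card_image[OF inj_on_subset[OF inj_index_compl subset_UNIV]])
  have min: "minimal_sets (N i) = index_compl P ` {Z. flat i Z}" if "q \<ge> 3" for i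
    using minimal_nullity_sets that by (simp add: N q)
  have b: "minimal_sets (N 2) = index_compl P ` line_and_point_sets \<union> index_compl P ` quadrangles"
    "minimal_sets (N 3) = index_compl P ` {l. affine_line l} \<union> index_compl P ` triangles"
    "minimal_sets (N 4) = index_compl P ` {S. card S = 2}"
    "minimal_sets (N 5) = {index_compl P {p} | p. True}"
    "minimal_sets (N 6) = {E}" if q3: "q \<ge> 3"
  proof -
    have q3': "CARD('a) \<ge> 3" using q3 q by simp
    show "minimal_sets (N 2) = index_compl P ` line_and_point_sets \<union> index_compl P ` quadrangles"
      unfolding min[OF q3] flat_2_iff[OF q3'] by blast
    show "minimal_sets (N 3) = index_compl P ` {l. affine_line l} \<union> index_compl P ` triangles"
      unfolding min[OF q3] flat_3_iff[OF q3'] by blast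
    show "minimal_sets (N 4) = index_compl P ` {S. card S = 2}"
      unfolding min[OF q3] flat_4_iff ..
    show "minimal_sets (N 5) = {index_compl P {p} | p. True}"
      unfolding min[OF q3] flat_5_iff by blast
    show "minimal_sets (N 6) = {E}"
      unfolding min[OF q3] flat_6_iff by (auto simp: index_compl_eq)
  qed
  have N6: "N 6 = {E}" if "q \<ge> 3"
  proof -
    have "CARD('a) \<ge> 3" using that q by simp
    then show ?thesis
      unfolding N by (simp add: nullity_sets_eq card_vanishing_eq_6_iff index_compl_eq)
  qed
  have "real (card (index_compl P ` line_and_point_sets)) = (real q ^ 2 + real q) * (real q ^ 2 - real q)" if "q \<ge> 3"
  proof -
    have "q \<le> q^2" by (simp add: power2_eq_square)
    then show ?thesis
      using card_line_and_point_sets[where 'a = 'a] that unfolding card_img q[symmetric] by (simp add: of_nat_diff)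
  qed
  moreover have "{index_compl P {p} | p. True} = index_compl P ` range (\<lambda>p. {p})" by blast
  then have "card {index_compl P {p} | p. True} = q ^ 2"
    using card_affine_plane[where 'a = 'a] q by (simp only: card_img) (simp add: card_image)
  moreover have "card (index_compl P ` {l. affine_line l}) = q ^ 2 + q"
    "card (index_compl P ` {S. card S = 2}) = (q ^ 2) choose 2"
    unfolding card_img q by (rule card_affine_lines card_pairs)+
  moreover have "minimal_sets (N i) = {\<sigma>. \<sigma> \<subseteq> E \<and> card \<sigma> = i}" if "q = 2" for i
    using minimal_nullity_sets_2 that by (simp add: N q)
  ultimately show ?thesis
    using a7 a5 a4 a3 a2 b N6 real_card_triangles[OF q] real_card_quadrangles[OF q] by (simp add: card_img)
qed

end
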